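(* The class of groups with the fixed-point property for cones is closed under the following operations: (0) quotients: if $G$ has the property, so does every quotient group of $G$; (1) subgroups: if $G$ has the property, so does every subgroup of $G$; (2) directed unions: if $G$ is the union of a family of subgroups that is directed with respect to inclusion, each of which has the property, then $G$ has the property; (3) Cartesian products with subexponential groups: if $G$ has the property and $H$ is a subexponential group, then $G\times H$ has the property; (4) central extensions: if $Z$ is a central subgroup of $G$ and $G/Z$ has the property, then $G$ has the property; (5) extensions by and of finite groups: if $N\lhd G$ is a normal subgroup such that one of the two groups $N$, $G/N$ is finite and the other has the property, then $G$ has the property.
   Context: Groups are abstract (discrete) groups; vector spaces are real; topological vector spaces are assumed locally convex and Hausdorff. A convex cone $C\subseteq E$ is a subset with $C+C\subseteq C$ and $\mathbf{R}_+C\subseteq C$; it is proper if $C\cap(-C)=\{0\}$. It is weakly complete if it is complete for the uniform structure induced by the weak topology $\sigma(E,E')$. The topological dual $E'$ carries the dual pre-order: $\lambda\geq 0$ iff $\lambda(c)\geq0$ for all $c\in C$. A $G$-representation on a cone $C\subseteq E$ is an action of $G$ on $E$ by continuous linear maps preserving $C$; $E'$ has the dual representation $(g\varphi)(x)=\varphi(g^{-1}x)$. The representation is of locally bounded type if there is $x\neq 0$ in $C$ whose orbit $Gx$ is bounded in the sense of topological vector spaces (absorbed by every neighbourhood of zero). It is of cobounded type if there is $\varphi\in E'$ such that for every $\lambda\in E'$ there are $g_1,\ldots,g_n\in G$ with $\pm\lambda\leq\sum_i g_i\varphi$. $G$ has the fixed-point property for cones if every $G$-representation of locally bounded cobounded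 type on any weakly complete proper convex cone $C$ has a non-zero fixed point in $C$. A group $H$ is subexponential if $\lim_{n\to\infty}|S^n|^{1/n}=1$ for every finite (non-empty) subset $S\subseteq H$, where $S^n$ is the set of $n$-fold products of elements of $S$. *)

theory Defs
  imports "HOL-Analysis.Analysis" "HOL-Algebra.Group_Action"
begin

section \<open>Locally convex Hausdorff spaces\<close>

text \<open>
  A vector space is given by a linear subspace \<open>E\<close> of a type \<open>'e\<close> of class \<open>real_vector\<close>; its
  topology is a value \<open>T\<close> of type \<open>'e topology\<close> and not the one of a type class, so that one can
  quantify over all vector space topologies on all subspaces of \<open>'e\<close>.
\<close>

definition linear_into :: "'e::real_vector set \<Rightarrow> ('e \<Rightarrow> 'f::real_vector) \<Rightarrow> bool" where
  "linear_into E f \<longleftrightarrow>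
     (\<forall>x\<in>E. \<forall>y\<in>E. f (x + y) = f x + f y) \<and> (\<forall>c. \<forall>x\<in>E. f (c *\<^sub>R x) = c *\<^sub>R f x)"

definition lc_hausdorff_tvs :: "'e::real_vector set \<Rightarrow> 'e topology \<Rightarrow> bool" where
  "lc_hausdorff_tvs E T \<longleftrightarrow>
     subspace E \<and> topspace T = E \<and>
     continuous_map (prod_topology T T) T (\<lambda>(x, y). x + y) \<and>
     continuous_map (prod_topology euclideanreal T) T (\<lambda>(c, x). c *\<^sub>R x) \<and>
     Hausdorff_space T \<and>
     neighbourhood_base_at 0 convex T"

text \<open>Only the values of a functional on \<open>E\<close> are relevant; they are arbitrary outside \<open>E\<close>.\<close>

definition top_dual :: "'e::real_vector set \<Rightarrow> 'e topology \<Rightarrow> ('e \<Rightarrow> real) set" where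
  "top_dual E T = {\<phi>. linear_into E \<phi> \<and> continuous_map T euclideanreal \<phi>}"

definition tvs_bounded :: "'e::real_vector topology \<Rightarrow> 'e set \<Rightarrow> bool" where
  "tvs_bounded T B \<longleftrightarrow>
     (\<forall>U. openin T U \<and> 0 \<in> U \<longrightarrow> (\<exists>r>0. \<forall>c. r \<le> \<bar>c\<bar> \<longrightarrow> B \<subseteq> (\<lambda>x. c *\<^sub>R x) ` U))"


section \<open>Weakly complete proper convex cones\<close>

definition proper_convex_cone :: "'e::real_vector set \<Rightarrow> 'e set \<Rightarrow> bool" where
  "proper_convex_cone E C \<longleftrightarrow>
     C \<subseteq> E \<and> cone C \<and> (\<forall>x\<in>C. \<forall>y\<in>C. x + y \<in> C) \<and> C \<inter> uminus ` C = {0}"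

text \<open>
  The uniform structure of the weak topology \<open>\<sigma>(E, E')\<close> is the initial one for the maps
  \<open>\<phi> : E \<rightarrow> \<real>\<close> in \<open>E'\<close>. Completeness follows the library definition for the
  type class \<open>uniform_space\<close> (\<open>cauchy_filter\<close>, \<open>complete_uniform\<close>), which does not apply here
  because the topology is not attached to the type.
\<close>

definition weak_uniformity :: "'e::real_vector set \<Rightarrow> 'e topology \<Rightarrow> ('e \<times> 'e) filter" where
  "weak_uniformity E T = (INF \<phi>\<in>top_dual E T. filtercomap (map_prod \<phi> \<phi>) uniformity)"

definition weak_nhds :: "'e::real_vector set \<Rightarrow> 'e topology \<Rightarrow> 'e \<Rightarrow> 'e filter" where
  "weak_nhds E T x = (INF \<phi>\<in>top_dual E T. filtercomap \<phi> (nhds (\<phi> x)))"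

definition weakly_complete :: "'e::real_vector set \<Rightarrow> 'e topology \<Rightarrow> 'e set \<Rightarrow> bool" where
  "weakly_complete E T C \<longleftrightarrow>
     (\<forall>F. F \<le> principal C \<and> F \<noteq> bot \<and> F \<times>\<^sub>F F \<le> weak_uniformity E T
        \<longrightarrow> (\<exists>x\<in>C. F \<le> weak_nhds E T x))"


section \<open>Representations on cones\<close>

text \<open>
  \<open>group_action\<close> makes every \<open>\<rho> g\<close> extensional, i.e. \<open>undefined\<close> outside \<open>E\<close>; this only
  normalizes irrelevant values.
\<close>

definition cone_representation ::
  "('g, 'm) monoid_scheme \<Rightarrow> 'e::real_vector set \<Rightarrow> 'e topology \<Rightarrow> 'e set \<Rightarrow> ('g \<Rightarrow> 'e \<Rightarrow> 'e) \<Rightarrow> bool"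
  where
  "cone_representation G E T C \<rho> \<longleftrightarrow>
     group_action G E \<rho> \<and>
     (\<forall>g\<in>carrier G. linear_into E (\<rho> g) \<and> continuous_map T T (\<rho> g) \<and> \<rho> g ` C \<subseteq> C)"

definition locally_bounded_type ::
  "('g, 'm) monoid_scheme \<Rightarrow> 'e::real_vector topology \<Rightarrow> 'e set \<Rightarrow> ('g \<Rightarrow> 'e \<Rightarrow> 'e) \<Rightarrow> bool"
  where
  "locally_bounded_type G T C \<rho> \<longleftrightarrow> (\<exists>x\<in>C. x \<noteq> 0 \<and> tvs_bounded T (orbit G \<rho> x))"

definition dual_le :: "'e set \<Rightarrow> ('e \<Rightarrow> real) \<Rightarrow> ('e \<Rightarrow> real) \<Rightarrow> bool" where
  "dual_le C \<phi> \<psi> \<longleftrightarrow> (\<forall>c\<in>C. 0 \<le> \<psi> c - \<phi> c)"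

definition dual_rep ::
  "('g, 'm) monoid_scheme \<Rightarrow> ('g \<Rightarrow> 'e \<Rightarrow> 'e) \<Rightarrow> 'g \<Rightarrow> ('e \<Rightarrow> real) \<Rightarrow> 'e \<Rightarrow> real" where
  "dual_rep G \<rho> g \<phi> = (\<lambda>x. \<phi> (\<rho> (inv\<^bsub>G\<^esub> g) x))"

definition cobounded_type ::
  "('g, 'm) monoid_scheme \<Rightarrow> 'e::real_vector set \<Rightarrow> 'e topology \<Rightarrow> 'e set \<Rightarrow> ('g \<Rightarrow> 'e \<Rightarrow> 'e) \<Rightarrow> bool"
  where
  "cobounded_type G E T C \<rho> \<longleftrightarrow>
     (\<exists>\<phi>\<in>top_dual E T. \<forall>\<psi>\<in>top_dual E T. \<exists>gs. set gs \<subseteq> carrier G \<and>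
        dual_le C \<psi> (\<lambda>x. \<Sum>g\<leftarrow>gs. dual_rep G \<rho> g \<phi> x) \<and>
        dual_le C (\<lambda>x. - \<psi> x) (\<lambda>x. \<Sum>g\<leftarrow>gs. dual_rep G \<rho> g \<phi> x))"


section \<open>The fixed-point property for cones\<close>

text \<open>
  A HOL formula cannot quantify over types, so the property refers to an ambient type \<open>'e\<close>:
  \<open>fixed_point_property_cones TYPE('e) G\<close> ranges over all locally convex Hausdorff spaces
  whose underlying vector space is a subspace of \<open>'e\<close>, i.e. (up to isomorphism) has at most
  the dimension of \<open>'e\<close>. The property of the literature is its conjunction over all types \<open>'e\<close>.
\<close>

definition fixed_point_property_cones ::
  "'e::real_vector itself \<Rightarrow> ('g, 'm) monoid_scheme \<Rightarrow> bool" where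
  "fixed_point_property_cones (_ :: 'e itself) G \<longleftrightarrow>
     (\<forall>(E :: 'e set) T C \<rho>.
        lc_hausdorff_tvs E T \<and> proper_convex_cone E C \<and> weakly_complete E T C \<and>
        cone_representation G E T C \<rho> \<and> locally_bounded_type G T C \<rho> \<and> cobounded_type G E T C \<rho>
        \<longrightarrow> (\<exists>x\<in>C. x \<noteq> 0 \<and> (\<forall>g\<in>carrier G. \<rho> g x = x)))"

text \<open>
  A hypothesis that a group with elements in \<open>'g\<close> has the property can be stated at one type
  \<open>'u\<close> only, which must not be too small (for the zero space the property is vacuous). The
  following says that the dimension of \<open>'u\<close> is at least the cardinality of \<open>\<real>^(\<real>^'g)\<close>. Such
  types exist above every given \<open>'e\<close>, e.g. \<open>'e \<times> V\<close> for the type \<open>V\<close> of bounded real functions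
  on the discrete space \<open>\<real>^(\<real>^'g)\<close>.
\<close>

definition large_universe :: "'g itself \<Rightarrow> 'u::real_vector itself \<Rightarrow> bool" where
  "large_universe (_ :: 'g itself) (_ :: 'u itself) \<longleftrightarrow>
     (\<exists>b :: (('g \<Rightarrow> real) \<Rightarrow> real) \<Rightarrow> 'u. inj b \<and> independent (range b))"


section \<open>Groups\<close>

primrec set_power :: "('h, 'm) monoid_scheme \<Rightarrow> 'h set \<Rightarrow> nat \<Rightarrow> 'h set" where
  "set_power H S 0 = {\<one>\<^bsub>H\<^esub>}"
| "set_power H S (Suc n) = S <#>\<^bsub>H\<^esub> set_power H S n"

definition subexponential :: "('h, 'm) monoid_scheme \<Rightarrow> bool" where
  "subexponential H \<longleftrightarrow>
     (\<forall>S. S \<subseteq> carrier H \<and> finite S \<and> S \<noteq> {} \<longrightarrow>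
        (\<lambda>n. root n (real (card (set_power H S n)))) \<longlonglongrightarrow> 1)"

definition central_subgroup :: "'g set \<Rightarrow> ('g, 'm) monoid_scheme \<Rightarrow> bool" where
  "central_subgroup Z G \<longleftrightarrow>
     subgroup Z G \<and> (\<forall>z\<in>Z. \<forall>g\<in>carrier G. z \<otimes>\<^bsub>G\<^esub> g = g \<otimes>\<^bsub>G\<^esub> z)"

definition directed_by_inclusion :: "'a set set \<Rightarrow> bool" where
  "directed_by_inclusion \<S> \<longleftrightarrow> \<S> \<noteq> {} \<and> (\<forall>A\<in>\<S>. \<forall>B\<in>\<S>. \<exists>C\<in>\<S>. A \<subseteq> C \<and> B \<subseteq> C)"

end

theory Submission
  imports Defs "HOL-Library.Function_Algebras" "HOL-Algebra.Weak_Morphisms"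
begin

text \<open>
  The fixed-point property is first translated into a property of the group alone. For a bounded function
  \<open>f \<ge> 0\<close> on \<open>G\<close>, not identically zero, let \<open>\<ell>\<^sup>\<infinity>(G; f)\<close> be the space of functions whose absolute value is at most a
  finite sum of translates of \<open>f\<close>. The group has the integral property if each of these spaces carries a
  translation invariant positive linear functional with value \<open>1\<close> at \<open>f\<close>.

  If \<open>G\<close> has the integral property, it has the fixed-point property in every vector space
  (\<open>integral_property_imp_fixed_point_property\<close>): an orbit \<open>g \<mapsto> \<rho> g x\<close> that is bounded carries continuous functionals to
  functions on \<open>G\<close>, an invariant integral pulls back to an invariant positive functional on the dual, and
  weak completeness identifies it with a point of the cone. Conversely, the integral is a fixed point in the weakly
  complete cone of positive functionals on \<open>\<ell>\<^sup>\<infinity>(G; f)\<close>, and this cone fits into a large universe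
  (\<open>fixed_point_property_imp_integral_property\<close>). So the closure properties have to be shown for integrals only, and
  the two universes in the theorem no longer matter.

  Two tools do this. The first is pulling back: a positive linear map that intertwines
  the actions transports integrals (\<open>integral_property_pullback\<close>); quotients and subgroups follow at once. The second is
  compactness in the form of \<open>constrained_positive_functional\<close>, a consequence of the
  Hahn-Banach theorem: infinitely many linear constraints on a positive functional can be met
  if any finitely many can be met approximately. Directed unions follow from it.

  For an extension with kernel \<open>N\<close> it is enough to find an \<open>N\<close>-invariant positive functional on \<open>\<ell>\<^sup>\<infinity>(G; f)\<close> that is
  bounded on the translates of \<open>f\<close>, because it maps \<open>\<ell>\<^sup>\<infinity>(G; f)\<close> equivariantly to functions on the quotient
  (\<open>integral_of_quotient_integral\<close>). When \<open>N\<close> or the quotient is finite, such a functional is at hand. When \<open>N\<close> is a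
  subexponential direct factor or is central (so that its finitely generated subgroups have polynomial
  growth), one averages over \<open>N\<close> with weights \<open>q ^ n\<close> on \<open>n\<close>-fold products, normalises at a point where the average of \<open>f\<close> is nearly
  maximal, and lets \<open>q\<close> tend to \<open>1\<close> by compactness (\<open>near_invariant_functional\<close>).
\<close>

section \<open>Functions as vectors\<close>

text \<open>
  With pointwise scaling, functions on a group, functionals on a topological vector space and functionals
  on functions on a group are all vectors of a type of class \<open>real_vector\<close>, so that one separation argument
  serves for all of them.
\<close>

instantiation "fun" :: (type, real_vector) real_vector
begin

definition scaleR_fun :: "real \<Rightarrow> ('a \<Rightarrow> 'b) \<Rightarrow> 'a \<Rightarrow> 'b" where
  "scaleR_fun c f = (\<lambda>x. c *\<^sub>R f x)"

instance
  by standard (simp_all add: scaleR_fun_def fun_eq_iff scaleR_add_right scaleR_add_left)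

end

lemma scaleR_fun_apply [simp]: "(c *\<^sub>R f) x = c *\<^sub>R f x"
  by (simp add: scaleR_fun_def)

lemma sum_fun_apply: "(\<Sum>i\<in>I. f i) x = (\<Sum>i\<in>I. f i x)"
  by (induction I rule: infinite_finite_induct) auto

lemma sum_list_fun_apply: "(\<Sum>i\<leftarrow>is. f i) x = (\<Sum>i\<leftarrow>is. f i x)"
  by (induction "is") auto

lemma linear_into_add: "linear_into W m \<Longrightarrow> u \<in> W \<Longrightarrow> v \<in> W \<Longrightarrow> m (u + v) = m u + m v"
  by (simp add: linear_into_def)

lemma linear_into_scale: "linear_into W m \<Longrightarrow> u \<in> W \<Longrightarrow> m (c *\<^sub>R u) = c *\<^sub>R m u"
  by (simp add: linear_into_def)

lemma linear_into_zero: "linear_into W m \<Longrightarrow> u \<in> W \<Longrightarrow> m 0 = 0"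
  using linear_into_scale[of W m u 0] by simp

lemma linear_into_uminus: "linear_into W m \<Longrightarrow> u \<in> W \<Longrightarrow> m (- u) = - m u"
  using linear_into_scale[of W m u "-1"] by simp

lemma linear_into_diff:
  "linear_into W m \<Longrightarrow> subspace W \<Longrightarrow> u \<in> W \<Longrightarrow> v \<in> W \<Longrightarrow> m (u - v) = m u - m v"
  using linear_into_add[of W m u "- v"] linear_into_uminus[of W m v] subspace_neg[of W v] by simp

lemma linear_into_sum:
  assumes "linear_into W m" "subspace W" "\<And>i. i \<in> I \<Longrightarrow> u i \<in> W"
  shows "m (\<Sum>i\<in>I. u i) = (\<Sum>i\<in>I. m (u i))"
  using assms(3)
proof (induction I rule: infinite_finite_induct)
  case (insert i I)
  then show ?case
    using assms(1,2) by (simp add: linear_into_add subspace_sum)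
qed (use linear_into_zero[OF assms(1) subspace_0[OF assms(2)]] in auto)

lemma subspace_sum_list:
  "subspace W \<Longrightarrow> (\<And>i. i \<in> set is \<Longrightarrow> u i \<in> W) \<Longrightarrow> (\<Sum>i\<leftarrow>is. u i) \<in> W"
  by (induction "is") (auto simp: subspace_0 subspace_add)

lemma linear_into_sum_list:
  assumes "linear_into W m" "subspace W" "\<And>i. i \<in> set is \<Longrightarrow> u i \<in> W"
  shows "m (\<Sum>i\<leftarrow>is. u i) = (\<Sum>i\<leftarrow>is. m (u i))"
  using assms(3)
proof (induction "is")
  case Nil
  then show ?case using linear_into_zero[OF assms(1) subspace_0[OF assms(2)]] by simp
next
  case (Cons a "is")
  then show ?case
    using assms(1,2) by (simp add: linear_into_add subspace_sum_list)
qed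

lemma linear_into_cong:
  "linear_into W m \<Longrightarrow> subspace W \<Longrightarrow> (\<And>w. w \<in> W \<Longrightarrow> m' w = m w) \<Longrightarrow> linear_into W m'"
  unfolding linear_into_def by (simp add: subspace_add subspace_scale)

section \<open>Positive functionals on spaces with an order unit\<close>

text \<open>
  A wedge need not be proper. It is the positive cone of a preorder on a vector space, and it is this
  preorder, possibly refined by constraints, that functionals below have to respect.
\<close>

definition wedge :: "'a::real_vector set \<Rightarrow> bool" where
  "wedge P \<longleftrightarrow> 0 \<in> P \<and> (\<forall>u\<in>P. \<forall>v\<in>P. u + v \<in> P) \<and> (\<forall>c\<ge>0. \<forall>u\<in>P. c *\<^sub>R u \<in> P)"

lemma wedge_add: "wedge P \<Longrightarrow> u \<in> P \<Longrightarrow> v \<in> P \<Longrightarrow> u + v \<in> P"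
  and wedge_scale: "wedge P \<Longrightarrow> 0 \<le> c \<Longrightarrow> u \<in> P \<Longrightarrow> c *\<^sub>R u \<in> P"
  and wedge_zero: "wedge P \<Longrightarrow> 0 \<in> P"
  by (auto simp: wedge_def)

lemma wedge_extension_by_ray:
  assumes "wedge Q" shows "wedge {q + s *\<^sub>R w | q s. q \<in> Q \<and> 0 \<le> s}"
  unfolding wedge_def
proof (intro conjI ballI allI impI)
  show "0 \<in> {q + s *\<^sub>R w | q s. q \<in> Q \<and> 0 \<le> s}"
    using wedge_zero[OF assms] by force
next
  fix u v assume "u \<in> {q + s *\<^sub>R w | q s. q \<in> Q \<and> 0 \<le> s}" "v \<in> {q + s *\<^sub>R w | q s. q \<in> Q \<and> 0 \<le> s}"
  then obtain q s q' s' where *: "u = q + s *\<^sub>R w" "v = q' + s' *\<^sub>R w" "q \<in> Q" "q' \<in> Q" "0 \<le> s" "0 \<le> s'"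
    by blast
  have "u + v = (q + q') + (s + s') *\<^sub>R w" by (simp add: * scaleR_add_left)
  then show "u + v \<in> {q + s *\<^sub>R w | q s. q \<in> Q \<and> 0 \<le> s}"
    using * wedge_add[OF assms] by (smt (verit) mem_Collect_eq)
next
  fix c :: real and u assume "0 \<le> c" "u \<in> {q + s *\<^sub>R w | q s. q \<in> Q \<and> 0 \<le> s}"
  then obtain q s where *: "u = q + s *\<^sub>R w" "q \<in> Q" "0 \<le> s"
    by blast
  have "c *\<^sub>R u = c *\<^sub>R q + (c * s) *\<^sub>R w" by (simp add: * scaleR_add_right)
  then show "c *\<^sub>R u \<in> {q + s *\<^sub>R w | q s. q \<in> Q \<and> 0 \<le> s}"
    using * wedge_scale[OF assms \<open>0 \<le> c\<close>] \<open>0 \<le> c\<close> by (smt (verit) mem_Collect_eq mult_nonneg_nonneg)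
qed

text \<open>
  Zorn's lemma gives a maximal wedge \<open>Q\<close> that omits \<open>- \<phi>\<close>. If neither \<open>w\<close> nor \<open>- w\<close> belonged to it, adjoining
  either ray would bring in \<open>- \<phi>\<close>, and the two resulting expressions of \<open>- \<phi>\<close> could be averaged so
  that \<open>w\<close> cancels.
\<close>

lemma maximal_wedge:
  assumes W: "subspace W" and P: "wedge P" "P \<subseteq> W" and neg: "- \<phi> \<notin> P"
  obtains Q where "wedge Q" "P \<subseteq> Q" "Q \<subseteq> W" "- \<phi> \<notin> Q" "\<And>w. w \<in> W \<Longrightarrow> w \<in> Q \<or> - w \<in> Q"
proof -
  define \<A> where "\<A> = {Q. wedge Q \<and> P \<subseteq> Q \<and> Q \<subseteq> W \<and> - \<phi> \<notin> Q}"
  have "\<exists>Q\<in>\<A>. \<forall>X\<in>\<A>. Q \<subseteq> X \<longrightarrow> X = Q"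
  proof (rule subset_Zorn_nonempty)
    show "\<A> \<noteq> {}" using assms by (auto simp: \<A>_def)
  next
    fix \<C> assume "\<C> \<noteq> {}" and ch: "subset.chain \<A> \<C>"
    then have sub: "\<C> \<subseteq> \<A>" and lin: "\<And>X Y. X \<in> \<C> \<Longrightarrow> Y \<in> \<C> \<Longrightarrow> X \<subseteq> Y \<or> Y \<subseteq> X"
      by (auto simp: subset_chain_def)
    obtain Q0 where Q0: "Q0 \<in> \<C>" using \<open>\<C> \<noteq> {}\<close> by blast
    have el: "wedge X" "P \<subseteq> X" "X \<subseteq> W" "- \<phi> \<notin> X" if "X \<in> \<C>" for X
      using sub that by (auto simp: \<A>_def)
    have "wedge (\<Union>\<C>)"
      unfolding wedge_def
    proof (intro conjI ballI allI impI)
      show "0 \<in> \<Union>\<C>" using Q0 el(1) wedge_zero by blast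
    next
      fix u v assume "u \<in> \<Union>\<C>" "v \<in> \<Union>\<C>"
      then obtain X Y where "X \<in> \<C>" "u \<in> X" "Y \<in> \<C>" "v \<in> Y" by blast
      then show "u + v \<in> \<Union>\<C>"
        using lin[of X Y] el(1) wedge_add by (metis UnionI subsetD)
    next
      fix c :: real and u assume "0 \<le> c" "u \<in> \<Union>\<C>"
      then show "c *\<^sub>R u \<in> \<Union>\<C>" using el(1) wedge_scale by blast
    qed
    then show "\<Union>\<C> \<in> \<A>" using el Q0 unfolding \<A>_def by blast
  qed
  then obtain Q where "Q \<in> \<A>" and max: "\<And>X. X \<in> \<A> \<Longrightarrow> Q \<subseteq> X \<Longrightarrow> X = Q" by blast
  then have Q: "wedge Q" "P \<subseteq> Q" "Q \<subseteq> W" "- \<phi> \<notin> Q" by (auto simp: \<A>_def)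
  have ray: "\<exists>q\<in>Q. \<exists>s>0. - \<phi> = q + s *\<^sub>R w" if w: "w \<in> W" "w \<notin> Q" for w
  proof (rule ccontr)
    assume no: "\<not> ?thesis"
    let ?Q = "{q + s *\<^sub>R w | q s. q \<in> Q \<and> 0 \<le> s}"
    have sub: "Q \<subseteq> ?Q" by force
    have "- \<phi> \<notin> ?Q"
    proof
      assume "- \<phi> \<in> ?Q"
      then obtain q s where qs: "- \<phi> = q + s *\<^sub>R w" "q \<in> Q" "0 \<le> s" by blast
      have "s \<noteq> 0" using Q(4) qs(1,2) by (metis add.right_neutral scaleR_zero_left)
      then have "0 < s" using qs(3) by simp
      then show False using no qs(1,2) by blast
    qed
    moreover have "?Q \<subseteq> W" using Q(3) w W by (auto intro!: subspace_add subspace_scale)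
    ultimately have "?Q \<in> \<A>" using wedge_extension_by_ray[OF Q(1)] sub Q(2) unfolding \<A>_def by blast
    then have "?Q = Q" using max sub by blast
    moreover have "w \<in> ?Q" using wedge_zero[OF Q(1)] by (intro CollectI exI[of _ 0] exI[of _ 1]) auto
    ultimately show False using w by blast
  qed
  have "w \<in> Q \<or> - w \<in> Q" if w: "w \<in> W" for w
  proof (rule ccontr)
    assume "\<not> ?thesis"
    then have "w \<notin> Q" "- w \<notin> Q" by auto
    moreover have "- w \<in> W" using W w by (rule subspace_neg)
    ultimately obtain q s q' s' where *: "q \<in> Q" "s > 0" "- \<phi> = q + s *\<^sub>R w"
      "q' \<in> Q" "s' > 0" "- \<phi> = q' + s' *\<^sub>R (- w)"
      using ray[OF w] ray[of "- w"] by blast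
    have "s' *\<^sub>R (- \<phi>) + s *\<^sub>R (- \<phi>) = s' *\<^sub>R (q + s *\<^sub>R w) + s *\<^sub>R (q' + s' *\<^sub>R (- w))"
      by (simp only: *(3)[symmetric] *(6)[symmetric])
    also have "\<dots> = s' *\<^sub>R q + s *\<^sub>R q'" by (simp add: algebra_simps)
    finally have "(s + s') *\<^sub>R (- \<phi>) = s' *\<^sub>R q + s *\<^sub>R q'" by (simp add: algebra_simps)
    then have "- \<phi> = inverse (s + s') *\<^sub>R (s' *\<^sub>R q + s *\<^sub>R q')"
      using *(2,5) by (metis add_pos_pos less_numeral_extra(3) scaleR_one scaleR_scaleR left_inverse)
    also have "\<dots> \<in> Q" using * Q(1) by (auto intro!: wedge_add wedge_scale)
    finally show False using Q(4) by blast
  qed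
  then show ?thesis using that Q by blast
qed

text \<open>
  This is the form in which the Hahn-Banach theorem is used. For a maximal wedge \<open>Q\<close> as above, let \<open>m w\<close> be the
  infimum of all \<open>t\<close> with \<open>t *\<^sub>R \<phi> - w \<in> Q\<close>. This is always subadditive; since \<open>Q\<close>
  decides the sign of every vector, also \<open>m (- w) = - m w\<close>, and a subadditive odd function is additive.
\<close>

lemma order_unit_state:
  fixes W :: "'a::real_vector set"
  assumes W: "subspace W" and P: "wedge P" "P \<subseteq> W" and neg: "- \<phi> \<notin> P" and "\<phi> \<in> W"
    and unit: "\<And>w. w \<in> W \<Longrightarrow> \<exists>t. t *\<^sub>R \<phi> - w \<in> P"
  shows "\<exists>m :: 'a \<Rightarrow> real. linear_into W m \<and> (\<forall>p\<in>P. 0 \<le> m p) \<and> m \<phi> = 1"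
proof -
  obtain Q where Q: "wedge Q" "P \<subseteq> Q" "Q \<subseteq> W" "- \<phi> \<notin> Q" and tot: "\<And>w. w \<in> W \<Longrightarrow> w \<in> Q \<or> - w \<in> Q"
    using maximal_wedge[OF W P neg] by metis
  have negmult: "s *\<^sub>R \<phi> \<notin> Q" if "s < 0" for s
  proof
    assume "s *\<^sub>R \<phi> \<in> Q"
    then have "inverse (- s) *\<^sub>R (s *\<^sub>R \<phi>) \<in> Q"
      using Q(1) that by (metis inverse_nonnegative_iff_nonnegative less_le neg_0_le_iff_le wedge_scale)
    then show False using Q(4) that by simp
  qed
  have pos: "\<phi> \<in> Q" using tot[of \<phi>] \<open>\<phi> \<in> W\<close> Q(4) by blast
  define S where "S w = {t. t *\<^sub>R \<phi> - w \<in> Q}" for w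
  define m where "m w = Inf (S w)" for w
  have ne: "S w \<noteq> {}" if "w \<in> W" for w using unit[OF that] Q(2) by (auto simp: S_def)
  have addS: "s + t \<in> S (v + w)" if "s \<in> S v" "t \<in> S w" for s t v w
    using wedge_add[OF Q(1)] that by (fastforce simp: S_def algebra_simps)
  have nonneg0: "0 \<le> t" if "t \<in> S 0" for t
    using that negmult by (force simp: S_def not_less[symmetric])
  have bdd: "bdd_below (S w)" if w: "w \<in> W" for w
  proof -
    obtain t where "t \<in> S (- w)" using ne[of "- w"] w W by (metis ex_in_conv subspace_neg)
    then have "- t \<le> s" if "s \<in> S w" for s using addS[OF that \<open>t \<in> S (- w)\<close>] nonneg0 by fastforce
    then show ?thesis by (rule bdd_belowI)
  qed
  have sub: "m (v + w) \<le> m v + m w" if "v \<in> W" "w \<in> W" for v w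
  proof -
    have vw: "v + w \<in> W" using that W by (simp add: subspace_add)
    have "m (v + w) - s \<le> t" if "s \<in> S v" "t \<in> S w" for s t
      using cInf_lower[OF addS[OF that] bdd[OF vw]] by (simp add: m_def)
    then have "m (v + w) - s \<le> m w" if "s \<in> S v" for s
      unfolding m_def[of w] using that by (intro cInf_greatest ne \<open>w \<in> W\<close>)
    then have "m (v + w) - m w \<le> s" if "s \<in> S v" for s using that by (smt (verit))
    then have "m (v + w) - m w \<le> m v"
      unfolding m_def[of v] by (intro cInf_greatest ne \<open>v \<in> W\<close>)
    then show ?thesis by simp
  qed
  have negle: "m (- w) \<le> - m w" if w: "w \<in> W" for w
  proof -
    have "s \<le> - m (- w)" if "s < m w" for s
    proof -
      have "s \<notin> S w" using cInf_lower[OF _ bdd[OF w]] that by (force simp: m_def)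
      then have "s *\<^sub>R \<phi> - w \<notin> Q" by (simp add: S_def)
      moreover have "s *\<^sub>R \<phi> - w \<in> W" using w \<open>\<phi> \<in> W\<close> W by (intro subspace_diff subspace_scale)
      ultimately have "- (s *\<^sub>R \<phi> - w) \<in> Q" using tot by blast
      then have "- s \<in> S (- w)" by (simp add: S_def)
      then have "m (- w) \<le> - s" unfolding m_def
        using w W by (intro cInf_lower bdd) (simp_all add: subspace_neg)
      then show ?thesis by simp
    qed
    then have "m w \<le> - m (- w)" by (rule dense_le)
    then show ?thesis by simp
  qed
  have m0: "m 0 = 0"
  proof -
    have "0 \<in> S 0" using wedge_zero[OF Q(1)] by (simp add: S_def)
    then show ?thesis unfolding m_def using nonneg0 by (intro cInf_eq_minimum)
  qed
  have mneg: "m (- w) = - m w" if "w \<in> W" for w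
    using sub[of w "- w"] negle[OF that] that W m0 by (simp add: subspace_neg)
  have add: "m (v + w) = m v + m w" if "v \<in> W" "w \<in> W" for v w
    using sub[OF that] sub[of "- v" "- w"] mneg[of "v + w"] mneg[of v] mneg[of w] that W
    by (simp add: subspace_neg subspace_add)
  have scale_pos: "m (c *\<^sub>R w) = c * m w" if "c > 0" "w \<in> W" for c w
  proof -
    have le: "c * m w \<le> m (c *\<^sub>R w)" if c: "c > 0" and w: "w \<in> W" for c w
      unfolding m_def[of "c *\<^sub>R w"]
    proof (rule cInf_greatest)
      show "S (c *\<^sub>R w) \<noteq> {}" using w W by (intro ne subspace_scale)
    next
      fix t assume "t \<in> S (c *\<^sub>R w)"
      then have "inverse c *\<^sub>R (t *\<^sub>R \<phi> - c *\<^sub>R w) \<in> Q" using Q(1) c by (intro wedge_scale) (auto simp: S_def)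
      then have "t / c \<in> S w" using c by (simp add: S_def algebra_simps divide_inverse)
      then have "m w \<le> t / c" unfolding m_def by (intro cInf_lower bdd w)
      then show "c * m w \<le> t" using c by (simp add: field_simps)
    qed
    have "inverse c * m (c *\<^sub>R w) \<le> m (inverse c *\<^sub>R (c *\<^sub>R w))"
      using that W by (intro le) (auto simp: subspace_scale)
    then have "m (c *\<^sub>R w) \<le> c * m w" using that by (simp add: field_simps)
    then show ?thesis using le[OF that] by simp
  qed
  have scale: "m (c *\<^sub>R w) = c * m w" if w: "w \<in> W" for c w
  proof (cases c "0::real" rule: linorder_cases)
    case less
    then have "m ((- c) *\<^sub>R w) = (- c) * m w" using w by (intro scale_pos) auto
    then show ?thesis using mneg[of "c *\<^sub>R w"] w W by (simp add: subspace_scale)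
  qed (use m0 scale_pos w in auto)
  have "0 \<le> m p" if "p \<in> P" for p
  proof -
    have pW: "p \<in> W" using that P by blast
    have "0 \<in> S (- p)" using that Q(2) by (auto simp: S_def)
    then have "m (- p) \<le> 0" unfolding m_def
      using pW W by (intro cInf_lower bdd) (simp_all add: subspace_neg)
    then show ?thesis using mneg[OF pW] by simp
  qed
  moreover have "m \<phi> = 1"
    unfolding m_def
  proof (rule cInf_eq_minimum)
    show "1 \<in> S \<phi>" using wedge_zero[OF Q(1)] by (simp add: S_def)
  next
    fix t assume "t \<in> S \<phi>"
    then have "(t - 1) *\<^sub>R \<phi> \<in> Q" by (simp add: S_def scaleR_diff_left)
    then show "1 \<le> t" using negmult[of "t - 1"] by (metis diff_less_0_iff_less not_less)
  qed
  moreover have "linear_into W m" using add scale by (simp add: linear_into_def)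
  ultimately show ?thesis by blast
qed

text \<open>
  A compactness principle: constraints \<open>0 \<le> m a\<close> for \<open>a\<close> in an infinite set \<open>A\<close> can be met together if any finitely
  many of them can be met up to any \<open>\<epsilon>\<close>, provided that the constraints themselves make \<open>\<phi>\<close> an order unit.
  Indeed \<open>\<phi>\<close> is an order unit for the wedge generated by \<open>P\<close> and \<open>A\<close>, and if this wedge contained \<open>- \<phi>\<close>,
  only finitely many constraints would be involved, so that an approximate solution \<open>m\<close> with a small \<open>\<epsilon>\<close> would
  satisfy \<open>m (- \<phi>) > - 1\<close>, in contrast to \<open>m \<phi> = 1\<close>. The approximate solutions may live on subspaces \<open>W0\<close> that depend on the constraints.
\<close>

lemma constrained_state:
  fixes W :: "'a::real_vector set"
  assumes W: "subspace W" and P: "wedge P" "P \<subseteq> W" and A: "A \<subseteq> W" and "\<phi> \<in> W"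
    and unit: "\<And>w. w \<in> W \<Longrightarrow> \<exists>t as. set as \<subseteq> A \<and> t *\<^sub>R \<phi> - w - sum_list as \<in> P"
    and approx: "\<And>A0 \<epsilon>. finite A0 \<Longrightarrow> A0 \<subseteq> A \<Longrightarrow> 0 < \<epsilon> \<Longrightarrow>
       \<exists>W0 (m :: 'a \<Rightarrow> real). subspace W0 \<and> \<phi> \<in> W0 \<and> A0 \<subseteq> W0 \<and> linear_into W0 m \<and>
         (\<forall>p\<in>P \<inter> W0. 0 \<le> m p) \<and> (\<forall>a\<in>A0. - \<epsilon> \<le> m a) \<and> m \<phi> = 1"
  shows "\<exists>m :: 'a \<Rightarrow> real. linear_into W m \<and> (\<forall>p\<in>P. 0 \<le> m p) \<and> (\<forall>a\<in>A. 0 \<le> m a) \<and> m \<phi> = 1"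
proof -
  define comb where "comb L = (\<Sum>(c, a)\<leftarrow>L. c *\<^sub>R a)" for L :: "(real \<times> 'a) list"
  define adm where "adm L \<longleftrightarrow> (\<forall>(c, a)\<in>set L. 0 \<le> c \<and> a \<in> A)" for L :: "(real \<times> 'a) list"
  have comb_append: "comb (L @ L') = comb L + comb L'" for L L' by (simp add: comb_def)
  have comb_scale: "comb (map (\<lambda>(c, a). (r * c, a)) L) = r *\<^sub>R comb L" for r L
    by (induction L) (auto simp: comb_def scaleR_add_right)
  define P' where "P' = {p \<in> W. \<exists>L. adm L \<and> p - comb L \<in> P}"
  have P'I: "p \<in> P'" if "p \<in> W" "adm L" "p - comb L \<in> P" for p L using that by (auto simp: P'_def)
  have PP': "P \<subseteq> P'" using P(2) by (force intro!: P'I[where L = "[]"] simp: adm_def comb_def)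
  have AP': "a \<in> P'" if "a \<in> A" for a
    using that A wedge_zero[OF P(1)] by (intro P'I[where L = "[(1, a)]"]) (auto simp: adm_def comb_def)
  have wedge': "wedge P'"
    unfolding wedge_def
  proof (intro conjI ballI allI impI)
    show "0 \<in> P'" using PP' wedge_zero[OF P(1)] by blast
  next
    fix u v assume "u \<in> P'" "v \<in> P'"
    then obtain L L' where *: "u \<in> W" "v \<in> W" "adm L" "u - comb L \<in> P" "adm L'" "v - comb L' \<in> P"
      by (auto simp: P'_def)
    then have "(u - comb L) + (v - comb L') \<in> P" using P(1) by (intro wedge_add)
    then show "u + v \<in> P'"
      using * W by (intro P'I[where L = "L @ L'"]) (auto simp: adm_def comb_append algebra_simps subspace_add)
  next
    fix c :: real and u assume c: "0 \<le> c" and "u \<in> P'"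
    then obtain L where *: "u \<in> W" "adm L" "u - comb L \<in> P" by (auto simp: P'_def)
    have "c *\<^sub>R u - c *\<^sub>R comb L \<in> P" using wedge_scale[OF P(1) c *(3)] by (simp add: scaleR_diff_right)
    then show "c *\<^sub>R u \<in> P'"
      using * W c by (intro P'I[where L = "map (\<lambda>(r, a). (c * r, a)) L"])
        (auto simp: adm_def comb_scale subspace_scale)
  qed
  have "- \<phi> \<notin> P'"
  proof
    assume "- \<phi> \<in> P'"
    then obtain L where L: "adm L" "- \<phi> - comb L \<in> P" by (auto simp: P'_def)
    define s where "s = (\<Sum>(c, a)\<leftarrow>L. c)"
    have s: "0 \<le> s" unfolding s_def using L(1) by (intro sum_list_nonneg) (auto simp: adm_def)
    \<comment> \<open>The total weight \<open>s\<close> of the constraints in \<open>L\<close> costs at most \<open>s * \<epsilon> < 1\<close>.\<close>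
    define \<epsilon> where "\<epsilon> = 1 / (2 * (s + 1))"
    have \<epsilon>: "\<epsilon> > 0" using s by (simp add: \<epsilon>_def)
    have "snd ` set L \<subseteq> A" using L(1) by (auto simp: adm_def)
    then obtain W0 and m :: "'a \<Rightarrow> real"
      where m: "subspace W0" "\<phi> \<in> W0" "snd ` set L \<subseteq> W0" "linear_into W0 m"
        "\<forall>p\<in>P \<inter> W0. 0 \<le> m p" "\<forall>a\<in>snd ` set L. - \<epsilon> \<le> m a" "m \<phi> = 1"
      using approx[of "snd ` set L" \<epsilon>] \<epsilon> by auto
    have cW: "c *\<^sub>R a \<in> W0" if "(c, a) \<in> set L" for c a
      using that m(1,3) by (force intro!: subspace_scale)
    have combW: "comb L \<in> W0"
      unfolding comb_def using cW m(1) by (intro subspace_sum_list) auto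
    have "m (comb L) = (\<Sum>(c, a)\<leftarrow>L. c * m a)"
      unfolding comb_def using m cW
      by (subst linear_into_sum_list[OF m(4,1)])
        (force simp: linear_into_scale[OF m(4)] intro!: arg_cong[of _ _ sum_list])+
    also have "(\<Sum>(c, a)\<leftarrow>L. c * m a) \<ge> (\<Sum>(c, a)\<leftarrow>L. c * (- \<epsilon>))"
    proof (rule sum_list_mono)
      fix x assume x: "x \<in> set L"
      show "(case x of (c, a) \<Rightarrow> c * - \<epsilon>) \<le> (case x of (c, a) \<Rightarrow> c * m a)"
        using x m(6) L(1) mult_left_mono[of "- \<epsilon>" "m (snd x)" "fst x"]
        by (auto simp: adm_def split_beta)
    qed
    also have "(\<Sum>(c, a)\<leftarrow>L. c * (- \<epsilon>)) = - (s * \<epsilon>)"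
      unfolding s_def by (induction L) (auto simp: algebra_simps)
    finally have 1: "- (s * \<epsilon>) \<le> m (comb L)" .
    have "s * \<epsilon> < 1" using s by (simp add: \<epsilon>_def field_simps)
    have "0 \<le> m (- \<phi> - comb L)"
      using m(1,2,5) L(2) combW by (auto intro!: subspace_diff subspace_neg)
    also have "\<dots> = - 1 - m (comb L)"
      using m(1,2,4,7) combW by (simp add: linear_into_diff linear_into_uminus subspace_neg)
    finally show False using 1 \<open>s * \<epsilon> < 1\<close> by linarith
  qed
  moreover have "\<exists>t. t *\<^sub>R \<phi> - w \<in> P'" if w: "w \<in> W" for w
  proof -
    obtain t as where *: "set as \<subseteq> A" "t *\<^sub>R \<phi> - w - sum_list as \<in> P" using unit[OF w] by blast
    have "comb (map (Pair 1) as) = sum_list as" by (simp add: comb_def o_def)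
    then have "t *\<^sub>R \<phi> - w \<in> P'" using * w W \<open>\<phi> \<in> W\<close>
      by (intro P'I[where L = "map (Pair 1) as"]) (auto simp: adm_def intro!: subspace_diff subspace_scale)
    then show ?thesis ..
  qed
  moreover have "P' \<subseteq> W" by (auto simp: P'_def)
  ultimately have "\<exists>m :: 'a \<Rightarrow> real. linear_into W m \<and> (\<forall>p\<in>P'. 0 \<le> m p) \<and> m \<phi> = 1"
    using \<open>\<phi> \<in> W\<close> by (intro order_unit_state[OF W wedge'])
  then show ?thesis using PP' AP' by blast
qed

section \<open>Duals of locally convex spaces and weakly complete cones\<close>

lemma top_dualD: "\<phi> \<in> top_dual E T \<Longrightarrow> linear_into E \<phi>" "\<phi> \<in> top_dual E T \<Longrightarrow> continuous_map T euclideanreal \<phi>"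
  by (auto simp: top_dual_def)

lemma subspace_top_dual: "subspace (top_dual E T)"
proof (rule subspaceI)
  show "0 \<in> top_dual E T" by (auto simp: top_dual_def linear_into_def zero_fun_def)
next
  fix \<phi> \<psi> assume "\<phi> \<in> top_dual E T" "\<psi> \<in> top_dual E T"
  then show "\<phi> + \<psi> \<in> top_dual E T"
    by (auto simp: top_dual_def linear_into_def algebra_simps plus_fun_def intro!: continuous_map_add)
next
  fix c and \<phi> assume "\<phi> \<in> top_dual E T"
  then show "c *\<^sub>R \<phi> \<in> top_dual E T"
    by (auto simp: top_dual_def linear_into_def algebra_simps scaleR_fun_def intro!: continuous_map_real_mult_left)
qed

lemma tvs_affine_continuous:
  assumes tvs: "lc_hausdorff_tvs E T" and a: "a \<in> E"
  shows "continuous_map T T (\<lambda>x. c *\<^sub>R (x + a))"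
proof -
  have top: "topspace T = E" and plus: "continuous_map (prod_topology T T) T (\<lambda>(x, y). x + y)"
    and scale: "continuous_map (prod_topology euclideanreal T) T (\<lambda>(c, x). c *\<^sub>R x)"
    using tvs by (auto simp: lc_hausdorff_tvs_def)
  have "continuous_map T (prod_topology T T) (\<lambda>x. (x, a))"
    using a top by (intro continuous_map_pairedI) auto
  from continuous_map_compose[OF this plus] have "continuous_map T T (\<lambda>x. x + a)"
    by (simp add: o_def)
  then have "continuous_map T (prod_topology euclideanreal T) (\<lambda>x. (c, x + a))"
    by (intro continuous_map_pairedI) auto
  from continuous_map_compose[OF this scale] show ?thesis
    by (simp add: o_def)
qed

lemma bounded_on_nhd_imp_top_dual:
  assumes tvs: "lc_hausdorff_tvs E T" and L: "linear_into E L"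
    and U: "openin T U" "0 \<in> U" and bd: "\<And>u. u \<in> U \<Longrightarrow> \<bar>L u\<bar> \<le> 1"
  shows "L \<in> top_dual E T"
proof -
  have top: "topspace T = E" and sub: "subspace E" using tvs by (auto simp: lc_hausdorff_tvs_def)
  have "continuous_map T euclideanreal L"
    unfolding continuous_map_def
  proof (intro conjI allI impI)
    fix V :: "real set" assume "openin euclideanreal V"
    then have V: "open V" by simp
    show "openin T {x \<in> topspace T. L x \<in> V}"
    proof (subst openin_subopen, intro ballI)
      fix x assume "x \<in> {x \<in> topspace T. L x \<in> V}"
      then have x: "x \<in> E" "L x \<in> V" using top by auto
      then obtain e where e: "e > 0" "ball (L x) e \<subseteq> V" using V openE by metis
      define N where "N = {y \<in> topspace T. (2 / e) *\<^sub>R (y + (- x)) \<in> U}"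
      have "openin T N"
        unfolding N_def
        by (intro openin_continuous_map_preimage[OF tvs_affine_continuous[OF tvs] U(1)] subspace_neg sub x)
      moreover have "x \<in> N" using x top U by (simp add: N_def)
      moreover have "N \<subseteq> {x \<in> topspace T. L x \<in> V}"
      proof
        fix y assume y: "y \<in> N"
        then have yE: "y \<in> E" by (simp add: N_def top)
        then have "L ((2 / e) *\<^sub>R (y + (- x))) = (2 / e) * (L y - L x)"
          using x sub L by (simp add: linear_into_scale linear_into_diff subspace_diff)
        moreover have "\<bar>L ((2 / e) *\<^sub>R (y + (- x)))\<bar> \<le> 1" using y by (intro bd) (simp add: N_def)
        ultimately have "\<bar>(2 / e) * (L y - L x)\<bar> \<le> 1" by simp
        then have "\<bar>L y - L x\<bar> \<le> e / 2" unfolding abs_mult using e by (simp add: field_simps)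
        then have "L y \<in> ball (L x) e" using e by (simp add: dist_real_def abs_minus_commute)
        then show "y \<in> {x \<in> topspace T. L x \<in> V}" using e yE top by auto
      qed
      ultimately show "\<exists>N. openin T N \<and> x \<in> N \<and> N \<subseteq> {x \<in> topspace T. L x \<in> V}" by blast
    qed
  qed auto
  then show ?thesis using L by (simp add: top_dual_def)
qed

text \<open>
  Let \<open>B\<close> be a symmetric convex neighbourhood of \<open>0\<close> that does not contain \<open>x\<close>. The vector \<open>x\<close> is an order unit for
  the wedge of rays through \<open>x + B\<close>, because \<open>B\<close> is absorbing. A state \<open>L\<close> with \<open>L x = 1\<close> that is nonnegative
  on \<open>x + B\<close> is at least \<open>- 1\<close> on \<open>B\<close>, and by symmetry it is bounded on \<open>B\<close>, hence continuous.
\<close>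

lemma top_dual_separates:
  assumes tvs: "lc_hausdorff_tvs E T" and x: "x \<in> E" "x \<noteq> 0"
  obtains \<psi> where "\<psi> \<in> top_dual E T" "\<psi> x \<noteq> 0"
proof -
  have top: "topspace T = E" and sub: "subspace E" and haus: "Hausdorff_space T"
    and nb: "neighbourhood_base_at 0 convex T"
    and scale: "continuous_map (prod_topology euclideanreal T) T (\<lambda>(c, x). c *\<^sub>R x)"
    using tvs by (auto simp: lc_hausdorff_tvs_def)
  have "0 \<in> E" using sub by (rule subspace_0)
  obtain U0 where U0: "openin T U0" "0 \<in> U0" "x \<notin> U0"
    using haus \<open>0 \<in> E\<close> x top unfolding Hausdorff_space_def disjnt_iff by metis
  then obtain U V where UV: "openin T U" "convex V" "0 \<in> U" "U \<subseteq> V" "V \<subseteq> U0"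
    using nb unfolding neighbourhood_base_at_def by metis
  have UE: "U \<subseteq> E" using openin_subset[OF UV(1)] top by simp
  define U' where "U' = U \<inter> {u \<in> topspace T. (- 1) *\<^sub>R (u + 0) \<in> U}"
  have U': "openin T U'"
    unfolding U'_def using \<open>0 \<in> E\<close>
    by (intro openin_Int UV openin_continuous_map_preimage[OF tvs_affine_continuous[OF tvs] UV(1)])
  have U'0: "0 \<in> U'" using UV \<open>0 \<in> E\<close> top by (simp add: U'_def)
  define B where "B = {u \<in> E. u \<in> V \<and> - u \<in> V}"
  have "convex B"
  proof -
    have "B = E \<inter> V \<inter> uminus -` V" by (auto simp: B_def)
    moreover have "convex (uminus -` V)"
      using UV(2) by (intro convex_linear_vimage) (auto intro: module_hom_uminus simp: linear_uminus)
    ultimately show ?thesis using UV(2) sub by (auto intro: convex_Int subspace_imp_convex)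
  qed
  have U'B: "U' \<subseteq> B" using UV(4) UE by (auto simp: U'_def B_def)
  define P where "P = cone hull ((+) x ` B)"
  have Pexpl: "P = {c *\<^sub>R y | c y. 0 \<le> c \<and> y \<in> (+) x ` B}" by (simp add: P_def cone_hull_expl)
  have "0 \<in> B" using U'B U'0 by blast
  have PW: "wedge P"
  proof -
    have "convex P" "cone P"
      unfolding P_def using \<open>convex B\<close>
      by (auto intro!: convex_cone_hull cone_cone_hull convex_translation)
    then have "(\<forall>x\<in>P. \<forall>y\<in>P. x + y \<in> P) \<and> (\<forall>x\<in>P. \<forall>c\<ge>0. c *\<^sub>R x \<in> P)" by (metis convex_cone)
    moreover have "0 *\<^sub>R (x + 0) \<in> P" unfolding Pexpl using \<open>0 \<in> B\<close> by (intro CollectI exI conjI refl) auto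
    ultimately show ?thesis by (auto simp: wedge_def)
  qed
  have PE: "P \<subseteq> E"
    unfolding Pexpl using x sub by (auto simp: B_def intro!: subspace_scale subspace_add)
  have neg: "- x \<notin> P"
  proof
    assume "- x \<in> P"
    then obtain c u where c: "0 \<le> c" "u \<in> B" "- x = c *\<^sub>R (x + u)" unfolding Pexpl by blast
    have "c \<noteq> 0" using c x by auto
    then have cp: "c > 0" using c by simp
    have "(c / (1 + c)) *\<^sub>R (- u) = x"
    proof -
      have "c *\<^sub>R (- u) = (1 + c) *\<^sub>R x" using c(3)
        by (simp add: scaleR_add_left scaleR_add_right eq_neg_iff_add_eq_0 neg_eq_iff_add_eq_0 ac_simps)
      then have "inverse (1 + c) *\<^sub>R (c *\<^sub>R (- u)) = inverse (1 + c) *\<^sub>R ((1 + c) *\<^sub>R x)" by simp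
      then show ?thesis using cp by (simp add: divide_inverse mult.commute)
    qed
    moreover have "(1 / (1 + c)) *\<^sub>R 0 + (c / (1 + c)) *\<^sub>R (- u) \<in> V"
      using c UV cp by (intro convexD) (auto simp: B_def field_simps)
    ultimately show False using U0 UV by auto
  qed
  have unit: "\<exists>t. t *\<^sub>R x - w \<in> P" if w: "w \<in> E" for w
  proof -
    have "continuous_map euclideanreal (prod_topology euclideanreal T) (\<lambda>c. (c, w))"
      using w top by (intro continuous_map_pairedI) auto
    from continuous_map_compose[OF this scale] have "continuous_map euclideanreal T (\<lambda>c. c *\<^sub>R w)"
      by (simp add: o_def)
    then have "open {c. c *\<^sub>R w \<in> U'}"
      using openin_continuous_map_preimage[OF _ U'] by fastforce
    moreover have "0 \<in> {c. c *\<^sub>R w \<in> U'}" using U'0 by simp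
    ultimately obtain d where d: "d > 0" "ball 0 d \<subseteq> {c. c *\<^sub>R w \<in> U'}" by (rule openE)
    then have "- (d / 2) \<in> {c. c *\<^sub>R w \<in> U'}" by (intro subsetD[OF d(2)]) (simp add: dist_real_def)
    then have "(- (d / 2)) *\<^sub>R w \<in> B" using U'B by blast
    then have "(2 / d) *\<^sub>R (x + (- (d / 2)) *\<^sub>R w) \<in> P"
      unfolding Pexpl using d(1) by (intro CollectI exI conjI refl) auto
    then have "(2 / d) *\<^sub>R x - w \<in> P" using d(1) by (simp add: algebra_simps)
    then show ?thesis ..
  qed
  obtain L :: "_ \<Rightarrow> real" where L: "linear_into E L" "\<And>p. p \<in> P \<Longrightarrow> 0 \<le> L p" "L x = 1"
    using order_unit_state[OF sub PW PE neg x(1) unit] by auto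
  have ge: "- 1 \<le> L u" if "u \<in> B" for u
  proof -
    have "1 *\<^sub>R (x + u) \<in> P" unfolding Pexpl using that by (intro CollectI exI[of _ 1] exI[of _ "x + u"]) auto
    then have "0 \<le> L (x + u)" using L(2) by simp
    also have "L (x + u) = 1 + L u" using that x L(1,3) by (simp add: B_def linear_into_add)
    finally show ?thesis by simp
  qed
  have sym: "- u \<in> B" "L (- u) = - L u" if "u \<in> B" for u
    using that sub L(1) by (auto simp: B_def subspace_neg linear_into_uminus)
  have "\<bar>L u\<bar> \<le> 1" if "u \<in> B" for u
    using ge[OF that] ge[OF sym(1)[OF that]] sym(2)[OF that] by linarith
  then have "L \<in> top_dual E T"
    using U'B by (intro bounded_on_nhd_imp_top_dual[OF tvs L(1) U' U'0]) blast
  then show ?thesis using that L(3) by force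
qed

text \<open>
  Separation in the finite-dimensional space \<open>\<real>\<^sup>I\<close>, realised as the functions \<open>X\<close> supported on \<open>I\<close>. If no point of
  \<open>C\<close> came \<open>\<epsilon>\<close>-close to \<open>m\<close> on \<open>I\<close>, a linear form \<open>L\<close> on \<open>\<real>\<^sup>I\<close> would be positive at the point \<open>p\<close> given by \<open>m\<close> and
  at most \<open>0\<close> on the image of \<open>C\<close>. The combination of elements of \<open>I\<close> that corresponds to \<open>- L\<close> would be
  nonnegative on \<open>C\<close>, but \<open>m\<close> would be negative at it.
\<close>

lemma cone_approximates_positive_functional:
  fixes m :: "('e::real_vector \<Rightarrow> real) \<Rightarrow> real"
  assumes C: "proper_convex_cone E C" and m: "linear_into (top_dual E T) m"
    and pos: "\<And>\<psi>. \<psi> \<in> top_dual E T \<Longrightarrow> (\<And>c. c \<in> C \<Longrightarrow> 0 \<le> \<psi> c) \<Longrightarrow> 0 \<le> m \<psi>"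
    and I: "finite I" "I \<subseteq> top_dual E T" and "0 < \<epsilon>"
  shows "\<exists>c\<in>C. \<forall>\<phi>\<in>I. \<bar>\<phi> c - m \<phi>\<bar> < \<epsilon>"
proof (rule ccontr)
  assume no: "\<not> ?thesis"
  have CE: "C \<subseteq> E" and add: "\<And>x y. x \<in> C \<Longrightarrow> y \<in> C \<Longrightarrow> x + y \<in> C"
    and "cone C" and "0 \<in> C"
    using C by (auto simp: proper_convex_cone_def)
  then have scale: "\<And>r c. c \<in> C \<Longrightarrow> 0 \<le> r \<Longrightarrow> r *\<^sub>R c \<in> C" by (auto simp: cone_def)
  have lin: "linear_into E \<phi>" if "\<phi> \<in> I" for \<phi> using that I by (auto simp: top_dual_def)
  define X :: "(('e \<Rightarrow> real) \<Rightarrow> real) set" where "X = {v. \<forall>\<psi>. \<psi> \<notin> I \<longrightarrow> v \<psi> = 0}"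
  have X: "subspace X" by (auto simp: X_def intro!: subspaceI)
  define a where "a c = (\<lambda>\<psi>. if \<psi> \<in> I then \<psi> c else 0)" for c :: 'e
  define p where "p = (\<lambda>\<psi>. if \<psi> \<in> I then m \<psi> else 0)"
  define \<delta> where "\<delta> = \<epsilon> / 2"
  have \<delta>: "0 < \<delta>" "\<delta> < \<epsilon>" using \<open>0 < \<epsilon>\<close> by (auto simp: \<delta>_def)
  have aX: "a c \<in> X" for c by (simp add: a_def X_def)
  have pX: "p \<in> X" by (simp add: p_def X_def)
  have a_add: "a (c + c') = a c + a c'" and a_scale: "a (r *\<^sub>R c) = r *\<^sub>R a c"
    if "c \<in> C" "c' \<in> C" for c c' r
    using that CE lin by (auto simp: a_def fun_eq_iff linear_into_def subset_iff)
  \<comment> \<open>The summand \<open>b\<close> ranges over a box of size proportional to \<open>s\<close>: this makes \<open>p\<close> an interior point of the wedge \<open>P\<close>.\<close>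
  define P where "P = {s *\<^sub>R p + b - a c | s b c. 0 \<le> s \<and> b \<in> X \<and> (\<forall>\<psi>. \<bar>b \<psi>\<bar> \<le> s * \<delta>) \<and> c \<in> C}"
  have PI: "v \<in> P" if "v = s *\<^sub>R p + b - a c" "0 \<le> s" "b \<in> X" "\<And>\<psi>. \<bar>b \<psi>\<bar> \<le> s * \<delta>" "c \<in> C" for v s b c
    using that unfolding P_def by blast
  have a0: "a 0 = 0" using a_scale[OF \<open>0 \<in> C\<close> \<open>0 \<in> C\<close>, of 0] by simp
  have "wedge P"
    unfolding wedge_def
  proof (intro conjI ballI allI impI)
    show "0 \<in> P" using X \<open>0 \<in> C\<close> by (intro PI[of _ 0 0 0]) (auto simp: a0 subspace_0)
  next
    fix u v assume "u \<in> P" "v \<in> P"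
    then obtain s b c s' b' c' where *: "u = s *\<^sub>R p + b - a c" "0 \<le> s" "b \<in> X" "\<forall>\<psi>. \<bar>b \<psi>\<bar> \<le> s * \<delta>" "c \<in> C"
      "v = s' *\<^sub>R p + b' - a c'" "0 \<le> s'" "b' \<in> X" "\<forall>\<psi>. \<bar>b' \<psi>\<bar> \<le> s' * \<delta>" "c' \<in> C"
      unfolding P_def by auto
    have "\<bar>(b + b') \<psi>\<bar> \<le> (s + s') * \<delta>" for \<psi>
      using *(4)[rule_format, of \<psi>] *(9)[rule_format, of \<psi>] by (simp add: distrib_right)
    moreover have "u + v = (s + s') *\<^sub>R p + (b + b') - a (c + c')"
      unfolding *(1,6) a_add[OF *(5,10)] scaleR_add_left by simp
    ultimately show "u + v \<in> P"
      using * X add by (intro PI[of _ "s + s'" "b + b'" "c + c'"]) (auto simp: subspace_add)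
  next
    fix r :: real and u assume "0 \<le> r" "u \<in> P"
    then obtain s b c where *: "u = s *\<^sub>R p + b - a c" "0 \<le> s" "b \<in> X" "\<forall>\<psi>. \<bar>b \<psi>\<bar> \<le> s * \<delta>" "c \<in> C"
      unfolding P_def by auto
    have "\<bar>(r *\<^sub>R b) \<psi>\<bar> \<le> (r * s) * \<delta>" for \<psi>
      using mult_left_mono[OF *(4)[rule_format, of \<psi>] \<open>0 \<le> r\<close>] \<open>0 \<le> r\<close> by (simp add: abs_mult mult.assoc)
    moreover have "r *\<^sub>R u = (r * s) *\<^sub>R p + r *\<^sub>R b - a (r *\<^sub>R c)"
      unfolding *(1) a_scale[OF *(5,5)] by (simp add: scaleR_diff_right scaleR_add_right)
    ultimately show "r *\<^sub>R u \<in> P"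
      using * X scale \<open>0 \<le> r\<close>
      by (intro PI[of _ "r * s" "r *\<^sub>R b" "r *\<^sub>R c"]) (auto simp: subspace_scale)
  qed
  moreover have "P \<subseteq> X"
    unfolding P_def using X aX pX by (auto intro!: subspace_diff subspace_add subspace_scale)
  moreover have "- p \<notin> P"
  proof
    assume "- p \<in> P"
    then obtain s b c where *: "- p = s *\<^sub>R p + b - a c" "0 \<le> s" "b \<in> X" "\<forall>\<psi>. \<bar>b \<psi>\<bar> \<le> s * \<delta>" "c \<in> C"
      unfolding P_def by auto
    define c' where "c' = (1 / (1 + s)) *\<^sub>R c"
    have "\<bar>\<phi> c' - m \<phi>\<bar> < \<epsilon>" if \<phi>: "\<phi> \<in> I" for \<phi>
    proof -
      have "(- p) \<phi> = (s *\<^sub>R p + b - a c) \<phi>" using *(1) by simp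
      then have "\<phi> c = (1 + s) * m \<phi> + b \<phi>" using \<phi> by (simp add: p_def a_def algebra_simps)
      moreover have "\<phi> c' = \<phi> c / (1 + s)"
        using lin[OF \<phi>] *(5) CE by (auto simp: c'_def linear_into_scale)
      ultimately have "\<phi> c' - m \<phi> = b \<phi> / (1 + s)" using *(2) by (simp add: field_simps)
      then have "\<bar>\<phi> c' - m \<phi>\<bar> \<le> s * \<delta> / (1 + s)" using *(2,4) by (simp add: divide_right_mono)
      also have "\<dots> \<le> \<delta>" using *(2) \<delta> by (simp add: field_simps)
      finally show ?thesis using \<delta> by simp
    qed
    moreover have "c' \<in> C" using * scale by (simp add: c'_def)
    ultimately show False using no by blast
  qed
  moreover have "\<exists>t. t *\<^sub>R p - v \<in> P" if v: "v \<in> X" for v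
  proof -
    define t where "t = (\<Sum>\<phi>\<in>I. \<bar>v \<phi>\<bar>) / \<delta>"
    have "\<bar>(- v) \<psi>\<bar> \<le> t * \<delta>" for \<psi>
    proof (cases "\<psi> \<in> I")
      case True
      then show ?thesis using \<delta> I(1) by (auto simp: t_def intro: member_le_sum)
    next
      case False
      then show ?thesis using v \<delta> by (auto simp: t_def X_def sum_nonneg)
    qed
    moreover have "0 \<le> t" using \<delta> by (auto simp: t_def sum_nonneg)
    ultimately have "t *\<^sub>R p - v \<in> P"
      using v X \<open>0 \<in> C\<close> by (intro PI[of _ t "- v" 0]) (auto simp: a0 subspace_neg)
    then show ?thesis ..
  qed
  ultimately obtain L :: "(('e \<Rightarrow> real) \<Rightarrow> real) \<Rightarrow> real"
    where L: "linear_into X L" "\<And>v. v \<in> P \<Longrightarrow> 0 \<le> L v" "L p = 1"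
    using order_unit_state[OF X, of P p] pX by auto
  define e :: "('e \<Rightarrow> real) \<Rightarrow> ('e \<Rightarrow> real) \<Rightarrow> real" where "e \<phi> = (\<lambda>\<psi>. if \<psi> = \<phi> then 1 else 0)" for \<phi>
  have eX: "e \<phi> \<in> X" if "\<phi> \<in> I" for \<phi> using that by (auto simp: e_def X_def)
  have expand: "L v = (\<Sum>\<phi>\<in>I. v \<phi> * L (e \<phi>))" if v: "v \<in> X" for v
  proof -
    have "v = (\<Sum>\<phi>\<in>I. v \<phi> *\<^sub>R e \<phi>)"
    proof
      fix \<psi>
      have "(\<Sum>\<phi>\<in>I. v \<phi> *\<^sub>R e \<phi>) \<psi> = (\<Sum>\<phi>\<in>I. if \<psi> = \<phi> then v \<phi> else 0)"
        by (simp add: sum_fun_apply e_def if_distrib cong: if_cong)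
      also have "\<dots> = v \<psi>" using v I(1) by (simp add: X_def)
      finally show "v \<psi> = (\<Sum>\<phi>\<in>I. v \<phi> *\<^sub>R e \<phi>) \<psi>" by simp
    qed
    then have "L v = L (\<Sum>\<phi>\<in>I. v \<phi> *\<^sub>R e \<phi>)" by (rule arg_cong)
    also have "\<dots> = (\<Sum>\<phi>\<in>I. L (v \<phi> *\<^sub>R e \<phi>))"
      using X eX by (intro linear_into_sum[OF L(1)]) (auto intro: subspace_scale)
    also have "\<dots> = (\<Sum>\<phi>\<in>I. v \<phi> * L (e \<phi>))"
      using linear_into_scale[OF L(1)] eX by (intro sum.cong) auto
    finally show ?thesis .
  qed
  define \<psi>0 where "\<psi>0 = (\<Sum>\<phi>\<in>I. (- L (e \<phi>)) *\<^sub>R \<phi>)"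
  have inI: "(- L (e \<phi>)) *\<^sub>R \<phi> \<in> top_dual E T" if "\<phi> \<in> I" for \<phi>
    using that I subspace_top_dual by (intro subspace_scale) auto
  have "\<psi>0 \<in> top_dual E T"
    unfolding \<psi>0_def using inI subspace_top_dual by (intro subspace_sum) auto
  moreover have "0 \<le> \<psi>0 c" if c: "c \<in> C" for c
  proof -
    have "- a c \<in> P" using c X by (intro PI[of _ 0 0 c]) (auto simp: subspace_0)
    then have "0 \<le> L (- a c)" using L(2) by blast
    also have "\<dots> = - L (a c)" using aX L(1) by (rule linear_into_uminus[rotated])
    also have "\<dots> = \<psi>0 c"
      unfolding expand[OF aX] \<psi>0_def by (simp add: sum_fun_apply a_def sum_negf mult.commute)
    finally show ?thesis .
  qed
  ultimately have "0 \<le> m \<psi>0" by (rule pos)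
  also have "m \<psi>0 = (\<Sum>\<phi>\<in>I. m ((- L (e \<phi>)) *\<^sub>R \<phi>))"
    unfolding \<psi>0_def using inI by (intro linear_into_sum[OF m subspace_top_dual])
  also have "\<dots> = (\<Sum>\<phi>\<in>I. - (m \<phi> * L (e \<phi>)))"
  proof (rule sum.cong)
    fix \<phi> assume "\<phi> \<in> I"
    then show "m ((- L (e \<phi>)) *\<^sub>R \<phi>) = - (m \<phi> * L (e \<phi>))"
      using I(2) by (subst linear_into_scale[OF m]) auto
  qed simp
  also have "\<dots> = - L p" unfolding expand[OF pX] by (simp add: p_def sum_negf)
  finally show False using L(3) by simp
qed

text \<open>
  The bipolar theorem and completeness together: the finite approximations by points of \<open>C\<close> form the filter \<open>F\<close>,
  which is a Cauchy filter for the weak uniformity. Its limit in \<open>C\<close> represents \<open>m\<close>.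
\<close>

lemma weakly_complete_represents:
  fixes m :: "('e::real_vector \<Rightarrow> real) \<Rightarrow> real"
  assumes C: "proper_convex_cone E C" "weakly_complete E T C" and m: "linear_into (top_dual E T) m"
    and pos: "\<And>\<psi>. \<psi> \<in> top_dual E T \<Longrightarrow> (\<And>c. c \<in> C \<Longrightarrow> 0 \<le> \<psi> c) \<Longrightarrow> 0 \<le> m \<psi>"
  obtains x where "x \<in> C" "\<And>\<phi>. \<phi> \<in> top_dual E T \<Longrightarrow> \<phi> x = m \<phi>"
proof -
  define F where "F = inf (INF \<phi>\<in>top_dual E T. filtercomap \<phi> (nhds (m \<phi>))) (principal C)"
  have "F \<noteq> bot"
  proof
    assume "F = bot"
    then have "eventually (\<lambda>x. False) F" by simp
    then have "eventually (\<lambda>x. x \<in> C \<longrightarrow> False) (INF \<phi>\<in>top_dual E T. filtercomap \<phi> (nhds (m \<phi>)))"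
      by (simp only: F_def eventually_inf_principal)
    then obtain I where I: "I \<subseteq> top_dual E T" "finite I"
      "eventually (\<lambda>x. x \<in> C \<longrightarrow> False) (INF \<phi>\<in>I. filtercomap \<phi> (nhds (m \<phi>)))"
      unfolding eventually_INF[of _ _ "top_dual E T"] by blast
    then obtain Q where Q: "\<forall>\<phi>\<in>I. eventually (Q \<phi>) (filtercomap \<phi> (nhds (m \<phi>)))"
      "\<forall>y. (\<forall>\<phi>\<in>I. Q \<phi> y) \<longrightarrow> y \<in> C \<longrightarrow> False"
      unfolding eventually_INF_finite[OF I(2)] by blast
    have "\<forall>\<phi>\<in>I. \<exists>d>0. \<forall>x. \<bar>\<phi> x - m \<phi>\<bar> < d \<longrightarrow> Q \<phi> x"
    proof
      fix \<phi> assume "\<phi> \<in> I"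
      then obtain R where R: "eventually R (nhds (m \<phi>))" "\<forall>x. R (\<phi> x) \<longrightarrow> Q \<phi> x"
        using Q(1) unfolding eventually_filtercomap by blast
      then show "\<exists>d>0. \<forall>x. \<bar>\<phi> x - m \<phi>\<bar> < d \<longrightarrow> Q \<phi> x"
        unfolding eventually_nhds_metric dist_real_def by blast
    qed
    then obtain d where d: "\<forall>\<phi>\<in>I. 0 < d \<phi> \<and> (\<forall>x. \<bar>\<phi> x - m \<phi>\<bar> < d \<phi> \<longrightarrow> Q \<phi> x)" by metis
    define \<epsilon> where "\<epsilon> = Min (insert 1 (d ` I))"
    have "\<epsilon> > 0" using d I(2) by (auto simp: \<epsilon>_def)
    moreover have "\<epsilon> \<le> d \<phi>" if "\<phi> \<in> I" for \<phi> using that I(2) by (auto simp: \<epsilon>_def)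
    ultimately show False
      using cone_approximates_positive_functional[OF C(1) m pos I(2,1), of \<epsilon>] d Q(2) by force
  qed
  moreover have "F \<le> principal C" by (simp add: F_def)
  moreover have lim: "filtermap \<phi> F \<le> nhds (m \<phi>)" if "\<phi> \<in> top_dual E T" for \<phi>
    unfolding filtermap_le_iff_le_filtercomap F_def using that by (intro le_infI1 INF_lower)
  have "F \<times>\<^sub>F F \<le> weak_uniformity E T"
    unfolding weak_uniformity_def
  proof (rule INF_greatest)
    fix \<phi> assume "\<phi> \<in> top_dual E T"
    then have "filtermap \<phi> F \<times>\<^sub>F filtermap \<phi> F \<le> uniformity"
      using nhds_imp_cauchy_filter[OF lim] by (simp add: cauchy_filter_def)
    moreover have "filtermap (map_prod \<phi> \<phi>) (F \<times>\<^sub>F F) \<le> filtermap \<phi> F \<times>\<^sub>F filtermap \<phi> F"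
      unfolding le_filter_def eventually_filtermap eventually_prod_filter by (auto simp: map_prod_def) 
    ultimately show "F \<times>\<^sub>F F \<le> filtercomap (map_prod \<phi> \<phi>) uniformity"
      by (simp add: filtermap_le_iff_le_filtercomap[symmetric])
  qed
  ultimately obtain x where x: "x \<in> C" "F \<le> weak_nhds E T x"
    using C(2) unfolding weakly_complete_def by blast
  have "\<phi> x = m \<phi>" if \<phi>: "\<phi> \<in> top_dual E T" for \<phi>
  proof -
    have "F \<le> filtercomap \<phi> (nhds (\<phi> x))"
      using x(2) \<phi> unfolding weak_nhds_def le_INF_iff by blast
    then have "(\<phi> \<longlongrightarrow> \<phi> x) F" by (simp add: filterlim_def filtermap_le_iff_le_filtercomap)
    moreover have "(\<phi> \<longlongrightarrow> m \<phi>) F" using lim[OF \<phi>] by (simp add: filterlim_def)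
    ultimately show ?thesis using \<open>F \<noteq> bot\<close> by (rule tendsto_unique[rotated])
  qed
  then show ?thesis using that x by blast
qed

section \<open>Integrals on functions dominated by translates\<close>

text \<open>
  Values outside the carrier are kept. In this way translation is an action of the group on the set of all
  functions of type \<open>'g \<Rightarrow> real\<close>.
\<close>

definition translate :: "('g, 'm) monoid_scheme \<Rightarrow> 'g \<Rightarrow> ('g \<Rightarrow> real) \<Rightarrow> 'g \<Rightarrow> real" where
  "translate G g h = (\<lambda>x. if x \<in> carrier G then h (inv\<^bsub>G\<^esub> g \<otimes>\<^bsub>G\<^esub> x) else h x)"

text \<open>
  For \<open>K = carrier G\<close> this is the space \<open>\<ell>\<^sup>\<infinity>(G; f)\<close> of functions dominated by sums of translates of \<open>f\<close>. Smaller sets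
  \<open>K\<close> of translating elements occur when a subgroup acts on functions on \<open>G\<close>.
\<close>

definition dominated :: "('g, 'm) monoid_scheme \<Rightarrow> 'g set \<Rightarrow> ('g \<Rightarrow> real) \<Rightarrow> ('g \<Rightarrow> real) set" where
  "dominated G K f =
     {h. \<exists>gs. set gs \<subseteq> K \<and> (\<forall>x\<in>carrier G. \<bar>h x\<bar> \<le> (\<Sum>g\<leftarrow>gs. translate G g f x))}"

definition bounded_weight :: "('g, 'm) monoid_scheme \<Rightarrow> ('g \<Rightarrow> real) \<Rightarrow> bool" where
  "bounded_weight G f \<longleftrightarrow>
     (\<forall>x\<in>carrier G. 0 \<le> f x) \<and> (\<exists>B. \<forall>x\<in>carrier G. f x \<le> B) \<and> (\<exists>x\<in>carrier G. f x \<noteq> 0)"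

definition positive_functional ::
  "('g, 'm) monoid_scheme \<Rightarrow> ('g \<Rightarrow> real) set \<Rightarrow> (('g \<Rightarrow> real) \<Rightarrow> real) \<Rightarrow> bool" where
  "positive_functional G W m \<longleftrightarrow>
     linear_into W m \<and> (\<forall>h\<in>W. (\<forall>x\<in>carrier G. 0 \<le> h x) \<longrightarrow> 0 \<le> m h)"

definition invariant_integral ::
  "('g, 'm) monoid_scheme \<Rightarrow> ('g \<Rightarrow> real) \<Rightarrow> (('g \<Rightarrow> real) \<Rightarrow> real) \<Rightarrow> bool" where
  "invariant_integral G f m \<longleftrightarrow>
     positive_functional G (dominated G (carrier G) f) m \<and>
     (\<forall>g\<in>carrier G. \<forall>h\<in>dominated G (carrier G) f. m (translate G g h) = m h) \<and>
     m f = 1"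

text \<open>
  The property of \<open>G\<close> that replaces fixed points: it speaks about functions on \<open>G\<close> only and so does not refer to
  an ambient vector space.
\<close>

definition integral_property :: "('g, 'm) monoid_scheme \<Rightarrow> bool" where
  "integral_property G \<longleftrightarrow> (\<forall>f. bounded_weight G f \<longrightarrow> (\<exists>m. invariant_integral G f m))"

lemma dominatedI:
  "set gs \<subseteq> K \<Longrightarrow> (\<And>x. x \<in> carrier G \<Longrightarrow> \<bar>h x\<bar> \<le> (\<Sum>g\<leftarrow>gs. translate G g f x)) \<Longrightarrow> h \<in> dominated G K f"
  by (auto simp: dominated_def)

lemma dominated_cong:
  "h \<in> dominated G K f \<Longrightarrow> (\<And>x. x \<in> carrier G \<Longrightarrow> \<bar>h' x\<bar> \<le> \<bar>h x\<bar>) \<Longrightarrow> h' \<in> dominated G K f"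
  unfolding dominated_def by force

lemma bounded_weight_nonneg: "bounded_weight G f \<Longrightarrow> x \<in> carrier G \<Longrightarrow> 0 \<le> f x"
  by (simp add: bounded_weight_def)

lemma positive_functional_linear: "positive_functional G W m \<Longrightarrow> linear_into W m"
  by (simp add: positive_functional_def)

lemma positive_functional_nonneg:
  "positive_functional G W m \<Longrightarrow> h \<in> W \<Longrightarrow> (\<And>x. x \<in> carrier G \<Longrightarrow> 0 \<le> h x) \<Longrightarrow> 0 \<le> m h"
  by (simp add: positive_functional_def)

lemma positive_functional_abs_le:
  assumes m: "positive_functional G W m" and W: "subspace W" and h: "h \<in> W" "h' \<in> W"
    and le: "\<And>x. x \<in> carrier G \<Longrightarrow> \<bar>h x\<bar> \<le> h' x"
  shows "\<bar>m h\<bar> \<le> m h'"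
proof -
  have "0 \<le> h' x - h x" "0 \<le> h' x + h x" if "x \<in> carrier G" for x
    using le[OF that] by linarith+
  then have "0 \<le> m (h' - h)" "0 \<le> m (h' + h)"
    using h W by (auto intro!: positive_functional_nonneg[OF m] subspace_diff subspace_add)
  moreover have "m (h' - h) = m h' - m h" "m (h' + h) = m h' + m h"
    using h W positive_functional_linear[OF m] by (auto simp: linear_into_diff linear_into_add)
  ultimately show ?thesis by linarith
qed

lemma translate_add: "translate G g (h + h') = translate G g h + translate G g h'"
  and translate_scale: "translate G g (c *\<^sub>R h) = c *\<^sub>R translate G g h"
  and translate_uminus: "translate G g (- h) = - translate G g h"
  by (auto simp: translate_def fun_eq_iff)

context group
begin

lemma translate_apply: "x \<in> carrier G \<Longrightarrow> translate G g h x = h (inv g \<otimes> x)"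
  by (simp add: translate_def)

lemma translate_one: "translate G \<one> h = h"
  by (auto simp: translate_def)

lemma translate_translate:
  "g \<in> carrier G \<Longrightarrow> k \<in> carrier G \<Longrightarrow> translate G g (translate G k h) = translate G (g \<otimes> k) h"
  by (auto simp: translate_def fun_eq_iff inv_mult_group m_assoc)

lemma translate_nonneg:
  "g \<in> carrier G \<Longrightarrow> (\<And>x. x \<in> carrier G \<Longrightarrow> 0 \<le> h x) \<Longrightarrow> x \<in> carrier G \<Longrightarrow> 0 \<le> translate G g h x"
  by (simp add: translate_def)

lemma subspace_dominated:
  assumes f: "\<And>x. x \<in> carrier G \<Longrightarrow> 0 \<le> f x" and K: "K \<subseteq> carrier G"
  shows "subspace (dominated G K f)"
proof (rule subspaceI)
  show "0 \<in> dominated G K f" by (intro dominatedI[of "[]"]) auto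
next
  fix h h' assume "h \<in> dominated G K f" "h' \<in> dominated G K f"
  then obtain gs gs' where *: "set gs \<subseteq> K" "\<And>x. x \<in> carrier G \<Longrightarrow> \<bar>h x\<bar> \<le> (\<Sum>g\<leftarrow>gs. translate G g f x)"
    "set gs' \<subseteq> K" "\<And>x. x \<in> carrier G \<Longrightarrow> \<bar>h' x\<bar> \<le> (\<Sum>g\<leftarrow>gs'. translate G g f x)"
    unfolding dominated_def by blast
  show "h + h' \<in> dominated G K f"
  proof (rule dominatedI[of "gs @ gs'"])
    fix x assume "x \<in> carrier G"
    from *(2)[OF this] *(4)[OF this]
    show "\<bar>(h + h') x\<bar> \<le> (\<Sum>g\<leftarrow>gs @ gs'. translate G g f x)" by simp
  qed (use * in auto)
next
  fix c and h assume "h \<in> dominated G K f"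
  then obtain gs where *: "set gs \<subseteq> K" "\<And>x. x \<in> carrier G \<Longrightarrow> \<bar>h x\<bar> \<le> (\<Sum>g\<leftarrow>gs. translate G g f x)"
    unfolding dominated_def by blast
  obtain n :: nat where n: "\<bar>c\<bar> \<le> real n" using real_arch_simple by blast
  have conc: "(\<Sum>g\<leftarrow>concat (replicate n gs). F g) = real n * (\<Sum>g\<leftarrow>gs. F g)" for F :: "'a \<Rightarrow> real"
    by (induction n) (auto simp: algebra_simps)
  show "c *\<^sub>R h \<in> dominated G K f"
  proof (rule dominatedI[of "concat (replicate n gs)"])
    fix x assume "x \<in> carrier G"
    then have "\<bar>c\<bar> * \<bar>h x\<bar> \<le> real n * (\<Sum>g\<leftarrow>gs. translate G g f x)"
      using n *(2) by (intro mult_mono) auto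
    then show "\<bar>(c *\<^sub>R h) x\<bar> \<le> (\<Sum>g\<leftarrow>concat (replicate n gs). translate G g f x)"
      by (simp add: conc abs_mult)
  qed (use * in auto)
qed

lemma translate_in_dominated:
  assumes K: "subgroup K G" and g: "g \<in> K" and h: "h \<in> dominated G K f"
  shows "translate G g h \<in> dominated G K f"
proof -
  interpret K: subgroup K G by (rule K)
  obtain gs where *: "set gs \<subseteq> K" "\<And>x. x \<in> carrier G \<Longrightarrow> \<bar>h x\<bar> \<le> (\<Sum>g\<leftarrow>gs. translate G g f x)"
    using h unfolding dominated_def by blast
  show ?thesis
  proof (rule dominatedI[of "map ((\<otimes>) g) gs"])
    show "set (map ((\<otimes>) g) gs) \<subseteq> K" using * g by auto
  next
    fix x assume x: "x \<in> carrier G"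
    have "translate G (g \<otimes> k) f x = translate G k f (inv g \<otimes> x)" if "k \<in> set gs" for k
      using that * g x by (simp add: translate_translate[symmetric] translate_apply subset_iff)
    then have "(\<Sum>k\<leftarrow>map ((\<otimes>) g) gs. translate G k f x) = (\<Sum>k\<leftarrow>gs. translate G k f (inv g \<otimes> x))"
      by (simp add: o_def cong: map_cong)
    then show "\<bar>translate G g h x\<bar> \<le> (\<Sum>k\<leftarrow>map ((\<otimes>) g) gs. translate G k f x)"
      using *(2)[of "inv g \<otimes> x"] x g by (simp add: translate_apply)
  qed
qed

lemma weight_in_dominated:
  "bounded_weight G f \<Longrightarrow> \<one> \<in> K \<Longrightarrow> f \<in> dominated G K f"
  by (rule dominatedI[of "[\<one>]"]) (auto simp: translate_one bounded_weight_def)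

end

text \<open>
  A group with a nonzero bounded function \<open>f \<ge> 0\<close>, and the space \<open>D\<close> of functions dominated by it.
\<close>

locale weighted_group = group G for G (structure) +
  fixes f :: "'a \<Rightarrow> real"
  assumes weight: "bounded_weight G f"
begin

abbreviation D :: "('a \<Rightarrow> real) set" where
  "D \<equiv> dominated G (carrier G) f"

lemma f_nonneg: "x \<in> carrier G \<Longrightarrow> 0 \<le> f x"
  using weight by (rule bounded_weight_nonneg)

lemma f_nonzero: "\<exists>t\<in>carrier G. 0 < f t"
  using weight by (force simp: bounded_weight_def less_le)

lemma subspace_D: "subspace D"
  using f_nonneg by (rule subspace_dominated) auto

lemma f_in_D: "f \<in> D"
  using weight by (rule weight_in_dominated) auto

lemma translate_in_D: "g \<in> carrier G \<Longrightarrow> h \<in> D \<Longrightarrow> translate G g h \<in> D"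
  by (rule translate_in_dominated[OF subgroup_self])

lemma abs_in_D: "h \<in> D \<Longrightarrow> (\<lambda>x. \<bar>h x\<bar>) \<in> D"
  by (rule dominated_cong) auto

lemma f_bounded: "\<exists>b\<ge>0. \<forall>x\<in>carrier G. f x \<le> b"
proof -
  obtain b where b: "\<forall>x\<in>carrier G. f x \<le> b" using weight by (auto simp: bounded_weight_def)
  then have "0 \<le> b" using f_nonneg[OF one_closed] bspec[OF b one_closed] by linarith
  with b show ?thesis by blast
qed

lemma D_bounded:
  assumes "h \<in> D" shows "\<exists>B\<ge>0. \<forall>x\<in>carrier G. \<bar>h x\<bar> \<le> B"
proof -
  obtain b where b: "0 \<le> b" "\<And>x. x \<in> carrier G \<Longrightarrow> f x \<le> b" using f_bounded by blast
  obtain gs where gs: "set gs \<subseteq> carrier G" "\<And>x. x \<in> carrier G \<Longrightarrow> \<bar>h x\<bar> \<le> (\<Sum>g\<leftarrow>gs. translate G g f x)"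
    using assms unfolding dominated_def by blast
  have "\<bar>h x\<bar> \<le> real (length gs) * b" if x: "x \<in> carrier G" for x
  proof -
    have "(\<Sum>g\<leftarrow>gs. translate G g f x) \<le> (\<Sum>g\<leftarrow>gs. b)"
      using gs(1) x b by (intro sum_list_mono) (auto simp: translate_apply)
    then show ?thesis using gs(2)[OF x] by (simp add: sum_list_triv)
  qed
  then show ?thesis using b(1) by (intro exI[of _ "real (length gs) * b"]) auto
qed

lemma positive_functional_le_translates:
  assumes m: "positive_functional G D m" and "h \<in> D" "set gs \<subseteq> carrier G"
    and "\<And>x. x \<in> carrier G \<Longrightarrow> \<bar>h x\<bar> \<le> (\<Sum>g\<leftarrow>gs. translate G g f x)"
  shows "\<bar>m h\<bar> \<le> (\<Sum>g\<leftarrow>gs. m (translate G g f))"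
proof -
  have tr: "translate G g f \<in> D" if "g \<in> set gs" for g
    using that assms(3) by (auto intro: translate_in_D f_in_D)
  have "\<bar>m h\<bar> \<le> m (\<Sum>g\<leftarrow>gs. translate G g f)"
    using assms tr by (intro positive_functional_abs_le[OF m] subspace_sum_list subspace_D)
      (auto simp: sum_list_fun_apply)
  also have "\<dots> = (\<Sum>g\<leftarrow>gs. m (translate G g f))"
    using tr by (intro linear_into_sum_list[OF positive_functional_linear[OF m] subspace_D])
  finally show ?thesis .
qed

text \<open>
  Both \<open>h\<close> and \<open>- h\<close> satisfy the inequality, whence equality.
\<close>

lemma invariant_if_subinvariant:
  assumes m: "linear_into D m" and g: "g \<in> carrier G" and h: "h \<in> D"
    and sub: "\<And>h. h \<in> D \<Longrightarrow> 0 \<le> m (translate G g h - h)"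
  shows "m (translate G g h) = (m h :: real)"
proof -
  have "m h' \<le> m (translate G g h')" if "h' \<in> D" for h'
    using sub[OF that] linear_into_diff[OF m subspace_D translate_in_D[OF g that] that] by simp
  from this[OF h] this[of "- h"] show ?thesis
    using h g linear_into_uminus[OF m] by (simp add: translate_uminus subspace_neg subspace_D translate_in_D)
qed

text \<open>
  The compactness principle for functionals on \<open>D\<close>. The constraints \<open>c *\<^sub>R f - translate G g f\<close> bound all translates of
  \<open>f\<close> by \<open>c *\<^sub>R f\<close>, and this makes \<open>f\<close> an order unit: without them a function in \<open>D\<close> is dominated by translates
  of \<open>f\<close> but not by multiples of \<open>f\<close>.
\<close>

lemma constrained_positive_functional:
  assumes A: "A \<subseteq> D" and unit: "\<And>g. g \<in> carrier G \<Longrightarrow> c *\<^sub>R f - translate G g f \<in> A"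
    and approx: "\<And>A0 \<epsilon>. finite A0 \<Longrightarrow> A0 \<subseteq> A \<Longrightarrow> 0 < \<epsilon> \<Longrightarrow>
       \<exists>K m. \<one> \<in> K \<and> K \<subseteq> carrier G \<and> A0 \<subseteq> dominated G K f \<and> positive_functional G (dominated G K f) m \<and>
         (\<forall>a\<in>A0. - \<epsilon> \<le> m a) \<and> m f = 1"
  shows "\<exists>m. positive_functional G D m \<and> (\<forall>a\<in>A. 0 \<le> m a) \<and> m f = 1"
proof -
  define P where "P = {p \<in> D. \<forall>x\<in>carrier G. 0 \<le> p x}"
  have P: "wedge P" "P \<subseteq> D"
    using subspace_D by (auto simp: P_def wedge_def subspace_0 subspace_add subspace_scale)
  have "\<exists>m :: ('a \<Rightarrow> real) \<Rightarrow> real. linear_into D m \<and> (\<forall>p\<in>P. 0 \<le> m p) \<and> (\<forall>a\<in>A. 0 \<le> m a) \<and> m f = 1"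
  proof (rule constrained_state[OF subspace_D P A f_in_D])
    fix h assume h: "h \<in> D"
    then obtain gs where gs: "set gs \<subseteq> carrier G" "\<And>x. x \<in> carrier G \<Longrightarrow> \<bar>h x\<bar> \<le> (\<Sum>g\<leftarrow>gs. translate G g f x)"
      unfolding dominated_def by blast
    define as where "as = map (\<lambda>g. c *\<^sub>R f - translate G g f) gs"
    have as: "set as \<subseteq> A" using gs(1) unit by (auto simp: as_def)
    define t where "t = real (length gs) * c"
    have "(sum_list as) x = real (length gs) * c * f x - (\<Sum>g\<leftarrow>gs. translate G g f x)" for x
      unfolding as_def by (induction gs) (auto simp: algebra_simps)
    then have "0 \<le> (t *\<^sub>R f - h - sum_list as) x" if "x \<in> carrier G" for x
      using gs(2)[OF that] by (simp add: t_def)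
    moreover have "t *\<^sub>R f - h - sum_list as \<in> D"
      using h as A subspace_sum_list[OF subspace_D, of as "\<lambda>a. a"]
      by (intro subspace_diff subspace_scale subspace_D f_in_D) auto
    ultimately show "\<exists>t as. set as \<subseteq> A \<and> t *\<^sub>R f - h - sum_list as \<in> P"
      using as by (intro exI[of _ t] exI[of _ as]) (simp add: P_def)
  next
    fix A0 :: "('a \<Rightarrow> real) set" and \<epsilon> :: real assume "finite A0" "A0 \<subseteq> A" "0 < \<epsilon>"
    then obtain K m where K: "\<one> \<in> K" "K \<subseteq> carrier G" "A0 \<subseteq> dominated G K f"
      and m: "positive_functional G (dominated G K f) m" "\<forall>a\<in>A0. - \<epsilon> \<le> m a" "m f = 1"
      using approx by metis
    show "\<exists>W0 (m :: ('a \<Rightarrow> real) \<Rightarrow> real). subspace W0 \<and> f \<in> W0 \<and> A0 \<subseteq> W0 \<and> linear_into W0 m \<and>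
         (\<forall>p\<in>P \<inter> W0. 0 \<le> m p) \<and> (\<forall>a\<in>A0. - \<epsilon> \<le> m a) \<and> m f = 1"
      using K m subspace_dominated[OF f_nonneg K(2)] weight_in_dominated[OF weight K(1)]
      by (intro exI[of _ "dominated G K f"] exI[of _ m]) (auto simp: P_def positive_functional_def)
  qed
  then show ?thesis by (auto simp: P_def positive_functional_def)
qed

end

text \<open>
  The way in which the integral property is exploited. A linear map \<open>T\<close> from a space \<open>W\<close> to functions on \<open>Q\<close>, with
  values dominated by translates of \<open>T \<phi>\<close>, transports an integral on \<open>Q\<close> back to \<open>W\<close>. Whatever \<open>T\<close> turns into
  positivity or translation on \<open>Q\<close> is respected by the functional \<open>M\<close>. Only the values of \<open>T w\<close> on the carrier
  enter, because an integral ignores values elsewhere.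
\<close>

lemma integral_property_pullback:
  fixes T :: "'w::real_vector \<Rightarrow> 'q \<Rightarrow> real"
  assumes Q: "integral_property Q" and W: "subspace W"
    and T: "\<And>x. x \<in> carrier Q \<Longrightarrow> linear_into W (\<lambda>w. T w x)"
    and "\<phi> \<in> W" and weight: "bounded_weight Q (T \<phi>)"
    and dom: "\<And>w. w \<in> W \<Longrightarrow> T w \<in> dominated Q (carrier Q) (T \<phi>)"
  shows "\<exists>M :: 'w \<Rightarrow> real. linear_into W M \<and> M \<phi> = 1 \<and>
    (\<forall>w\<in>W. (\<forall>x\<in>carrier Q. 0 \<le> T w x) \<longrightarrow> 0 \<le> M w) \<and>
    (\<forall>w\<in>W. \<forall>w'\<in>W. \<forall>g\<in>carrier Q.
       (\<forall>x\<in>carrier Q. T w' x = T w (inv\<^bsub>Q\<^esub> g \<otimes>\<^bsub>Q\<^esub> x)) \<longrightarrow> M w' = M w)"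
proof -
  let ?D = "dominated Q (carrier Q) (T \<phi>)"
  obtain m where "invariant_integral Q (T \<phi>) m"
    using Q weight by (auto simp: integral_property_def)
  then have lin: "linear_into ?D m" and pos: "\<And>h. h \<in> ?D \<Longrightarrow> (\<And>x. x \<in> carrier Q \<Longrightarrow> 0 \<le> h x) \<Longrightarrow> 0 \<le> m h"
    and inv: "\<And>g h. g \<in> carrier Q \<Longrightarrow> h \<in> ?D \<Longrightarrow> m (translate Q g h) = m h" and one: "m (T \<phi>) = 1"
    by (simp_all add: invariant_integral_def positive_functional_def)
  have add: "m (h + h') = m h + m h'" and scale: "m (c *\<^sub>R h) = c * m h" if "h \<in> ?D" "h' \<in> ?D" for h h' c
    using lin that by (auto simp: linear_into_def)
  have cong: "m h' = m h" if "h \<in> ?D" "\<And>x. x \<in> carrier Q \<Longrightarrow> h' x = h x" for h h'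
  proof -
    have h': "h' \<in> ?D" using that by (auto intro: dominated_cong)
    have n: "- 1 *\<^sub>R h \<in> ?D" "- 1 *\<^sub>R h' \<in> ?D" using that h' by (auto intro: dominated_cong)
    have z: "h' + (- 1) *\<^sub>R h \<in> ?D" "h + (- 1) *\<^sub>R h' \<in> ?D"
      by (rule dominated_cong[OF that(1)], simp add: that(2))+
    have "0 \<le> m (h' + (- 1) *\<^sub>R h)" "0 \<le> m (h + (- 1) *\<^sub>R h')"
      by (rule pos[OF z(1)], simp add: that(2)) (rule pos[OF z(2)], simp add: that(2))
    moreover have "m (h' + (- 1) *\<^sub>R h) = m h' - m h" "m (h + (- 1) *\<^sub>R h') = m h - m h'"
      using add[OF h' n(1)] add[OF that(1) n(2)] scale[OF that(1) that(1), of "-1"] scale[OF h' h', of "-1"] by auto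
    ultimately show ?thesis by linarith
  qed
  define M where "M w = m (T w)" for w
  have "M (u + v) = M u + M v" if "u \<in> W" "v \<in> W" for u v
  proof -
    have "M (u + v) = m (T u + T v)"
      unfolding M_def using that W
      by (intro cong[symmetric] dom subspace_add) (simp_all add: linear_into_add[OF T])
    then show ?thesis using that by (simp add: M_def add dom)
  qed
  moreover have "M (c *\<^sub>R u) = c * M u" if "u \<in> W" for u c
  proof -
    have "M (c *\<^sub>R u) = m (c *\<^sub>R T u)"
      unfolding M_def using that W
      by (intro cong[symmetric] dom subspace_scale) (simp_all add: linear_into_scale[OF T])
    then show ?thesis using that by (simp add: M_def scale[OF dom dom])
  qed
  ultimately have "linear_into W M" by (simp add: linear_into_def)
  moreover have "M \<phi> = 1" by (simp add: M_def one)
  moreover have "0 \<le> M w" if "w \<in> W" "\<And>x. x \<in> carrier Q \<Longrightarrow> 0 \<le> T w x" for w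
    unfolding M_def using that by (intro pos dom)
  then have "\<forall>w\<in>W. (\<forall>x\<in>carrier Q. 0 \<le> T w x) \<longrightarrow> 0 \<le> M w" by blast
  moreover have "M w' = M w"
    if "w \<in> W" "w' \<in> W" "g \<in> carrier Q" "\<And>x. x \<in> carrier Q \<Longrightarrow> T w' x = T w (inv\<^bsub>Q\<^esub> g \<otimes>\<^bsub>Q\<^esub> x)" for w w' g
  proof -
    have "M w' = m (translate Q g (T w))"
      unfolding M_def using that by (intro cong[symmetric] dom) (simp_all add: translate_def)
    then show ?thesis using that by (simp add: M_def inv dom)
  qed
  then have "\<forall>w\<in>W. \<forall>w'\<in>W. \<forall>g\<in>carrier Q.
      (\<forall>x\<in>carrier Q. T w' x = T w (inv\<^bsub>Q\<^esub> g \<otimes>\<^bsub>Q\<^esub> x)) \<longrightarrow> M w' = M w" by blast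
  ultimately show ?thesis by blast
qed

section \<open>Integrals yield fixed points\<close>

text \<open>
  A vector \<open>x \<in> C\<close> with bounded orbit turns every \<open>\<psi> \<in> E'\<close> into the bounded function \<open>g \<mapsto> \<psi> (\<rho> g x)\<close> on \<open>G\<close>.
  If \<open>\<phi>\<close> cobounds the representation, all these functions are dominated by translates of the function of
  \<open>\<phi>\<close>. Pulling back an integral gives an invariant positive functional on \<open>E'\<close>, and since \<open>C\<close> is
  weakly complete this functional is a point of \<open>C\<close>.
\<close>

theorem integral_property_imp_fixed_point_property:
  fixes G (structure)
  assumes "group G" and int: "integral_property G"
  shows "fixed_point_property_cones TYPE('e::real_vector) G"
  unfolding fixed_point_property_cones_def
proof (intro allI impI)
  fix E :: "'e set" and T C \<rho>
  assume H: "lc_hausdorff_tvs E T \<and> proper_convex_cone E C \<and> weakly_complete E T C \<and>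
    cone_representation G E T C \<rho> \<and> locally_bounded_type G T C \<rho> \<and> cobounded_type G E T C \<rho>"
  then have tvs: "lc_hausdorff_tvs E T" and C: "proper_convex_cone E C" and wc: "weakly_complete E T C"
    and act: "group_action G E \<rho>"
    and rep: "\<And>g. g \<in> carrier G \<Longrightarrow> linear_into E (\<rho> g) \<and> continuous_map T T (\<rho> g) \<and> \<rho> g ` C \<subseteq> C"
    by (auto simp: cone_representation_def)
  interpret G: group G by fact
  interpret act: group_action G E \<rho> by fact
  have top: "topspace T = E" and sub: "subspace E" using tvs by (auto simp: lc_hausdorff_tvs_def)
  have CE: "C \<subseteq> E" using C by (simp add: proper_convex_cone_def)
  obtain x where x: "x \<in> C" "x \<noteq> 0" and bounded: "tvs_bounded T (orbit G \<rho> x)"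
    using H by (auto simp: locally_bounded_type_def)
  have xE: "x \<in> E" using x CE by blast
  have \<rho>C: "\<rho> g c \<in> C" if "g \<in> carrier G" "c \<in> C" for g c using rep that by blast
  have \<rho>E: "\<rho> g v \<in> E" if "g \<in> carrier G" "v \<in> E" for g v
    using act.element_image[OF that] by blast
  have dual_comp: "(\<lambda>v. \<psi> (\<rho> g v)) \<in> top_dual E T" if "\<psi> \<in> top_dual E T" "g \<in> carrier G" for \<psi> g
  proof -
    have "continuous_map T euclideanreal (\<psi> \<circ> \<rho> g)"
      using rep[OF that(2)] top_dualD(2)[OF that(1)] by (intro continuous_map_compose) auto
    moreover have "linear_into E (\<lambda>v. \<psi> (\<rho> g v))"
      using rep[OF that(2)] top_dualD(1)[OF that(1)] \<rho>E[OF that(2)] by (simp add: linear_into_def)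
    ultimately show ?thesis by (simp add: top_dual_def o_def)
  qed
  obtain \<phi> where \<phi>: "\<phi> \<in> top_dual E T" and cob: "\<And>\<psi>. \<psi> \<in> top_dual E T \<Longrightarrow> \<exists>gs. set gs \<subseteq> carrier G \<and>
        dual_le C \<psi> (\<lambda>x. \<Sum>g\<leftarrow>gs. dual_rep G \<rho> g \<phi> x) \<and>
        dual_le C (\<lambda>x. - \<psi> x) (\<lambda>x. \<Sum>g\<leftarrow>gs. dual_rep G \<rho> g \<phi> x)"
    using H unfolding cobounded_type_def by blast
  have cob: "\<exists>gs. set gs \<subseteq> carrier G \<and> (\<forall>c\<in>C. \<bar>\<psi> c\<bar> \<le> (\<Sum>g\<leftarrow>gs. \<phi> (\<rho> (inv g) c)))"
    if \<psi>: "\<psi> \<in> top_dual E T" for \<psi>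
  proof -
    obtain gs where *: "set gs \<subseteq> carrier G" "dual_le C \<psi> (\<lambda>x. \<Sum>g\<leftarrow>gs. dual_rep G \<rho> g \<phi> x)"
      "dual_le C (\<lambda>x. - \<psi> x) (\<lambda>x. \<Sum>g\<leftarrow>gs. dual_rep G \<rho> g \<phi> x)"
      using cob[OF \<psi>] by blast
    have "\<bar>\<psi> c\<bar> \<le> (\<Sum>g\<leftarrow>gs. \<phi> (\<rho> (inv g) c))" if "c \<in> C" for c
      using *(2,3) that by (force simp: dual_le_def dual_rep_def abs_le_iff)
    then show ?thesis using *(1) by blast
  qed
  \<comment> \<open>The functional \<open>\<phi>\<close> itself need not be positive, but a sum of translates that dominates it is.\<close>
  obtain gs0 where gs0: "set gs0 \<subseteq> carrier G"
    "\<And>c. c \<in> C \<Longrightarrow> \<bar>\<phi> c\<bar> \<le> (\<Sum>g\<leftarrow>gs0. \<phi> (\<rho> (inv g) c))"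
    using cob[OF \<phi>] by blast
  define \<phi>' where "\<phi>' = (\<Sum>g\<leftarrow>gs0. (\<lambda>v. \<phi> (\<rho> (inv g) v)))"
  have \<phi>': "\<phi>' \<in> top_dual E T"
    unfolding \<phi>'_def using gs0(1) \<phi> by (intro subspace_sum_list subspace_top_dual dual_comp) auto
  have le: "\<bar>\<phi> c\<bar> \<le> \<phi>' c" if "c \<in> C" for c
    using gs0(2)[OF that] by (simp add: \<phi>'_def sum_list_fun_apply)
  have comp: "\<rho> (inv g) (\<rho> h v) = \<rho> (inv g \<otimes> h) v" if "g \<in> carrier G" "h \<in> carrier G" "v \<in> E" for g h v
    using that act.composition_rule[of v "inv g" h] by simp
  define L where "L \<psi> g = \<psi> (\<rho> g x)" for \<psi> :: "'e \<Rightarrow> real" and g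
  have dom: "L \<psi> \<in> dominated G (carrier G) (L \<phi>')" if \<psi>: "\<psi> \<in> top_dual E T" for \<psi>
  proof -
    obtain gs where gs: "set gs \<subseteq> carrier G" "\<And>c. c \<in> C \<Longrightarrow> \<bar>\<psi> c\<bar> \<le> (\<Sum>g\<leftarrow>gs. \<phi> (\<rho> (inv g) c))"
      using cob[OF \<psi>] by blast
    show ?thesis
    proof (rule dominatedI[OF gs(1)])
      fix h assume h: "h \<in> carrier G"
      have "\<bar>L \<psi> h\<bar> \<le> (\<Sum>g\<leftarrow>gs. \<phi> (\<rho> (inv g) (\<rho> h x)))" unfolding L_def by (intro gs \<rho>C h x)
      also have "\<dots> \<le> (\<Sum>g\<leftarrow>gs. translate G g (L \<phi>') h)"
      proof (rule sum_list_mono)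
        fix g assume "g \<in> set gs"
        then have g: "g \<in> carrier G" using gs by blast
        then have "\<phi> (\<rho> (inv g \<otimes> h) x) \<le> \<phi>' (\<rho> (inv g \<otimes> h) x)"
          using le[of "\<rho> (inv g \<otimes> h) x"] \<rho>C[OF _ x(1)] h by (simp add: abs_le_iff)
        then show "\<phi> (\<rho> (inv g) (\<rho> h x)) \<le> translate G g (L \<phi>') h"
          using comp[OF g h xE] h by (simp add: L_def G.translate_apply)
      qed
      finally show "\<bar>L \<psi> h\<bar> \<le> (\<Sum>g\<leftarrow>gs. translate G g (L \<phi>') h)" .
    qed
  qed
  have weight: "bounded_weight G (L \<phi>')"
    unfolding bounded_weight_def
  proof (intro conjI ballI)
    fix g assume "g \<in> carrier G"
    then show "0 \<le> L \<phi>' g" using le[OF \<rho>C[OF _ x(1)], of g] by (simp add: L_def)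
  next
    define U where "U = {v \<in> topspace T. \<phi>' v \<in> {-1<..<1}}"
    have "openin T U" unfolding U_def
      using top_dualD(2)[OF \<phi>'] by (rule openin_continuous_map_preimage) auto
    moreover have "0 \<in> U"
      using linear_into_zero[OF top_dualD(1)[OF \<phi>'] xE] sub top by (simp add: U_def subspace_0)
    ultimately obtain r where r: "r > 0" "\<And>c. r \<le> \<bar>c\<bar> \<Longrightarrow> orbit G \<rho> x \<subseteq> (\<lambda>x. c *\<^sub>R x) ` U"
      using bounded unfolding tvs_bounded_def by blast
    have "L \<phi>' g \<le> r" if g: "g \<in> carrier G" for g
    proof -
      have "\<rho> g x \<in> (\<lambda>x. r *\<^sub>R x) ` U" using r g by (force simp: orbit_def)
      then obtain u where u: "u \<in> U" "\<rho> g x = r *\<^sub>R u" by blast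
      then have "L \<phi>' g = r * \<phi>' u"
        using linear_into_scale[OF top_dualD(1)[OF \<phi>'], of u r] top by (simp add: L_def U_def)
      also have "\<dots> \<le> r" using u r by (simp add: U_def)
      finally show ?thesis .
    qed
    then show "\<exists>B. \<forall>g\<in>carrier G. L \<phi>' g \<le> B" by blast
  next
    obtain \<psi> where \<psi>: "\<psi> \<in> top_dual E T" "\<psi> x \<noteq> 0" using top_dual_separates[OF tvs xE x(2)] by blast
    have \<rho>1: "\<rho> \<one> x = x" using act.id_eq_one xE by (metis restrict_apply')
    show "\<exists>g\<in>carrier G. L \<phi>' g \<noteq> 0"
    proof (rule ccontr)
      assume "\<not> ?thesis"
      then have z: "L \<phi>' g = 0" if "g \<in> carrier G" for g using that by blast
      obtain gs where gs: "set gs \<subseteq> carrier G"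
        "\<And>g. g \<in> carrier G \<Longrightarrow> \<bar>L \<psi> g\<bar> \<le> (\<Sum>k\<leftarrow>gs. translate G k (L \<phi>') g)"
        using dom[OF \<psi>(1)] unfolding dominated_def by blast
      have "(\<Sum>k\<leftarrow>gs. translate G k (L \<phi>') \<one>) = (\<Sum>k\<leftarrow>gs. 0)"
        using gs(1) z by (intro arg_cong[of _ _ sum_list] map_cong) (auto simp: translate_def)
      then have "\<bar>L \<psi> \<one>\<bar> \<le> 0" using gs(2)[of "\<one>"] by simp
      then show False using \<psi>(2) \<rho>1 by (simp add: L_def)
    qed
  qed
  have "linear_into (top_dual E T) (\<lambda>\<psi>. L \<psi> g)" for g by (simp add: linear_into_def L_def)
  note pullback = integral_property_pullback[where T = L, OF int subspace_top_dual this \<phi>' weight dom]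
  obtain M :: "('e \<Rightarrow> real) \<Rightarrow> real" where M: "linear_into (top_dual E T) M" "M \<phi>' = 1"
    "\<And>\<psi>. \<psi> \<in> top_dual E T \<Longrightarrow> \<forall>g\<in>carrier G. 0 \<le> L \<psi> g \<Longrightarrow> 0 \<le> M \<psi>"
    "\<And>\<psi> \<psi>' g. \<psi> \<in> top_dual E T \<Longrightarrow> \<psi>' \<in> top_dual E T \<Longrightarrow> g \<in> carrier G \<Longrightarrow>
       \<forall>h\<in>carrier G. L \<psi>' h = L \<psi> (inv g \<otimes> h) \<Longrightarrow> M \<psi>' = M \<psi>"
    using pullback by blast
  obtain y where y: "y \<in> C" "\<And>\<psi>. \<psi> \<in> top_dual E T \<Longrightarrow> \<psi> y = M \<psi>"
  proof (rule weakly_complete_represents[OF C wc M(1)])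
    fix \<psi> assume "\<psi> \<in> top_dual E T" "\<And>c. c \<in> C \<Longrightarrow> 0 \<le> \<psi> c"
    then show "0 \<le> M \<psi>" using \<rho>C[OF _ x(1)] by (intro M(3)) (auto simp: L_def)
  qed blast
  have yE: "y \<in> E" using y CE by blast
  have "y \<noteq> 0"
  proof
    assume "y = 0"
    then show False using y(2)[OF \<phi>'] M(2) linear_into_zero[OF top_dualD(1)[OF \<phi>'] xE] by simp
  qed
  moreover have "\<rho> g y = y" if g: "g \<in> carrier G" for g
  proof (rule ccontr)
    assume "\<rho> g y \<noteq> y"
    then have "\<rho> g y - y \<noteq> 0" "\<rho> g y - y \<in> E" using \<rho>E[OF g yE] yE sub by (auto intro: subspace_diff)
    then obtain \<psi> where \<psi>: "\<psi> \<in> top_dual E T" "\<psi> (\<rho> g y - y) \<noteq> 0"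
      using top_dual_separates[OF tvs] by metis
    have "\<psi> (\<rho> g y) = M (\<lambda>v. \<psi> (\<rho> g v))" using y(2)[OF dual_comp[OF \<psi>(1) g]] by simp
    also have "\<dots> = M \<psi>"
    proof (rule M(4))
      show "inv g \<in> carrier G" using g by simp
      show "\<forall>h\<in>carrier G. L (\<lambda>v. \<psi> (\<rho> g v)) h = L \<psi> (inv (inv g) \<otimes> h)"
        using comp[of "inv g" _ x] g xE by (simp add: L_def)
    qed (use \<psi> g dual_comp in auto)
    also have "\<dots> = \<psi> y" using y(2)[OF \<psi>(1)] by simp
    finally show False
      using \<psi> linear_into_diff[OF top_dualD(1)[OF \<psi>(1)] sub \<rho>E[OF g yE] yE] by simp
  qed
  ultimately show "\<exists>x\<in>C. x \<noteq> 0 \<and> (\<forall>g\<in>carrier G. \<rho> g x = x)" using y(1) by blast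
qed

section \<open>Copies of product spaces\<close>

text \<open>
  The representation needed for the converse lives on the product space \<open>\<real>\<^sup>I\<close>, but the fixed-point property is assumed for
  subspaces of another type \<open>'u\<close>. An injective linear map \<open>J\<close> carries the product topology over to its range.
\<close>

locale product_copy =
  fixes J :: "('i \<Rightarrow> real) \<Rightarrow> 'u::real_vector"
  assumes linear: "linear J" and inj: "inj J"
begin

abbreviation J' :: "'u \<Rightarrow> 'i \<Rightarrow> real" where
  "J' \<equiv> inv_into UNIV J"

definition coord :: "'i \<Rightarrow> 'u \<Rightarrow> real" where
  "coord i u = J' u i"

definition topol :: "'u topology" where
  "topol = pullback_topology (range J) (J') (product_topology (\<lambda>_. euclideanreal) UNIV)"

lemma J'_J [simp]: "J' (J v) = v"
  using inj by simp

lemma coord_J [simp]: "coord i (J v) = v i"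
  by (simp add: coord_def)

lemma J_add: "J (v + w) = J v + J w" and J_scale: "J (c *\<^sub>R v) = c *\<^sub>R J v" and J_0: "J 0 = 0"
  and J_uminus: "J (- v) = - J v" and J_sum: "J (\<Sum>a\<in>A. f a) = (\<Sum>a\<in>A. J (f a))"
  using linear by (simp_all add: linear_add linear_scale linear_0 linear_neg linear_sum)

lemma subspace_range: "subspace (range J)"
  using linear by (simp add: linear_subspace_image)

lemma topspace_topol [simp]: "topspace topol = range J"
  by (auto simp: topol_def topspace_pullback_topology)

lemma linear_into_coord: "linear_into (range J) (coord i)"
  unfolding linear_into_def by (auto simp flip: J_add J_scale)

lemma continuous_map_into_topol:
  "continuous_map X topol f \<longleftrightarrow>
     f ` topspace X \<subseteq> range J \<and> (\<forall>i. continuous_map X euclideanreal (\<lambda>x. coord i (f x)))"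
proof
  assume f: "continuous_map X topol f"
  have "continuous_map topol (product_topology (\<lambda>_. euclideanreal) UNIV) (id \<circ> J')"
    unfolding topol_def by (rule continuous_map_pullback) simp
  from continuous_map_compose[OF f this]
  have "\<forall>i. continuous_map X euclideanreal (\<lambda>x. coord i (f x))"
    by (simp add: continuous_map_componentwise_UNIV coord_def o_def)
  then show "f ` topspace X \<subseteq> range J \<and> (\<forall>i. continuous_map X euclideanreal (\<lambda>x. coord i (f x)))"
    using continuous_map_image_subset_topspace[OF f] by simp
next
  assume f: "f ` topspace X \<subseteq> range J \<and> (\<forall>i. continuous_map X euclideanreal (\<lambda>x. coord i (f x)))"
  show "continuous_map X topol f"
    unfolding topol_def
    by (rule continuous_map_pullback') (use f in \<open>auto simp: continuous_map_componentwise_UNIV coord_def\<close>)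
qed

lemma continuous_map_coord: "continuous_map topol euclideanreal (coord i)"
  using continuous_map_into_topol[of topol "\<lambda>x. x"] by simp

lemma coord_in_dual: "coord i \<in> top_dual (range J) topol"
  by (simp add: top_dual_def linear_into_coord continuous_map_coord)

definition box :: "'i set \<Rightarrow> real \<Rightarrow> 'u set" where
  "box I \<epsilon> = J ` {v. \<forall>i\<in>I. \<bar>v i\<bar> < \<epsilon>}"

lemma openin_box: assumes "finite I" shows "openin topol (box I \<epsilon>)"
proof -
  let ?X = "\<lambda>i. if i \<in> I then {- \<epsilon><..<\<epsilon>} else UNIV"
  have "{i. ?X i \<noteq> topspace euclideanreal} \<subseteq> I" by auto
  then have "openin (product_topology (\<lambda>_. euclideanreal) UNIV) (\<Pi>\<^sub>E i\<in>UNIV. ?X i)"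
    using assms finite_subset by (intro product_topology_basis) auto
  moreover have "box I \<epsilon> = J' -` (\<Pi>\<^sub>E i\<in>UNIV. ?X i) \<inter> range J"
    by (auto simp: box_def PiE_def Pi_def abs_less_iff minus_less_iff)
  ultimately show ?thesis unfolding topol_def openin_pullback_topology by blast
qed

lemma convex_box: "convex (box I \<epsilon>)"
proof -
  have "convex {v :: 'i \<Rightarrow> real. \<forall>i\<in>I. \<bar>v i\<bar> < \<epsilon>}"
  proof (rule convexI)
    fix v w :: "'i \<Rightarrow> real" and a b :: real
    assume *: "v \<in> {v. \<forall>i\<in>I. \<bar>v i\<bar> < \<epsilon>}" "w \<in> {v. \<forall>i\<in>I. \<bar>v i\<bar> < \<epsilon>}" "0 \<le> a" "0 \<le> b" "a + b = 1"
    have "\<bar>a * v i + b * w i\<bar> < \<epsilon>" if "i \<in> I" for i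
    proof -
      have "\<bar>a * v i + b * w i\<bar> \<le> a * \<bar>v i\<bar> + b * \<bar>w i\<bar>"
        using *(3,4) abs_triangle_ineq[of "a * v i" "b * w i"] by (simp add: abs_mult)
      also have "\<dots> < \<epsilon>" using * that by (intro convex_bound_lt) auto
      finally show ?thesis .
    qed
    then show "a *\<^sub>R v + b *\<^sub>R w \<in> {v. \<forall>i\<in>I. \<bar>v i\<bar> < \<epsilon>}" by simp
  qed
  then show ?thesis unfolding box_def using linear by (intro convex_linear_image)
qed

lemma open_contains_box:
  assumes W: "openin topol W" "0 \<in> W"
  obtains I \<epsilon> where "finite I" "0 < \<epsilon>" "box I \<epsilon> \<subseteq> W"
proof -
  obtain O' where O': "openin (product_topology (\<lambda>_. euclideanreal) UNIV) O'" "W = J' -` O' \<inter> range J"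
    using W(1) unfolding topol_def openin_pullback_topology by blast
  have "J' (J 0) \<in> O'" using W(2) O'(2) by (simp add: J_0)
  then have "0 \<in> O'" by simp
  then obtain U where U: "finite {i. U i \<noteq> (UNIV :: real set)}" "\<forall>i. open (U i)"
    "(0 :: 'i \<Rightarrow> real) \<in> Pi\<^sub>E UNIV U" "Pi\<^sub>E UNIV U \<subseteq> O'"
    using O'(1) unfolding openin_product_topology_alt by force
  let ?I = "{i. U i \<noteq> UNIV}"
  have "\<exists>d>0. ball 0 d \<subseteq> U i" for i
    using U(2,3) by (auto simp: PiE_def Pi_def open_contains_ball)
  then obtain d where d: "\<And>i. 0 < d i" "\<And>i. ball 0 (d i) \<subseteq> U i" by metis
  define \<epsilon> where "\<epsilon> = Min (insert 1 (d ` ?I))"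
  have pos: "0 < \<epsilon>" using U(1) d by (auto simp: \<epsilon>_def)
  have le: "\<epsilon> \<le> d i" if "i \<in> ?I" for i using that U(1) by (auto simp: \<epsilon>_def)
  have "box ?I \<epsilon> \<subseteq> W"
  proof
    fix u assume "u \<in> box ?I \<epsilon>"
    then obtain v where v: "u = J v" "\<forall>i\<in>?I. \<bar>v i\<bar> < \<epsilon>" by (auto simp: box_def)
    have "v i \<in> U i" for i
    proof (cases "i \<in> ?I")
      case True
      then have "v i \<in> ball 0 (d i)" using v(2) le[OF True] by (auto simp: dist_real_def)
      then show ?thesis using d by blast
    qed simp
    then show "u \<in> W" using U(4) v(1) O'(2) by (auto simp: PiE_def Pi_def)
  qed
  then show ?thesis by (rule that[OF U(1) pos])
qed

lemma lc_hausdorff: "lc_hausdorff_tvs (range J) topol"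
  unfolding lc_hausdorff_tvs_def
proof (intro conjI)
  have add: "coord i (u + w) = coord i u + coord i w" and scale: "coord i (c *\<^sub>R u) = c * coord i u"
    if "u \<in> range J" "w \<in> range J" for i c u w
    using linear_into_coord[of i] that unfolding linear_into_def by auto
  show "continuous_map (prod_topology topol topol) topol (\<lambda>(x, y). x + y)"
    unfolding continuous_map_into_topol
  proof (intro conjI allI)
    show "(\<lambda>(x, y). x + y) ` topspace (prod_topology topol topol) \<subseteq> range J"
      using subspace_range by (auto intro: subspace_add)
    fix i
    have "continuous_map (prod_topology topol topol) euclideanreal (\<lambda>z. coord i (fst z) + coord i (snd z))"
      using continuous_map_compose[OF continuous_map_fst continuous_map_coord[of i]]
        continuous_map_compose[OF continuous_map_snd continuous_map_coord[of i]]
      by (intro continuous_map_add) (auto simp: o_def)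
    then show "continuous_map (prod_topology topol topol) euclideanreal (\<lambda>z. coord i (case z of (x, y) \<Rightarrow> x + y))"
      by (rule continuous_map_eq) (auto simp: add)
  qed
  show "continuous_map (prod_topology euclideanreal topol) topol (\<lambda>(c, x). c *\<^sub>R x)"
    unfolding continuous_map_into_topol
  proof (intro conjI allI)
    show "(\<lambda>(c, x). c *\<^sub>R x) ` topspace (prod_topology euclideanreal topol) \<subseteq> range J"
      using subspace_range by (auto intro: subspace_scale)
    fix i
    have "continuous_map (prod_topology euclideanreal topol) euclideanreal (\<lambda>z. fst z * coord i (snd z))"
      using continuous_map_fst continuous_map_compose[OF continuous_map_snd continuous_map_coord[of i]]
      by (intro continuous_map_real_mult) (auto simp: o_def)
    then show "continuous_map (prod_topology euclideanreal topol) euclideanreal (\<lambda>z. coord i (case z of (c, x) \<Rightarrow> c *\<^sub>R x))"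
      by (rule continuous_map_eq) (auto simp: scale[OF rangeI rangeI])
  qed
  show "Hausdorff_space topol"
  proof (rule Hausdorff_space_injective_preimage)
    show "Hausdorff_space (product_topology (\<lambda>_::'i. euclideanreal) UNIV)"
      unfolding Hausdorff_space_product_topology by simp
    show "continuous_map topol (product_topology (\<lambda>_. euclideanreal) UNIV) (J')"
      using continuous_map_coord by (simp add: continuous_map_componentwise_UNIV coord_def[abs_def])
    show "inj_on (J') (topspace topol)" by (simp add: inj_on_inv_into)
  qed
  show "neighbourhood_base_at 0 convex topol"
    unfolding neighbourhood_base_at_def
  proof (intro allI impI, elim conjE)
    fix W assume "openin topol W" "0 \<in> W"
    then obtain I \<epsilon> where *: "finite I" "0 < \<epsilon>" "box I \<epsilon> \<subseteq> W" by (rule open_contains_box)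
    have "J 0 \<in> box I \<epsilon>" unfolding box_def using *(2) by (intro imageI) simp
    then show "\<exists>U V. openin topol U \<and> convex V \<and> 0 \<in> U \<and> U \<subseteq> V \<and> V \<subseteq> W"
      using * openin_box convex_box J_0 by (intro exI[of _ "box I \<epsilon>"]) auto
  qed
qed (simp_all add: subspace_range)

text \<open>
  A functional that is continuous for the product topology is bounded on some \<open>box I \<epsilon>\<close>, so it vanishes on all
  vectors whose coordinates in the finite set \<open>I\<close> are zero.
\<close>

lemma dual_finite_combination:
  assumes \<psi>: "\<psi> \<in> top_dual (range J) topol"
  shows "\<exists>I a. finite I \<and> (\<forall>v. \<psi> (J v) = (\<Sum>i\<in>I. a i * v i))"
proof -
  have lin: "linear_into (range J) \<psi>" and cont: "continuous_map topol euclideanreal \<psi>"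
    using \<psi> by (auto simp: top_dual_def)
  have "openin topol {u \<in> topspace topol. \<psi> u \<in> {-1<..<1}}"
    using cont by (rule openin_continuous_map_preimage) auto
  moreover have "0 \<in> {u \<in> topspace topol. \<psi> u \<in> {-1<..<1}}"
    using linear_into_zero[OF lin, of "J 0"] J_0 by (auto intro!: range_eqI[of _ _ 0])
  ultimately obtain I \<epsilon> where I: "finite I" "0 < \<epsilon>" "box I \<epsilon> \<subseteq> {u \<in> topspace topol. \<psi> u \<in> {-1<..<1}}"
    by (rule open_contains_box)
  have vanish: "\<psi> (J v) = 0" if v: "\<forall>i\<in>I. v i = 0" for v
  proof (rule ccontr)
    assume nz: "\<psi> (J v) \<noteq> 0"
    define t where "t = 1 / \<psi> (J v)"
    have "J (t *\<^sub>R v) \<in> box I \<epsilon>" unfolding box_def using v I(2) by (intro imageI) simp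
    then have "\<psi> (J (t *\<^sub>R v)) < 1" using I(3) by auto
    moreover have "\<psi> (J (t *\<^sub>R v)) = t * \<psi> (J v)" using linear_into_scale[OF lin, of "J v" t] by (simp add: J_scale)
    ultimately show False using nz by (simp add: t_def)
  qed
  define e :: "'i \<Rightarrow> 'i \<Rightarrow> real" where "e i = (\<lambda>j. if j = i then 1 else 0)" for i
  have "\<psi> (J v) = (\<Sum>i\<in>I. \<psi> (J (e i)) * v i)" for v
  proof -
    define r where "r = v - (\<Sum>i\<in>I. v i *\<^sub>R e i)"
    have "(\<Sum>i\<in>I. v i *\<^sub>R e i) j = v j" if "j \<in> I" for j
    proof -
      have "(\<Sum>i\<in>I. v i *\<^sub>R e i) j = (\<Sum>i\<in>I. if j = i then v i else 0)"
        by (simp add: sum_fun_apply e_def if_distrib cong: if_cong)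
      then show ?thesis using that I(1) by simp
    qed
    then have r: "\<psi> (J r) = 0" by (intro vanish) (simp add: r_def)
    have "J v = J (r + (\<Sum>i\<in>I. v i *\<^sub>R e i))" by (simp add: r_def)
    also have "\<dots> = J r + (\<Sum>i\<in>I. v i *\<^sub>R J (e i))" by (simp add: J_add J_sum J_scale)
    finally have "\<psi> (J v) = \<psi> (J r + (\<Sum>i\<in>I. v i *\<^sub>R J (e i)))" by (rule arg_cong)
    also have "\<dots> = \<psi> (J r) + \<psi> (\<Sum>i\<in>I. v i *\<^sub>R J (e i))"
      using subspace_range by (intro linear_into_add[OF lin] subspace_sum) (auto intro: subspace_scale)
    also have "\<psi> (\<Sum>i\<in>I. v i *\<^sub>R J (e i)) = (\<Sum>i\<in>I. \<psi> (v i *\<^sub>R J (e i)))"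
      using subspace_range by (intro linear_into_sum[OF lin]) (auto intro: subspace_scale)
    also have "\<dots> = (\<Sum>i\<in>I. \<psi> (J (e i)) * v i)"
      by (simp add: linear_into_scale[OF lin] mult.commute)
    finally show ?thesis using r by simp
  qed
  with I(1) show ?thesis by (intro exI[of _ I] exI[of _ "\<lambda>i. \<psi> (J (e i))"] conjI allI)
qed

text \<open>
  Coordinates are continuous functionals, so a weak Cauchy filter converges in each coordinate; by
  \<open>dual_finite_combination\<close> coordinatewise convergence is weak convergence.
\<close>

lemma weakly_completeI:
  assumes closed: "\<And>m F. F \<noteq> bot \<Longrightarrow> F \<le> principal C \<Longrightarrow> (\<And>i. ((\<lambda>v. v i) \<longlongrightarrow> m i) F) \<Longrightarrow> m \<in> C"
  shows "weakly_complete (range J) topol (J ` C)"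
  unfolding weakly_complete_def
proof (intro allI impI, elim conjE)
  fix F assume F: "F \<le> principal (J ` C)" "F \<noteq> bot" "F \<times>\<^sub>F F \<le> weak_uniformity (range J) topol"
  have "\<exists>l. filtermap (coord i) F \<le> nhds l" for i
  proof -
    have "F \<times>\<^sub>F F \<le> filtercomap (map_prod (coord i) (coord i)) uniformity"
      using F(3) coord_in_dual[of i] unfolding weak_uniformity_def le_INF_iff by blast
    then have 1: "filtermap (map_prod (coord i) (coord i)) (F \<times>\<^sub>F F) \<le> uniformity"
      by (simp add: filtermap_le_iff_le_filtercomap)
    have "filtermap (coord i) F \<times>\<^sub>F filtermap (coord i) F \<le> filtermap (map_prod (coord i) (coord i)) (F \<times>\<^sub>F F)"
    proof (rule filter_leI)
      fix P assume "eventually P (filtermap (map_prod (coord i) (coord i)) (F \<times>\<^sub>F F))"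
      then obtain Q where Q: "eventually Q F" "\<And>x y. Q x \<Longrightarrow> Q y \<Longrightarrow> P (coord i x, coord i y)"
        unfolding eventually_filtermap eventually_prod_same by auto
      define R where "R z = (\<exists>x. Q x \<and> z = coord i x)" for z
      have "eventually R (filtermap (coord i) F)"
        unfolding eventually_filtermap using Q(1) by (rule eventually_mono) (auto simp: R_def)
      then show "eventually P (filtermap (coord i) F \<times>\<^sub>F filtermap (coord i) F)"
        unfolding eventually_prod_same
        using Q(2) by (intro exI[of _ R]) (auto simp: R_def)
    qed
    then have "cauchy_filter (filtermap (coord i) F)" using 1 by (simp add: cauchy_filter_def)
    moreover have "filtermap (coord i) F \<noteq> bot" using F(2) by (simp add: filtermap_bot_iff)
    ultimately show ?thesis
      using complete_uniform[of "UNIV :: real set"] complete_UNIV by auto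
  qed
  then obtain m where m: "\<And>i. filtermap (coord i) F \<le> nhds (m i)" by metis
  then have lim: "(coord i \<longlongrightarrow> m i) F" for i by (simp add: filterlim_def)
  have ev: "eventually (\<lambda>u. u \<in> J ` C) F" using F(1) by (simp add: le_principal)
  have "m \<in> C"
  proof (rule closed)
    show "filtermap (J') F \<noteq> bot" using F(2) by (simp add: filtermap_bot_iff)
    show "filtermap (J') F \<le> principal C"
      unfolding le_principal eventually_filtermap using ev by (rule eventually_mono) auto
    show "((\<lambda>v. v i) \<longlongrightarrow> m i) (filtermap (J') F)" for i
      using lim[of i] by (simp add: filterlim_filtermap coord_def[abs_def])
  qed
  moreover have "F \<le> weak_nhds (range J) topol (J m)"
    unfolding weak_nhds_def
  proof (rule INF_greatest)
    fix \<psi> assume "\<psi> \<in> top_dual (range J) topol"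
    then obtain I a where Ia: "finite I" "\<And>v. \<psi> (J v) = (\<Sum>i\<in>I. a i * v i)"
      using dual_finite_combination by metis
    have "((\<lambda>u. \<Sum>i\<in>I. a i * coord i u) \<longlongrightarrow> (\<Sum>i\<in>I. a i * m i)) F"
      by (intro tendsto_sum tendsto_mult lim tendsto_const)
    moreover have "eventually (\<lambda>u. (\<Sum>i\<in>I. a i * coord i u) = \<psi> u) F"
      using ev by (rule eventually_mono) (auto simp: Ia(2))
    ultimately have "(\<psi> \<longlongrightarrow> \<psi> (J m)) F"
      unfolding Ia(2) by (rule Lim_transform_eventually)
    then show "F \<le> filtercomap \<psi> (nhds (\<psi> (J m)))"
      by (simp add: filterlim_def filtermap_le_iff_le_filtercomap)
  qed
  ultimately show "\<exists>x\<in>J ` C. F \<le> weak_nhds (range J) topol x" by blast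
qed

end

section \<open>Fixed points yield integrals\<close>

text \<open>
  The group acts on the cone of positive functionals on \<open>\<ell>\<^sup>\<infinity>(G; f)\<close>, and a nonzero fixed point is an invariant integral
  up to scaling. Evaluation at a point is a functional with bounded orbit, since functions in
  \<open>\<ell>\<^sup>\<infinity>(G; f)\<close> are bounded, and evaluation of functionals at \<open>f\<close> cobounds the representation by the very definition
  of \<open>\<ell>\<^sup>\<infinity>(G; f)\<close>. The ambient space is taken to be all of \<open>\<real>\<close> to the power \<open>'g \<Rightarrow> real\<close>, the functionals being
  extended by \<open>0\<close> outside \<open>\<ell>\<^sup>\<infinity>(G; f)\<close>; it embeds linearly into every large universe.
\<close>

theorem fixed_point_property_imp_integral_property:
  fixes G :: "('g, 'm) monoid_scheme" (structure)
  assumes G: "group G" and large: "large_universe TYPE('g) TYPE('u::real_vector)"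
    and fpp: "fixed_point_property_cones TYPE('u) G"
  shows "integral_property G"
  unfolding integral_property_def
proof (intro allI impI)
  fix f assume weight: "bounded_weight G f"
  interpret weighted_group G f
    using G weight by (simp add: weighted_group_def weighted_group_axioms_def)
  obtain b :: "(('g \<Rightarrow> real) \<Rightarrow> real) \<Rightarrow> 'u" where b: "inj b" "independent (range b)"
    using large by (auto simp: large_universe_def)
  \<comment> \<open>A basis of the product space has at most as many elements as the space, so it can be mapped injectively to
    the independent family that the large universe provides.\<close>
  obtain \<B> :: "(('g \<Rightarrow> real) \<Rightarrow> real) set" where \<B>: "independent \<B>" "UNIV \<subseteq> span \<B>"
    using maximal_independent_subset[of UNIV] by metis
  obtain J where J: "linear J" "\<And>x. x \<in> \<B> \<Longrightarrow> J x = b x"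
    using linear_independent_extend[OF \<B>(1), of b] by blast
  have "J ` \<B> = b ` \<B>" using J(2) by (rule image_cong[OF refl])
  moreover have "independent (b ` \<B>)" using b(2) by (rule independent_mono) auto
  ultimately have "independent (J ` \<B>)" by simp
  moreover have "inj_on J \<B>" using b(1) J(2) by (simp add: inj_on_def)
  ultimately have "inj_on J (span \<B>)"
    using linear_inj_on_span_iff_independent_image[OF J(1)] by blast
  then have "inj J" using \<B>(2) by (rule inj_on_subset)
  with J(1) interpret pc: product_copy J by (simp add: product_copy_def)

  have trD_iff: "translate G g h \<in> D \<longleftrightarrow> h \<in> D" if g: "g \<in> carrier G" for g h
  proof
    assume "translate G g h \<in> D"
    then have "translate G (inv g) (translate G g h) \<in> D"
      using g by (intro translate_in_D[of "inv g"]) auto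
    then show "h \<in> D" using g by (simp add: translate_translate translate_one)
  qed (rule translate_in_D[OF g])
  define C where "C = {m. positive_functional G D m \<and> (\<forall>h. h \<notin> D \<longrightarrow> m h = 0)}"
  have Cpos: "positive_functional G D m" and Clin: "linear_into D m" and Cout: "h \<notin> D \<Longrightarrow> m h = 0"
    if "m \<in> C" for m h
    using that by (auto simp: C_def positive_functional_def)
  have Cdom: "\<exists>gs. set gs \<subseteq> carrier G \<and> (\<forall>m\<in>C. \<bar>m h\<bar> \<le> (\<Sum>g\<leftarrow>gs. m (translate G g f)))"
    if h: "h \<in> D" for h
  proof -
    obtain gs where gs: "set gs \<subseteq> carrier G" "\<And>x. x \<in> carrier G \<Longrightarrow> \<bar>h x\<bar> \<le> (\<Sum>g\<leftarrow>gs. translate G g f x)"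
      using h unfolding dominated_def by blast
    then show ?thesis using positive_functional_le_translates[OF Cpos h] by blast
  qed
  define act where "act g m = (\<lambda>h. m (translate G (inv g) h))" for g and m :: "('g \<Rightarrow> real) \<Rightarrow> real"
  have act_mult: "act (g \<otimes> k) m = act g (act k m)" if "g \<in> carrier G" "k \<in> carrier G" for g k m
    using that by (simp add: act_def inv_mult_group translate_translate)
  have act_one: "act \<one> m = m" for m by (simp add: act_def translate_one)
  have act_C: "act g m \<in> C" if g: "g \<in> carrier G" and m: "m \<in> C" for g m
  proof -
    have "linear_into D (act g m)"
      using g translate_in_D[of "inv g"] Clin[OF m]
      by (simp add: linear_into_def act_def translate_add translate_scale)
    moreover have "0 \<le> act g m h" if "h \<in> D" "\<forall>x\<in>carrier G. 0 \<le> h x" for h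
      unfolding act_def using that g
      by (intro positive_functional_nonneg[OF Cpos[OF m]] translate_in_D) (auto intro: translate_nonneg)
    moreover have "act g m h = 0" if "h \<notin> D" for h
      unfolding act_def using that g by (intro Cout[OF m]) (simp add: trD_iff)
    ultimately show ?thesis by (simp add: C_def positive_functional_def)
  qed
  define \<rho> where "\<rho> g = (\<lambda>u\<in>range J. J (act g (pc.J' u)))" for g
  have \<rho>J: "\<rho> g (J m) = J (act g m)" for g m by (simp add: \<rho>_def)

  have "proper_convex_cone (range J) (J ` C)"
    unfolding proper_convex_cone_def
  proof (intro conjI ballI)
    show "J ` C \<subseteq> range J" by blast
    have "c *\<^sub>R m \<in> C" if "m \<in> C" "0 \<le> c" for c m
      using that by (auto simp: C_def positive_functional_def linear_into_def algebra_simps)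
    then show "cone (J ` C)" by (auto simp: cone_def simp flip: pc.J_scale)
    have "m + m' \<in> C" if "m \<in> C" "m' \<in> C" for m m'
      using that by (auto simp: C_def positive_functional_def linear_into_def algebra_simps)
    then show "x + y \<in> J ` C" if "x \<in> J ` C" "y \<in> J ` C" for x y
      using that by (auto simp flip: pc.J_add)
    have zero: "m = 0" if m: "m \<in> C" "- m \<in> C" for m
    proof
      fix h
      show "m h = 0 h"
      proof (cases "h \<in> D")
        case True
        have "\<bar>m h\<bar> \<le> m (\<lambda>x. \<bar>h x\<bar>)"
          by (rule positive_functional_abs_le[OF Cpos[OF m(1)] subspace_D True abs_in_D[OF True]]) simp
        moreover have "\<bar>(- m) h\<bar> \<le> (- m) (\<lambda>x. \<bar>h x\<bar>)"
          by (rule positive_functional_abs_le[OF Cpos[OF m(2)] subspace_D True abs_in_D[OF True]]) simp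
        ultimately show ?thesis by simp
      qed (use Cout[OF m(1)] in simp)
    qed
    have "J ` C \<inter> uminus ` J ` C \<subseteq> {0}"
    proof
      fix u assume "u \<in> J ` C \<inter> uminus ` J ` C"
      then obtain m m' where m: "u = J m" "m \<in> C" "u = - J m'" "m' \<in> C" by blast
      then have "J m' = J (- m)" by (metis minus_minus pc.J_uminus)
      then have "m' = - m" using inj_eq[OF \<open>inj J\<close>] by blast
      then have "m = 0" using m zero by blast
      then show "u \<in> {0}" using m(1) pc.J_0 by simp
    qed
    moreover have "0 \<in> C" by (auto simp: C_def positive_functional_def linear_into_def)
    then have "0 \<in> J ` C" by (metis pc.J_0 imageI)
    then have "0 \<in> J ` C \<inter> uminus ` J ` C" by (metis IntI imageI minus_zero)
    ultimately show "J ` C \<inter> uminus ` J ` C = {0}" by blast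
  qed
  moreover have "weakly_complete (range J) pc.topol (J ` C)"
  proof (rule pc.weakly_completeI)
    fix m and F :: "(('g \<Rightarrow> real) \<Rightarrow> real) filter"
    assume F: "F \<noteq> bot" "F \<le> principal C" and lim: "\<And>i. ((\<lambda>v. v i) \<longlongrightarrow> m i) F"
    have ev: "eventually (\<lambda>v. v \<in> C) F" using F(2) by (simp add: le_principal)
    have eq: "m h = a" if "((\<lambda>v. v h) \<longlongrightarrow> a) F" for h a
      using tendsto_unique[OF F(1) lim that] .
    have "m (h + h') = m h + m h'" if h: "h \<in> D" "h' \<in> D" for h h'
    proof (rule eq)
      have "((\<lambda>v. v h + v h') \<longlongrightarrow> m h + m h') F" by (intro tendsto_add lim)
      then show "((\<lambda>v. v (h + h')) \<longlongrightarrow> m h + m h') F"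
        by (rule Lim_transform_eventually)
          (use ev in \<open>rule eventually_mono, simp add: linear_into_add[OF Clin h]\<close>)
    qed
    moreover have "m (c *\<^sub>R h) = c * m h" if h: "h \<in> D" for h c
    proof (rule eq)
      have "((\<lambda>v. c * v h) \<longlongrightarrow> c * m h) F" by (intro tendsto_mult_left lim)
      then show "((\<lambda>v. v (c *\<^sub>R h)) \<longlongrightarrow> c * m h) F"
        by (rule Lim_transform_eventually)
          (use ev in \<open>rule eventually_mono, simp add: linear_into_scale[OF Clin h]\<close>)
    qed
    moreover have "0 \<le> m h" if h: "h \<in> D" "\<forall>x\<in>carrier G. 0 \<le> h x" for h
      by (rule tendsto_lowerbound[OF lim _ F(1)])
        (use ev in \<open>rule eventually_mono, use h in \<open>auto intro: positive_functional_nonneg[OF Cpos]\<close>\<close>)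
    moreover have "m h = 0" if h: "h \<notin> D" for h
    proof (rule eq)
      show "((\<lambda>v. v h) \<longlongrightarrow> 0) F"
        by (rule Lim_transform_eventually[OF tendsto_const])
          (use ev in \<open>rule eventually_mono, use h in \<open>auto simp: Cout\<close>\<close>)
    qed
    ultimately show "m \<in> C" by (auto simp: C_def positive_functional_def linear_into_def)
  qed
  moreover have "cone_representation G (range J) pc.topol (J ` C) \<rho>"
    unfolding cone_representation_def
  proof (intro conjI ballI)
    have Bij: "\<rho> g \<in> Bij (range J)" if g: "g \<in> carrier G" for g
    proof -
      have "act g (act (inv g) m) = m" "act (inv g) (act g m) = m" for m
        using g by (simp_all add: act_one flip: act_mult)
      then have "bij_betw (\<rho> g) (range J) (range J)"
        by (intro bij_betwI[where g = "\<rho> (inv g)"]) (auto simp: \<rho>J)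
      then show ?thesis by (simp add: Bij_def \<rho>_def)
    qed
    show "group_action G (range J) \<rho>"
      unfolding group_action_def group_hom_def group_hom_axioms_def
    proof (intro conjI G group_BijGroup homI)
      show "\<rho> g \<in> carrier (BijGroup (range J))" if "g \<in> carrier G" for g
        using Bij[OF that] by (simp add: BijGroup_def)
      show "\<rho> (g \<otimes> k) = \<rho> g \<otimes>\<^bsub>BijGroup (range J)\<^esub> \<rho> k" if "g \<in> carrier G" "k \<in> carrier G" for g k
        using Bij[OF that(1)] Bij[OF that(2)] that
        by (auto simp: BijGroup_def \<rho>_def compose_def fun_eq_iff act_mult)
    qed
    fix g assume g: "g \<in> carrier G"
    show "linear_into (range J) (\<rho> g)"
      unfolding linear_into_def
    proof (intro conjI ballI allI)
      fix u v assume "u \<in> range J" "v \<in> range J"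
      then show "\<rho> g (u + v) = \<rho> g u + \<rho> g v"
        by (auto simp: \<rho>J act_def plus_fun_def simp flip: pc.J_add)
    next
      fix c u assume "u \<in> range J"
      then show "\<rho> g (c *\<^sub>R u) = c *\<^sub>R \<rho> g u"
        by (auto simp: \<rho>J act_def scaleR_fun_def simp flip: pc.J_scale)
    qed
    show "continuous_map pc.topol pc.topol (\<rho> g)"
      unfolding pc.continuous_map_into_topol
    proof (intro conjI allI)
      show "\<rho> g ` topspace pc.topol \<subseteq> range J" by (auto simp: \<rho>J)
      show "continuous_map pc.topol euclideanreal (\<lambda>u. pc.coord h (\<rho> g u))" for h
        using pc.continuous_map_coord[of "translate G (inv g) h"]
        by (rule continuous_map_eq) (auto simp: \<rho>J act_def)
    qed
    show "\<rho> g ` J ` C \<subseteq> J ` C" using act_C[OF g] by (auto simp: \<rho>J)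
  qed
  moreover have "locally_bounded_type G pc.topol (J ` C) \<rho>"
  proof -
    obtain t where t: "t \<in> carrier G" "0 < f t" using f_nonzero by blast
    define m where "m h = (if h \<in> D then h t else 0)" for h
    have "m \<in> C"
      using t subspace_D by (auto simp: C_def positive_functional_def linear_into_def m_def subspace_add subspace_scale)
    moreover have "m f \<noteq> 0" using t f_in_D by (simp add: m_def)
    then have "m \<noteq> 0" by (metis zero_fun_apply)
    then have "J m \<noteq> 0" using inj_eq[OF \<open>inj J\<close>, of m 0] by (simp add: pc.J_0)
    moreover have "tvs_bounded pc.topol (orbit G \<rho> (J m))"
      unfolding tvs_bounded_def
    proof (intro allI impI, elim conjE)
      fix U assume "openin pc.topol U" "0 \<in> U"
      then obtain I \<epsilon> where I: "finite I" "0 < \<epsilon>" "pc.box I \<epsilon> \<subseteq> U" by (rule pc.open_contains_box)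
      have "\<exists>B\<ge>0. \<forall>g\<in>carrier G. \<bar>act g m h\<bar> \<le> B" for h
      proof (cases "h \<in> D")
        case True
        then obtain B where B: "0 \<le> B" "\<And>x. x \<in> carrier G \<Longrightarrow> \<bar>h x\<bar> \<le> B"
          using D_bounded by blast
        have "\<bar>act g m h\<bar> \<le> B" if "g \<in> carrier G" for g
          using B(2)[of "g \<otimes> t"] that t True by (simp add: act_def m_def trD_iff translate_apply)
        then show ?thesis using B(1) by blast
      next
        case False
        then have "act g m h = 0" if "g \<in> carrier G" for g
          using that by (simp add: act_def m_def trD_iff)
        then show ?thesis by (intro exI[of _ 0]) simp
      qed
      then obtain B where B: "\<And>h. 0 \<le> B h" "\<And>h g. g \<in> carrier G \<Longrightarrow> \<bar>act g m h\<bar> \<le> B h" by metis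
      define r where "r = (\<Sum>h\<in>I. B h) / \<epsilon> + 1"
      have r: "0 < r" using I(2) B(1) by (simp add: r_def add_nonneg_pos sum_nonneg)
      have "orbit G \<rho> (J m) \<subseteq> (\<lambda>x. c *\<^sub>R x) ` U" if c: "r \<le> \<bar>c\<bar>" for c
      proof
        fix u assume "u \<in> orbit G \<rho> (J m)"
        then obtain g where g: "g \<in> carrier G" "u = J (act g m)" by (auto simp: orbit_def \<rho>J)
        have "\<bar>((1 / c) *\<^sub>R act g m) h\<bar> < \<epsilon>" if h: "h \<in> I" for h
        proof -
          have "B h \<le> (\<Sum>h\<in>I. B h)" using h I(1) B(1) by (intro member_le_sum) auto
          also have "\<dots> < r * \<epsilon>" using I(2) by (simp add: r_def field_simps)
          also have "\<dots> \<le> \<bar>c\<bar> * \<epsilon>" using c I(2) by simp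
          finally have "\<bar>act g m h\<bar> < \<bar>c\<bar> * \<epsilon>" using B(2)[OF g(1), of h] by linarith
          then show ?thesis using c r by (simp add: abs_mult field_simps)
        qed
        then have "J ((1 / c) *\<^sub>R act g m) \<in> U" using I(3) by (auto simp: pc.box_def)
        moreover have "u = c *\<^sub>R J ((1 / c) *\<^sub>R act g m)"
          using c r g(2) by (cases "c = 0") (simp_all flip: pc.J_scale)
        ultimately show "u \<in> (\<lambda>x. c *\<^sub>R x) ` U" by blast
      qed
      then show "\<exists>r>0. \<forall>c. r \<le> \<bar>c\<bar> \<longrightarrow> orbit G \<rho> (J m) \<subseteq> (\<lambda>x. c *\<^sub>R x) ` U"
        using r by blast
    qed
    ultimately show ?thesis unfolding locally_bounded_type_def by blast
  qed
  moreover have "cobounded_type G (range J) pc.topol (J ` C) \<rho>"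
    unfolding cobounded_type_def
  proof (intro bexI ballI)
    show "pc.coord f \<in> top_dual (range J) pc.topol" by (rule pc.coord_in_dual)
    fix \<psi> assume "\<psi> \<in> top_dual (range J) pc.topol"
    then obtain I a where Ia: "finite I" "\<And>v. \<psi> (J v) = (\<Sum>h\<in>I. a h * v h)"
      using pc.dual_finite_combination by blast
    define w where "w = (\<Sum>h\<in>I \<inter> D. a h *\<^sub>R h)"
    have inD: "a h *\<^sub>R h \<in> D" if "h \<in> I \<inter> D" for h using that subspace_D by (auto intro: subspace_scale)
    then have w: "w \<in> D" unfolding w_def by (intro subspace_sum subspace_D)
    have \<psi>: "\<psi> (J m) = m w" if m: "m \<in> C" for m
    proof -
      have "\<psi> (J m) = (\<Sum>h\<in>I \<inter> D. a h * m h)"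
        unfolding Ia(2) using Ia(1) Cout[OF m] by (intro sum.mono_neutral_right) auto
      also have "\<dots> = (\<Sum>h\<in>I \<inter> D. m (a h *\<^sub>R h))"
        by (intro sum.cong refl) (simp add: linear_into_scale[OF Clin[OF m]])
      also have "\<dots> = m w"
        unfolding w_def using inD by (intro linear_into_sum[OF Clin[OF m] subspace_D, symmetric])
      finally show ?thesis .
    qed
    obtain gs where gs: "set gs \<subseteq> carrier G" "\<And>m. m \<in> C \<Longrightarrow> \<bar>m w\<bar> \<le> (\<Sum>g\<leftarrow>gs. m (translate G g f))"
      using Cdom[OF w] by blast
    have "dual_rep G \<rho> g (pc.coord f) (J m) = m (translate G g f)" if "g \<in> set gs" for g m
    proof -
      have "g \<in> carrier G" using that gs(1) by blast
      then show ?thesis by (simp add: dual_rep_def \<rho>J act_def)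
    qed
    then have eq: "(\<Sum>g\<leftarrow>gs. dual_rep G \<rho> g (pc.coord f) (J m)) = (\<Sum>g\<leftarrow>gs. m (translate G g f))" for m
      by (simp cong: map_cong)
    show "\<exists>gs. set gs \<subseteq> carrier G \<and>
        dual_le (J ` C) \<psi> (\<lambda>x. \<Sum>g\<leftarrow>gs. dual_rep G \<rho> g (pc.coord f) x) \<and>
        dual_le (J ` C) (\<lambda>x. - \<psi> x) (\<lambda>x. \<Sum>g\<leftarrow>gs. dual_rep G \<rho> g (pc.coord f) x)"
      using gs by (intro exI[of _ gs]) (force simp: dual_le_def eq \<psi> abs_le_iff)
  qed
  ultimately have "\<exists>x\<in>J ` C. x \<noteq> 0 \<and> (\<forall>g\<in>carrier G. \<rho> g x = x)"
    using fpp pc.lc_hausdorff unfolding fixed_point_property_cones_def by blast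
  then obtain m where m: "m \<in> C" "J m \<noteq> 0" "\<And>g. g \<in> carrier G \<Longrightarrow> J (act g m) = J m"
    by (auto simp: \<rho>J)
  have inv: "m (translate G g h) = m h" if g: "g \<in> carrier G" for g h
  proof -
    have "act (inv g) m = m" using m(3)[of "inv g"] g inj_eq[OF \<open>inj J\<close>] by simp
    then have "act (inv g) m h = m h" by simp
    then show ?thesis using g by (simp add: act_def)
  qed
  have "m f \<noteq> 0"
  proof
    assume mf: "m f = 0"
    have "m h = 0" for h
    proof (cases "h \<in> D")
      case True
      then obtain gs where gs: "set gs \<subseteq> carrier G" "\<bar>m h\<bar> \<le> (\<Sum>g\<leftarrow>gs. m (translate G g f))"
        using Cdom m(1) by blast
      have "(\<Sum>g\<leftarrow>gs. m (translate G g f)) = (\<Sum>g\<leftarrow>gs. 0)"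
        using gs(1) by (intro arg_cong[of _ _ sum_list] map_cong) (auto simp: inv mf)
      then show ?thesis using gs(2) by simp
    qed (use Cout[OF m(1)] in simp)
    then have "m = 0" by (simp add: fun_eq_iff)
    then show False using m(2) pc.J_0 by simp
  qed
  moreover have "0 \<le> m f" using f_nonneg by (intro positive_functional_nonneg[OF Cpos[OF m(1)] f_in_D])
  ultimately have pos: "0 < m f" by simp
  have "invariant_integral G f (\<lambda>h. m h / m f)"
    unfolding invariant_integral_def
    using Cpos[OF m(1)] inv pos by (auto simp: positive_functional_def linear_into_def add_divide_distrib)
  then show "\<exists>m. invariant_integral G f m" by blast
qed

section \<open>Groups with the integral property\<close>

lemma weighted_groupI: "group G \<Longrightarrow> bounded_weight G f \<Longrightarrow> weighted_group G f"
  by (simp add: weighted_group_def weighted_group_axioms_def)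

text \<open>
  Functions on the image are pulled back along \<open>\<theta>\<close>.
\<close>

lemma integral_property_hom_image:
  fixes G (structure)
  assumes G: "group G" and Q: "group Q" and \<theta>: "\<theta> \<in> hom G Q" "\<theta> ` carrier G = carrier Q"
    and int: "integral_property G"
  shows "integral_property Q"
  unfolding integral_property_def
proof (intro allI impI)
  fix f assume f: "bounded_weight Q f"
  interpret Q: weighted_group Q f using Q f by (rule weighted_groupI)
  interpret \<theta>: group_hom G Q \<theta> using G Q \<theta>(1) by (simp add: group_hom_def group_hom_axioms_def)
  define T where "T h = (\<lambda>x. h (\<theta> x))" for h :: "'c \<Rightarrow> real"
  have T: "linear_into Q.D (\<lambda>h. T h x)" for x by (simp add: linear_into_def T_def)
  have weight: "bounded_weight G (T f)"
    using f unfolding bounded_weight_def T_def \<theta>(2)[symmetric] by simp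
  have dom: "T h \<in> dominated G (carrier G) (T f)" if h: "h \<in> Q.D" for h
  proof -
    obtain gs where gs: "set gs \<subseteq> carrier Q" "\<And>x. x \<in> carrier Q \<Longrightarrow> \<bar>h x\<bar> \<le> (\<Sum>g\<leftarrow>gs. translate Q g f x)"
      using h unfolding dominated_def by blast
    let ?l = "inv_into (carrier G) \<theta>"
    have l: "?l g \<in> carrier G" "\<theta> (?l g) = g" if "g \<in> set gs" for g
    proof -
      have "g \<in> \<theta> ` carrier G" using that gs(1) \<theta>(2) by blast
      then show "?l g \<in> carrier G" "\<theta> (?l g) = g" by (rule inv_into_into, rule f_inv_into_f)
    qed
    show ?thesis
    proof (rule dominatedI[of "map ?l gs"])
      show "set (map ?l gs) \<subseteq> carrier G" using l by auto
      fix x assume x: "x \<in> carrier G"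
      have "translate G (?l g) (T f) x = translate Q g f (\<theta> x)" if "g \<in> set gs" for g
        using l[OF that] x by (simp add: T_def translate_def)
      then have "(\<Sum>g\<leftarrow>map ?l gs. translate G g (T f) x) = (\<Sum>g\<leftarrow>gs. translate Q g f (\<theta> x))"
        by (simp add: o_def cong: map_cong)
      then show "\<bar>T h x\<bar> \<le> (\<Sum>g\<leftarrow>map ?l gs. translate G g (T f) x)"
        using gs(2)[of "\<theta> x"] x by (simp add: T_def)
    qed
  qed
  note pullback = integral_property_pullback[where T = T, OF int Q.subspace_D T Q.f_in_D weight dom]
  obtain M :: "_ \<Rightarrow> real" where M: "linear_into Q.D M" "M f = 1"
    "\<And>w. w \<in> Q.D \<Longrightarrow> \<forall>x\<in>carrier G. 0 \<le> T w x \<Longrightarrow> 0 \<le> M w"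
    "\<And>w w' g. w \<in> Q.D \<Longrightarrow> w' \<in> Q.D \<Longrightarrow> g \<in> carrier G \<Longrightarrow>
       \<forall>x\<in>carrier G. T w' x = T w (inv g \<otimes> x) \<Longrightarrow> M w' = M w"
    using pullback by blast
  have "invariant_integral Q f M"
    unfolding invariant_integral_def
  proof (intro conjI ballI)
    show "positive_functional Q Q.D M"
      using M(1,3) by (simp add: positive_functional_def T_def)
    fix q h assume q: "q \<in> carrier Q" and h: "h \<in> Q.D"
    from q have "q \<in> \<theta> ` carrier G" using \<theta>(2) by simp
    then obtain g where g: "g \<in> carrier G" "\<theta> g = q" by blast
    show "M (translate Q q h) = M h"
    proof (rule M(4)[OF h _ g(1)])
      show "translate Q q h \<in> Q.D" using h q by (intro Q.translate_in_D)
      show "\<forall>x\<in>carrier G. T (translate Q q h) x = T h (inv g \<otimes> x)"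
        using g by (simp add: T_def Q.translate_apply)
    qed
  qed (rule M(2))
  then show "\<exists>m. invariant_integral Q f m" by blast
qed

text \<open>
  Functions on \<open>K\<close> are extended by \<open>0\<close> to \<open>G\<close>, which commutes with translation by elements of \<open>K\<close>.
\<close>

lemma integral_property_subgroup:
  fixes G (structure)
  assumes G: "group G" and K: "subgroup K G" and int: "integral_property G"
  shows "integral_property (G\<lparr>carrier := K\<rparr>)"
  unfolding integral_property_def
proof (intro allI impI)
  let ?K = "G\<lparr>carrier := K\<rparr>"
  fix f assume f: "bounded_weight ?K f"
  interpret group G by fact
  interpret K: subgroup K G by fact
  interpret KG: weighted_group ?K f using subgroup_imp_group[OF K] f by (rule weighted_groupI)
  have invK: "inv\<^bsub>?K\<^esub> k = inv k" if "k \<in> K" for k using m_inv_consistent[OF K that] .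
  define T where "T h = (\<lambda>x. if x \<in> K then h x else 0)" for h :: "'a \<Rightarrow> real"
  have T: "linear_into KG.D (\<lambda>h. T h x)" for x by (simp add: linear_into_def T_def)
  have fnn: "0 \<le> T f x" for x using f by (simp add: T_def bounded_weight_def)
  have weight: "bounded_weight G (T f)"
    unfolding bounded_weight_def
  proof (intro conjI ballI)
    obtain B where "\<And>x. x \<in> K \<Longrightarrow> f x \<le> B" using f by (auto simp: bounded_weight_def)
    then have "\<forall>x\<in>carrier G. T f x \<le> max B 0" by (auto simp: T_def le_max_iff_disj)
    then show "\<exists>B. \<forall>x\<in>carrier G. T f x \<le> B" ..
    show "\<exists>x\<in>carrier G. T f x \<noteq> 0" using f K.subset by (auto simp: T_def bounded_weight_def)
  qed (rule fnn)
  have dom: "T h \<in> dominated G (carrier G) (T f)" if h: "h \<in> KG.D" for h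
  proof -
    obtain gs where gs: "set gs \<subseteq> K" "\<And>x. x \<in> K \<Longrightarrow> \<bar>h x\<bar> \<le> (\<Sum>g\<leftarrow>gs. translate ?K g f x)"
      using h unfolding dominated_def by auto
    show ?thesis
    proof (rule dominatedI[of gs])
      show "set gs \<subseteq> carrier G" using gs(1) K.subset by blast
      fix x assume x: "x \<in> carrier G"
      show "\<bar>T h x\<bar> \<le> (\<Sum>g\<leftarrow>gs. translate G g (T f) x)"
      proof (cases "x \<in> K")
        case True
        have "translate ?K g f x = translate G g (T f) x" if "g \<in> set gs" for g
        proof -
          have "g \<in> K" using that gs(1) by blast
          then show ?thesis using True x by (simp add: translate_def T_def invK)
        qed
        then have "(\<Sum>g\<leftarrow>gs. translate ?K g f x) = (\<Sum>g\<leftarrow>gs. translate G g (T f) x)"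
          by (simp cong: map_cong)
        then show ?thesis using gs(2)[OF True] True by (simp add: T_def)
      next
        case False
        then show ?thesis using fnn by (auto simp: T_def[of h] translate_def intro!: sum_list_nonneg)
      qed
    qed
  qed
  note pullback = integral_property_pullback[where T = T, OF int KG.subspace_D T KG.f_in_D weight dom]
  obtain M :: "_ \<Rightarrow> real" where M: "linear_into KG.D M" "M f = 1"
    "\<And>w. w \<in> KG.D \<Longrightarrow> \<forall>x\<in>carrier G. 0 \<le> T w x \<Longrightarrow> 0 \<le> M w"
    "\<And>w w' g. w \<in> KG.D \<Longrightarrow> w' \<in> KG.D \<Longrightarrow> g \<in> carrier G \<Longrightarrow>
       \<forall>x\<in>carrier G. T w' x = T w (inv g \<otimes> x) \<Longrightarrow> M w' = M w"
    using pullback by blast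
  have "invariant_integral ?K f M"
    unfolding invariant_integral_def
  proof (intro conjI ballI)
    show "positive_functional ?K KG.D M"
      using M(1,3) by (simp add: positive_functional_def T_def)
    fix k h assume "k \<in> carrier ?K" and h: "h \<in> KG.D"
    then have k: "k \<in> K" "k \<in> carrier G" using K.subset by auto
    show "M (translate ?K k h) = M h"
    proof (rule M(4)[OF h _ k(2)])
      show "translate ?K k h \<in> KG.D" using h k by (intro KG.translate_in_D) auto
      have "inv k \<otimes> x \<in> K \<longleftrightarrow> x \<in> K" if x: "x \<in> carrier G" for x
      proof
        assume "inv k \<otimes> x \<in> K"
        then have "k \<otimes> (inv k \<otimes> x) \<in> K" using k by blast
        also have "k \<otimes> (inv k \<otimes> x) = x" using k x by (metis inv_closed m_assoc r_inv l_one)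
        finally show "x \<in> K" .
      qed (use k in auto)
      then show "\<forall>x\<in>carrier G. T (translate ?K k h) x = T h (inv k \<otimes> x)"
        using k by (auto simp: T_def translate_def invK)
    qed
  qed (rule M(2))
  then show "\<exists>m. invariant_integral ?K f m" by blast
qed

text \<open>
  A subgroup with the integral property acts on functions on the whole group: restrict them to a right coset
  \<open>K #> t\<close> that meets the support of \<open>f\<close>.
\<close>

lemma subgroup_invariant_functional:
  fixes G (structure)
  assumes G: "group G" and K: "subgroup K G" and int: "integral_property (G\<lparr>carrier := K\<rparr>)"
    and f: "bounded_weight G f"
  shows "\<exists>M. positive_functional G (dominated G K f) M \<and> M f = 1 \<and>
    (\<forall>k\<in>K. \<forall>h\<in>dominated G K f. M (translate G k h) = M h)"
proof -
  let ?K = "G\<lparr>carrier := K\<rparr>"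
  interpret weighted_group G f using G f by (rule weighted_groupI)
  interpret K: subgroup K G by fact
  have invK: "inv\<^bsub>?K\<^esub> k = inv k" if "k \<in> K" for k using m_inv_consistent[OF K that] .
  let ?W = "dominated G K f"
  obtain t where t: "t \<in> carrier G" "0 < f t" using f_nonzero by blast
  define T where "T h = (\<lambda>k. h (k \<otimes> t))" for h :: "'a \<Rightarrow> real"
  have W: "subspace ?W" using f_nonneg K.subset by (rule subspace_dominated)
  have fW: "f \<in> ?W" using f by (rule weight_in_dominated) auto
  have T: "linear_into ?W (\<lambda>h. T h x)" for x by (simp add: linear_into_def T_def)
  have weightK: "bounded_weight ?K (T f)"
    unfolding bounded_weight_def
  proof (intro conjI ballI)
    show "\<exists>B. \<forall>x\<in>carrier ?K. T f x \<le> B" using f t K.subset by (force simp: T_def bounded_weight_def)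
    show "\<exists>x\<in>carrier ?K. T f x \<noteq> 0" using t by (intro bexI[of _ "\<one>"]) (auto simp: T_def)
    show "0 \<le> T f x" if "x \<in> carrier ?K" for x
      using that t K.subset f by (auto simp: T_def bounded_weight_def subset_iff)
  qed
  have dom: "T h \<in> dominated ?K (carrier ?K) (T f)" if h: "h \<in> ?W" for h
  proof -
    obtain gs where gs: "set gs \<subseteq> K" "\<And>x. x \<in> carrier G \<Longrightarrow> \<bar>h x\<bar> \<le> (\<Sum>g\<leftarrow>gs. translate G g f x)"
      using h unfolding dominated_def by auto
    show ?thesis
    proof (rule dominatedI[of gs])
      show "set gs \<subseteq> carrier ?K" using gs(1) by simp
      fix k assume "k \<in> carrier ?K"
      then have k: "k \<in> K" "k \<in> carrier G" using K.subset by auto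
      have "translate ?K g (T f) k = translate G g f (k \<otimes> t)" if "g \<in> set gs" for g
      proof -
        have "g \<in> K" "g \<in> carrier G" using that gs(1) K.subset by auto
        then show ?thesis using k t by (simp add: translate_def T_def invK m_assoc)
      qed
      then have "(\<Sum>g\<leftarrow>gs. translate ?K g (T f) k) = (\<Sum>g\<leftarrow>gs. translate G g f (k \<otimes> t))"
        by (simp cong: map_cong)
      then show "\<bar>T h k\<bar> \<le> (\<Sum>g\<leftarrow>gs. translate ?K g (T f) k)"
        using gs(2)[of "k \<otimes> t"] k t by (simp add: T_def)
    qed
  qed
  note pullback = integral_property_pullback[where T = T, OF int W T fW weightK dom]
  obtain M :: "_ \<Rightarrow> real" where M: "linear_into ?W M" "M f = 1"
    "\<And>w. w \<in> ?W \<Longrightarrow> \<forall>x\<in>carrier ?K. 0 \<le> T w x \<Longrightarrow> 0 \<le> M w"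
    "\<And>w w' g. w \<in> ?W \<Longrightarrow> w' \<in> ?W \<Longrightarrow> g \<in> carrier ?K \<Longrightarrow>
       \<forall>x\<in>carrier ?K. T w' x = T w (inv\<^bsub>?K\<^esub> g \<otimes>\<^bsub>?K\<^esub> x) \<Longrightarrow> M w' = M w"
    using pullback by blast
  have "0 \<le> M h" if "h \<in> ?W" "\<forall>x\<in>carrier G. 0 \<le> h x" for h
    using that t K.subset by (intro M(3)) (auto simp: T_def subset_iff)
  then have "positive_functional G ?W M" using M(1) by (simp add: positive_functional_def)
  moreover have "M (translate G k h) = M h" if k: "k \<in> K" and h: "h \<in> ?W" for k h
  proof (rule M(4)[OF h])
    show "translate G k h \<in> ?W" using K k h by (intro translate_in_dominated)
    show "\<forall>x\<in>carrier ?K. T (translate G k h) x = T h (inv\<^bsub>?K\<^esub> k \<otimes>\<^bsub>?K\<^esub> x)"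
      using k t K.subset by (auto simp: T_def translate_def invK m_assoc subset_iff)
  qed (use k in simp)
  ultimately show ?thesis using M(2) by blast
qed

text \<open>
  Extensions are handled in two stages. Suppose that a positive functional \<open>x\<close> on \<open>\<ell>\<^sup>\<infinity>(G; f)\<close> is \<open>N\<close>-invariant and bounded on the translates
  of \<open>f\<close>. Then \<open>k \<mapsto> x (translate G (inv k) h)\<close> is constant on cosets of \<open>N\<close>, and it is a bounded
  function on \<open>G Mod N\<close> for \<open>h = f\<close>. An integral on \<open>G Mod N\<close> can therefore be composed with it.
\<close>

lemma integral_of_quotient_integral:
  fixes G (structure)
  assumes N: "N \<lhd> G" and int: "integral_property (G Mod N)" and f: "bounded_weight G f"
    and x: "positive_functional G (dominated G (carrier G) f) x"
    and N_inv: "\<And>n h. n \<in> N \<Longrightarrow> h \<in> dominated G (carrier G) f \<Longrightarrow> x (translate G n h) = x h"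
    and bound: "\<And>g. g \<in> carrier G \<Longrightarrow> x (translate G g f) \<le> B"
    and nonzero: "\<exists>g\<in>carrier G. x (translate G g f) \<noteq> 0"
  shows "\<exists>m. invariant_integral G f m"
proof -
  interpret normal N G by fact
  interpret weighted_group G f using is_group f by (rule weighted_groupI)
  let ?Q = "G Mod N"
  interpret Q: group ?Q by (rule factorgroup_is_group)
  interpret \<pi>: group_hom G ?Q "(#>) N"
    using r_coset_hom_Mod by unfold_locales
  have Q: "carrier ?Q = (#>) N ` carrier G" by (rule carrier_FactGroup)
  define T where "T h A = x (translate G (inv (SOME k. k \<in> A)) h)" for h A
  have T: "T h (N #> k) = x (translate G (inv k) h)" if k: "k \<in> carrier G" and h: "h \<in> D" for k h
  proof -
    define k' where "k' = (SOME k'. k' \<in> N #> k)"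
    have "k' \<in> N #> k" unfolding k'_def using rcos_self[OF k subgroup_axioms] by (rule someI)
    then obtain n where n: "n \<in> N" "k' = n \<otimes> k" by (auto simp: r_coset_def)
    then have nG: "n \<in> carrier G" by simp
    \<comment> \<open>Normality moves the factor from \<open>N\<close> to the left, where \<open>x\<close> ignores it.\<close>
    define n' where "n' = inv k \<otimes> inv n \<otimes> k"
    have n': "n' \<in> N" unfolding n'_def using inv_op_closed1[OF k] n(1) by simp
    then have n'G: "n' \<in> carrier G" by simp
    have "inv k' = n' \<otimes> inv k" using n(2) nG k by (simp add: n'_def inv_mult_group m_assoc)
    then have "T h (N #> k) = x (translate G n' (translate G (inv k) h))"
      using k n'G by (simp add: T_def translate_translate flip: k'_def)
    also have "\<dots> = x (translate G (inv k) h)" using k h n' by (intro N_inv translate_in_D) auto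
    finally show ?thesis .
  qed
  have inv_coset: "inv\<^bsub>?Q\<^esub> (N #> g) \<otimes>\<^bsub>?Q\<^esub> (N #> k) = N #> (inv g \<otimes> k)" if "g \<in> carrier G" "k \<in> carrier G" for g k
    using that \<pi>.hom_inv[of g] \<pi>.hom_mult[of "inv g" k] by simp
  have shift: "T h (inv\<^bsub>?Q\<^esub> (N #> g) \<otimes>\<^bsub>?Q\<^esub> (N #> k)) = x (translate G (inv k) (translate G g h))"
    if "g \<in> carrier G" "k \<in> carrier G" "h \<in> D" for g k h
  proof -
    have "T h (inv\<^bsub>?Q\<^esub> (N #> g) \<otimes>\<^bsub>?Q\<^esub> (N #> k)) = T h (N #> (inv g \<otimes> k))"
      by (rule arg_cong[OF inv_coset[OF that(1,2)]])
    also have "\<dots> = x (translate G (inv k) (translate G g h))"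
      using that by (subst T) (simp_all add: translate_translate inv_mult_group)
    finally show ?thesis .
  qed
  have weightQ: "bounded_weight ?Q (T f)"
    unfolding bounded_weight_def
  proof (intro conjI ballI)
    fix A assume "A \<in> carrier ?Q"
    then obtain k where k: "k \<in> carrier G" "A = N #> k" using Q by blast
    have "0 \<le> x (translate G (inv k) f)"
      using k by (intro positive_functional_nonneg[OF x] translate_in_D f_in_D translate_nonneg f_nonneg) auto
    then show "0 \<le> T f A" using k T[OF _ f_in_D] by simp
  next
    show "\<exists>B. \<forall>A\<in>carrier ?Q. T f A \<le> B" using bound T[OF _ f_in_D] Q by auto
    obtain g where g: "g \<in> carrier G" "x (translate G g f) \<noteq> 0" using nonzero by blast
    then have "T f (N #> inv g) \<noteq> 0" using T[of "inv g" f] f_in_D by simp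
    then show "\<exists>A\<in>carrier ?Q. T f A \<noteq> 0" using g(1) Q by blast
  qed
  have dom: "T h \<in> dominated ?Q (carrier ?Q) (T f)" if h: "h \<in> D" for h
  proof -
    obtain gs where gs: "set gs \<subseteq> carrier G" "\<And>y. y \<in> carrier G \<Longrightarrow> \<bar>h y\<bar> \<le> (\<Sum>g\<leftarrow>gs. translate G g f y)"
      using h unfolding dominated_def by blast
    show ?thesis
    proof (rule dominatedI[of "map ((#>) N) gs"])
      show "set (map ((#>) N) gs) \<subseteq> carrier ?Q" using gs(1) Q by auto
      fix A assume A: "A \<in> carrier ?Q"
      then obtain k where k: "k \<in> carrier G" "A = N #> k" using Q by blast
      let ?ks = "map ((\<otimes>) (inv k)) gs"
      have "\<bar>x (translate G (inv k) h)\<bar> \<le> (\<Sum>g\<leftarrow>?ks. x (translate G g f))"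
      proof (rule positive_functional_le_translates[OF x])
        show "translate G (inv k) h \<in> D" using k h by (intro translate_in_D) auto
        show "set ?ks \<subseteq> carrier G" using gs(1) k by auto
        fix y assume y: "y \<in> carrier G"
        have "translate G (inv k \<otimes> g) f y = translate G g f (k \<otimes> y)" if "g \<in> set gs" for g
          using that gs(1) y k by (subst translate_translate[symmetric]) (auto simp: translate_apply)
        then show "\<bar>translate G (inv k) h y\<bar> \<le> (\<Sum>g\<leftarrow>?ks. translate G g f y)"
          using y k gs(2)[of "k \<otimes> y"] by (simp add: translate_apply o_def cong: map_cong)
      qed
      also have "\<dots> = (\<Sum>g\<leftarrow>map ((#>) N) gs. translate ?Q g (T f) A)"
      proof -
        have "x (translate G (inv k \<otimes> g) f) = translate ?Q (N #> g) (T f) A" if "g \<in> set gs" for g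
          using that gs(1) A shift[of g k f] k f_in_D by (auto simp: translate_def[of ?Q] translate_translate)
        then show ?thesis by (simp add: o_def cong: map_cong)
      qed
      finally show "\<bar>T h A\<bar> \<le> (\<Sum>g\<leftarrow>map ((#>) N) gs. translate ?Q g (T f) A)"
        using k h by (simp add: T)
    qed
  qed
  have T_lin: "linear_into D (\<lambda>h. T h A)" if A: "A \<in> carrier ?Q" for A
  proof -
    obtain k where k: "k \<in> carrier G" "A = N #> k" using A Q by blast
    have "linear_into D (\<lambda>h. x (translate G (inv k) h))"
      using k(1) translate_in_D[of "inv k"] positive_functional_linear[OF x]
      by (simp add: linear_into_def translate_add translate_scale)
    then show ?thesis
      unfolding k(2) using T[OF k(1)] by (rule linear_into_cong[OF _ subspace_D])
  qed
  note pullback = integral_property_pullback[where T = T, OF int subspace_D T_lin f_in_D weightQ dom]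
  obtain M :: "_ \<Rightarrow> real" where M: "linear_into D M" "M f = 1"
    "\<And>w. w \<in> D \<Longrightarrow> \<forall>A\<in>carrier ?Q. 0 \<le> T w A \<Longrightarrow> 0 \<le> M w"
    "\<And>w w' g. w \<in> D \<Longrightarrow> w' \<in> D \<Longrightarrow> g \<in> carrier ?Q \<Longrightarrow>
       \<forall>A\<in>carrier ?Q. T w' A = T w (inv\<^bsub>?Q\<^esub> g \<otimes>\<^bsub>?Q\<^esub> A) \<Longrightarrow> M w' = M w"
    using pullback by blast
  have "invariant_integral G f M"
    unfolding invariant_integral_def
  proof (intro conjI ballI)
    have "0 \<le> T h A" if h: "h \<in> D" "\<forall>y\<in>carrier G. 0 \<le> h y" and "A \<in> carrier ?Q" for h A
    proof -
      obtain k where k: "k \<in> carrier G" "A = N #> k" using \<open>A \<in> carrier ?Q\<close> Q by blast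
      have "0 \<le> x (translate G (inv k) h)"
        using k h by (intro positive_functional_nonneg[OF x] translate_in_D translate_nonneg) auto
      then show ?thesis using k h by (simp add: T)
    qed
    then show "positive_functional G D M" using M(1,3) by (simp add: positive_functional_def)
    fix g h assume g: "g \<in> carrier G" and h: "h \<in> D"
    show "M (translate G g h) = M h"
    proof (rule M(4)[OF h translate_in_D[OF g h]])
      show "N #> g \<in> carrier ?Q" using g Q by blast
      show "\<forall>A\<in>carrier ?Q. T (translate G g h) A = T h (inv\<^bsub>?Q\<^esub> (N #> g) \<otimes>\<^bsub>?Q\<^esub> A)"
        using g h Q shift translate_in_D by (auto simp: T)
    qed
  qed (rule M(2))
  then show ?thesis by blast
qed

lemma integral_property_finite:
  fixes G (structure)
  assumes "group G" and fin: "finite (carrier G)"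
  shows "integral_property G"
  unfolding integral_property_def
proof (intro allI impI)
  fix f assume f: "bounded_weight G f"
  interpret weighted_group G f using assms(1) f by (rule weighted_groupI)
  let ?s = "\<lambda>h :: 'a \<Rightarrow> real. \<Sum>x\<in>carrier G. h x"
  obtain t where "t \<in> carrier G" "0 < f t" using f_nonzero by blast
  then have pos: "0 < ?s f" using fin f_nonneg by (intro sum_pos2[of _ t])
  have "invariant_integral G f (\<lambda>h. ?s h / ?s f)"
    unfolding invariant_integral_def
  proof (intro conjI ballI)
    show "positive_functional G D (\<lambda>h. ?s h / ?s f)"
      using pos by (auto simp: positive_functional_def linear_into_def sum.distrib add_divide_distrib
        simp flip: sum_distrib_left intro!: divide_nonneg_pos sum_nonneg)
    fix g h assume g: "g \<in> carrier G"
    have "?s (translate G g h) = (\<Sum>x\<in>carrier G. h (inv g \<otimes> x))"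
      by (intro sum.cong) (auto simp: translate_def)
    also have "\<dots> = ?s h"
      using g by (intro sum.reindex_bij_witness[of _ "\<lambda>y. g \<otimes> y" "\<lambda>x. inv g \<otimes> x"])
        (auto simp flip: m_assoc)
    finally show "?s (translate G g h) / ?s f = ?s h / ?s f" by simp
  qed (use pos in simp)
  then show "\<exists>m. invariant_integral G f m" by blast
qed

text \<open>
  Summation over a coset of the finite kernel is the required \<open>N\<close>-invariant functional.
\<close>

lemma integral_property_finite_kernel:
  fixes G (structure)
  assumes N: "N \<lhd> G" and fin: "finite N" and int: "integral_property (G Mod N)"
  shows "integral_property G"
  unfolding integral_property_def
proof (intro allI impI)
  fix f assume f: "bounded_weight G f"
  interpret normal N G by fact
  interpret weighted_group G f using is_group f by (rule weighted_groupI)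
  obtain t where t: "t \<in> carrier G" "0 < f t" using f_nonzero by blast
  obtain b where b: "\<And>y. y \<in> carrier G \<Longrightarrow> f y \<le> b" using f_bounded by blast
  define x where "x h = (\<Sum>n\<in>N. h (n \<otimes> t))" for h :: "'a \<Rightarrow> real"
  show "\<exists>m. invariant_integral G f m"
  proof (rule integral_of_quotient_integral[OF N int f, of x])
    show "positive_functional G D x"
      using t by (auto simp: positive_functional_def linear_into_def x_def sum.distrib sum_distrib_left intro!: sum_nonneg)
    show "x (translate G k h) = x h" if k: "k \<in> N" for k h
    proof -
      have kG: "k \<in> carrier G" using k by simp
      have "x (translate G k h) = (\<Sum>n\<in>N. h (inv k \<otimes> n \<otimes> t))"
        unfolding x_def using kG t by (intro sum.cong) (auto simp: translate_apply m_assoc)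
      also have "\<dots> = x h"
        unfolding x_def using k kG
        by (intro sum.reindex_bij_witness[of _ "\<lambda>n. k \<otimes> n" "\<lambda>n. inv k \<otimes> n"]) (auto simp flip: m_assoc)
      finally show ?thesis .
    qed
    show "x (translate G g f) \<le> real (card N) * b" if "g \<in> carrier G" for g
    proof -
      have "x (translate G g f) \<le> (\<Sum>n\<in>N. b)"
        unfolding x_def using that t b by (intro sum_mono) (auto simp: translate_apply)
      then show ?thesis by simp
    qed
    have "f (\<one> \<otimes> t) \<le> x f"
      unfolding x_def using fin t f_nonneg by (intro member_le_sum) auto
    then have "x (translate G \<one> f) \<noteq> 0" using t by (simp add: translate_one)
    then show "\<exists>g\<in>carrier G. x (translate G g f) \<noteq> 0" by blast
  qed
qed

text \<open>
  An \<open>N\<close>-invariant functional comes from the integral property of \<open>N\<close>. It is taken for the sum \<open>F\<close> of the finitely many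
  translates of \<open>f\<close> by coset representatives, because \<open>N\<close>-translates of \<open>F\<close> dominate all translates of \<open>f\<close>.
  The quotient is finite and has the integral property by summation.
\<close>

lemma integral_property_finite_quotient:
  fixes G (structure)
  assumes N: "N \<lhd> G" and fin: "finite (carrier (G Mod N))" and int: "integral_property (G\<lparr>carrier := N\<rparr>)"
  shows "integral_property G"
  unfolding integral_property_def
proof (intro allI impI)
  fix f assume f: "bounded_weight G f"
  interpret normal N G by fact
  interpret weighted_group G f using is_group f by (rule weighted_groupI)
  obtain b where b: "\<And>y. y \<in> carrier G \<Longrightarrow> f y \<le> b" using f_bounded by blast
  obtain t where t: "t \<in> carrier G" "0 < f t" using f_nonzero by blast
  define R where "R = (\<lambda>A. SOME k. k \<in> A) ` carrier (G Mod N)"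
  have finR: "finite R" using fin by (simp add: R_def)
  have rep: "\<exists>r\<in>R. \<exists>n\<in>N. g = n \<otimes> r" if g: "g \<in> carrier G" for g
  proof -
    define r where "r = (SOME k. k \<in> N #> g)"
    have "r \<in> N #> g" unfolding r_def using rcos_self[OF g subgroup_axioms] by (rule someI)
    then obtain n where n: "n \<in> N" "r = n \<otimes> g" by (auto simp: r_coset_def)
    then have "g = inv n \<otimes> r" using g by (simp flip: m_assoc)
    moreover have "r \<in> R" using g by (auto simp: R_def r_def carrier_FactGroup)
    ultimately show ?thesis using n by blast
  qed
  have RG: "R \<subseteq> carrier G"
  proof
    fix r assume "r \<in> R"
    then obtain g where g: "g \<in> carrier G" "r = (SOME k. k \<in> N #> g)" by (auto simp: R_def carrier_FactGroup)
    then have "r \<in> N #> g" using someI[of "\<lambda>k. k \<in> N #> g", OF rcos_self[OF g(1) subgroup_axioms]] by simp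
    then show "r \<in> carrier G" using g(1) r_coset_subset_G[OF subset] by blast
  qed
  define F where "F = (\<Sum>r\<in>R. translate G r f)"
  have F_apply: "F y = (\<Sum>r\<in>R. f (inv r \<otimes> y))" if "y \<in> carrier G" for y
    unfolding F_def sum_fun_apply using that RG by (intro sum.cong) (auto simp: translate_apply)
  have tr_le_F: "f (inv r \<otimes> y) \<le> F y" if "r \<in> R" "y \<in> carrier G" for r y
    unfolding F_apply[OF that(2)] using that finR RG f_nonneg by (intro member_le_sum) auto
  have F: "bounded_weight G F"
    unfolding bounded_weight_def
  proof (intro conjI ballI)
    show "0 \<le> F y" if "y \<in> carrier G" for y
      unfolding F_apply[OF that] using that RG f_nonneg by (intro sum_nonneg) auto
    have "F y \<le> real (card R) * b" if "y \<in> carrier G" for y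
    proof -
      have "F y \<le> (\<Sum>r\<in>R. b)" unfolding F_apply[OF that] using that RG b by (intro sum_mono) auto
      then show ?thesis by simp
    qed
    then show "\<exists>B. \<forall>y\<in>carrier G. F y \<le> B" by blast
    obtain r n where rn: "r \<in> R" "n \<in> N" "\<one> = n \<otimes> r" using rep[OF one_closed] by blast
    then have rG: "r \<in> carrier G" using RG by blast
    have "f (inv r \<otimes> (r \<otimes> t)) \<le> F (r \<otimes> t)" using rn(1) rG t by (intro tr_le_F) auto
    then have "F (r \<otimes> t) \<noteq> 0" using rG t by (simp flip: m_assoc)
    then show "\<exists>y\<in>carrier G. F y \<noteq> 0" using rG t by blast
  qed
  have sub: "D \<subseteq> dominated G N F"
  proof
    fix h assume "h \<in> D"
    then obtain gs where gs: "set gs \<subseteq> carrier G" "\<And>y. y \<in> carrier G \<Longrightarrow> \<bar>h y\<bar> \<le> (\<Sum>g\<leftarrow>gs. translate G g f y)"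
      unfolding dominated_def by blast
    obtain r n where rn: "\<And>g. g \<in> carrier G \<Longrightarrow> r g \<in> R \<and> n g \<in> N \<and> g = n g \<otimes> r g"
      using rep by metis
    show "h \<in> dominated G N F"
    proof (rule dominatedI[of "map n gs"])
      show "set (map n gs) \<subseteq> N" using gs(1) rn by auto
      fix y assume y: "y \<in> carrier G"
      have "translate G g f y \<le> translate G (n g) F y" if "g \<in> set gs" for g
      proof -
        have g: "g \<in> carrier G" using that gs(1) by blast
        then have *: "r g \<in> R" "n g \<in> carrier G" "r g \<in> carrier G" "g = n g \<otimes> r g" using rn[OF g] RG by auto
        have "translate G g f y = translate G (n g) (translate G (r g) f) y"
          using * by (metis translate_translate)
        also have "\<dots> = f (inv (r g) \<otimes> (inv (n g) \<otimes> y))" using * y by (simp add: translate_apply)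
        also have "\<dots> \<le> F (inv (n g) \<otimes> y)" using * y by (intro tr_le_F) auto
        finally show ?thesis using y by (simp add: translate_apply)
      qed
      then have "(\<Sum>g\<leftarrow>gs. translate G g f y) \<le> (\<Sum>g\<leftarrow>gs. translate G (n g) F y)" by (rule sum_list_mono)
      then show "\<bar>h y\<bar> \<le> (\<Sum>k\<leftarrow>map n gs. translate G k F y)"
        using gs(2)[OF y] by (simp add: o_def)
    qed
  qed
  obtain M where M: "positive_functional G (dominated G N F) M" "M F = 1"
    "\<forall>k\<in>N. \<forall>h\<in>dominated G N F. M (translate G k h) = M h"
    using subgroup_invariant_functional[OF is_group subgroup_axioms int F] by blast
  have MD: "positive_functional G D M"
    using M(1) sub unfolding positive_functional_def linear_into_def by blast
  have trR: "translate G r f \<in> D" if "r \<in> R" for r using that RG f_in_D by (auto intro: translate_in_D)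
  have MF: "(\<Sum>r\<in>R. M (translate G r f)) = 1"
    using linear_into_sum[OF positive_functional_linear[OF MD] subspace_D, of R "\<lambda>r. translate G r f"] trR M(2) by (simp add: F_def)
  have Mnn: "0 \<le> M (translate G r f)" if "r \<in> R" for r
    using that RG f_nonneg by (intro positive_functional_nonneg[OF MD trR] translate_nonneg) auto
  show "\<exists>m. invariant_integral G f m"
  proof (rule integral_of_quotient_integral[OF N integral_property_finite[OF factorgroup_is_group fin] f MD])
    show "M (translate G n h) = M h" if "n \<in> N" "h \<in> D" for n h using M(3) sub that by blast
    show "M (translate G g f) \<le> 1" if g: "g \<in> carrier G" for g
    proof -
      obtain r n where rn: "r \<in> R" "n \<in> N" "g = n \<otimes> r" using rep[OF g] by blast
      have "M (translate G g f) = M (translate G n (translate G r f))"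
        using rn RG by (simp add: translate_translate subset_iff)
      also have "\<dots> = M (translate G r f)" using M(3) sub rn(2) trR[OF rn(1)] by blast
      also have "\<dots> \<le> (\<Sum>r\<in>R. M (translate G r f))" using rn(1) finR Mnn by (intro member_le_sum) auto
      finally show ?thesis using MF by simp
    qed
    show "\<exists>g\<in>carrier G. M (translate G g f) \<noteq> 0"
    proof (rule ccontr)
      assume "\<not> ?thesis"
      then have "(\<Sum>r\<in>R. M (translate G r f)) = 0" using RG by (intro sum.neutral) auto
      then show False using MF by simp
    qed
  qed
qed

lemma directed_finite_subset:
  assumes "directed_by_inclusion \<S>" "finite X" "X \<subseteq> \<Union>\<S>"
  shows "\<exists>K\<in>\<S>. X \<subseteq> K"
  using assms(2,3)
proof (induction X rule: finite_induct)
  case empty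
  then show ?case using assms(1) by (auto simp: directed_by_inclusion_def)
next
  case (insert a X)
  then obtain K K' where "K \<in> \<S>" "X \<subseteq> K" "K' \<in> \<S>" "a \<in> K'" by auto
  moreover then obtain L where "L \<in> \<S>" "K \<subseteq> L" "K' \<subseteq> L"
    using assms(1) unfolding directed_by_inclusion_def by blast
  ultimately show ?case by blast
qed

text \<open>
  Compactness: finitely many invariance conditions on \<open>\<ell>\<^sup>\<infinity>(G; f)\<close> involve finitely many group elements, also those in the
  dominating sums, and these lie in one member \<open>K\<close> of the family. A \<open>K\<close>-invariant functional
  satisfies these conditions exactly.
\<close>

lemma integral_property_directed_union:
  fixes G (structure)
  assumes "group G" and sub: "\<And>K. K \<in> \<S> \<Longrightarrow> subgroup K G" and dir: "directed_by_inclusion \<S>"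
    and union: "\<Union>\<S> = carrier G" and int: "\<And>K. K \<in> \<S> \<Longrightarrow> integral_property (G\<lparr>carrier := K\<rparr>)"
  shows "integral_property G"
  unfolding integral_property_def
proof (intro allI impI)
  fix f assume f: "bounded_weight G f"
  interpret weighted_group G f using \<open>group G\<close> f by (rule weighted_groupI)
  define A where "A = {translate G g h - h | g h. g \<in> carrier G \<and> h \<in> D}"
  have "\<exists>m. positive_functional G D m \<and> (\<forall>a\<in>A. 0 \<le> m a) \<and> m f = 1"
  proof (rule constrained_positive_functional)
    show "A \<subseteq> D" by (auto simp: A_def intro: subspace_diff subspace_D translate_in_D)
    show "1 *\<^sub>R f - translate G g f \<in> A" if "g \<in> carrier G" for g
    proof -
      \<comment> \<open>With \<open>h = - f\<close> the invariance conditions contain the bounds on translates that compactness asks for.\<close>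
      have "1 *\<^sub>R f - translate G g f = translate G g (- f) - (- f)" by (simp only: translate_uminus) simp
      then show ?thesis using that subspace_neg[OF subspace_D f_in_D] unfolding A_def by blast
    qed
    fix A0 :: "('a \<Rightarrow> real) set" and \<epsilon> :: real assume A0: "finite A0" "A0 \<subseteq> A" and \<epsilon>: "0 < \<epsilon>"
    have "\<exists>g h gs. a = translate G g h - h \<and> g \<in> carrier G \<and> set gs \<subseteq> carrier G \<and>
        (\<forall>x\<in>carrier G. \<bar>h x\<bar> \<le> (\<Sum>g\<leftarrow>gs. translate G g f x))" if "a \<in> A0" for a
      using that A0(2) unfolding A_def dominated_def by blast
    then obtain g h gs where *: "\<And>a. a \<in> A0 \<Longrightarrow> a = translate G (g a) (h a) - h a \<and> g a \<in> carrier G \<and>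
        set (gs a) \<subseteq> carrier G \<and> (\<forall>x\<in>carrier G. \<bar>h a x\<bar> \<le> (\<Sum>g\<leftarrow>gs a. translate G g f x))"
      by metis
    have inS: "g a \<in> \<Union>\<S> \<and> set (gs a) \<subseteq> \<Union>\<S>" if "a \<in> A0" for a
      using *[OF that] unfolding union by simp
    have "g ` A0 \<union> (\<Union>a\<in>A0. set (gs a)) \<subseteq> \<Union>\<S>"
      by (intro Un_least image_subsetI UN_least)
        (rule inS[THEN conjunct1], assumption, rule inS[THEN conjunct2], assumption)
    moreover have "finite (g ` A0 \<union> (\<Union>a\<in>A0. set (gs a)))" using A0 by simp
    ultimately have "\<exists>K\<in>\<S>. g ` A0 \<union> (\<Union>a\<in>A0. set (gs a)) \<subseteq> K"
      by (intro directed_finite_subset[OF dir])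
    then obtain K where K: "K \<in> \<S>" "g ` A0 \<union> (\<Union>a\<in>A0. set (gs a)) \<subseteq> K" by blast
    have hK: "h a \<in> dominated G K f" if "a \<in> A0" for a
      using *[OF that] K(2) that by (intro dominatedI[of "gs a"]) auto
    obtain M where M: "positive_functional G (dominated G K f) M" "M f = 1"
      "\<forall>k\<in>K. \<forall>h\<in>dominated G K f. M (translate G k h) = M h"
      using subgroup_invariant_functional[OF \<open>group G\<close> sub[OF K(1)] int[OF K(1)] f] by blast
    interpret K: subgroup K G by (rule sub[OF K(1)])
    have W0: "subspace (dominated G K f)"
      using f_nonneg K.subset by (rule subspace_dominated)
    have aK: "a \<in> dominated G K f \<and> M a = 0" if a: "a \<in> A0" for a
    proof -
      have "g a \<in> K" using a K(2) by blast
      then have "translate G (g a) (h a) \<in> dominated G K f" "M (translate G (g a) (h a)) = M (h a)"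
        using M(3) hK[OF a] translate_in_dominated[OF sub[OF K(1)]] by auto
      then show ?thesis
        using *[OF a] hK[OF a] W0 linear_into_diff[OF positive_functional_linear[OF M(1)] W0, of "translate G (g a) (h a)" "h a"]
        by (metis subspace_diff diff_self)
    qed
    show "\<exists>K m. \<one> \<in> K \<and> K \<subseteq> carrier G \<and> A0 \<subseteq> dominated G K f \<and>
        positive_functional G (dominated G K f) m \<and> (\<forall>a\<in>A0. - \<epsilon> \<le> m a) \<and> m f = 1"
      using aK \<epsilon> M(1,2) K.subset by (intro exI[of _ K] exI[of _ M]) auto
  qed
  then obtain m where m: "positive_functional G D m" "\<forall>a\<in>A. 0 \<le> m a" "m f = 1" by blast
  have "m (translate G g h) = m h" if "g \<in> carrier G" "h \<in> D" for g h
    using m(2) that by (intro invariant_if_subinvariant[OF positive_functional_linear[OF m(1)]]) (auto simp: A_def)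
  then have "invariant_integral G f m" using m(1,3) by (simp add: invariant_integral_def)
  then show "\<exists>m. invariant_integral G f m" by blast
qed

section \<open>Subexponential kernels\<close>

text \<open>
  Products of sets do not depend on the carrier, so for a subgroup \<open>Z\<close> this is subexponential growth of \<open>Z\<close> as a
  group, expressed with the operations of \<open>G\<close>.
\<close>

definition subexponential_in :: "('g, 'm) monoid_scheme \<Rightarrow> 'g set \<Rightarrow> bool" where
  "subexponential_in G Z \<longleftrightarrow>
     (\<forall>S. S \<subseteq> Z \<and> finite S \<and> S \<noteq> {} \<longrightarrow> (\<lambda>n. root n (real (card (set_power G S n)))) \<longlonglongrightarrow> 1)"

lemma set_power_subset:
  assumes "subgroup Z G" "S \<subseteq> Z" shows "set_power G S n \<subseteq> Z"
proof -
  interpret subgroup Z G by fact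
  show ?thesis using assms(2) by (induction n) (auto simp: set_mult_def)
qed

lemma finite_set_power: "finite S \<Longrightarrow> finite (set_power G S n)"
  by (induction n) (auto simp: set_mult_def)

lemma set_power_nonempty: "S \<noteq> {} \<Longrightarrow> set_power G S n \<noteq> {}"
  by (induction n) (auto simp: set_mult_def)

lemma summable_growth:
  assumes lim: "(\<lambda>n. root n (real (card (set_power G S n)))) \<longlonglongrightarrow> 1" and q: "0 < q" "q < 1"
  shows "summable (\<lambda>n. q ^ n * real (card (set_power G S n)))"
proof (rule root_test_convergence)
  have "(\<lambda>n. q * root n (real (card (set_power G S n)))) \<longlonglongrightarrow> q * 1"
    by (intro tendsto_mult lim tendsto_const)
  moreover have "\<forall>\<^sub>F n in sequentially. q * root n (real (card (set_power G S n))) =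
      root n (norm (q ^ n * real (card (set_power G S n))))"
    using eventually_gt_at_top[of 0]
    by eventually_elim (use q in \<open>simp add: real_root_mult real_root_power_cancel\<close>)
  ultimately show "(\<lambda>n. root n (norm (q ^ n * real (card (set_power G S n))))) \<longlonglongrightarrow> q"
    using Lim_transform_eventually by fastforce
qed (rule q)

text \<open>
  For finite \<open>S \<subseteq> Z\<close> and \<open>q < 1\<close> put \<open>smooth h y = (\<Sum>n. q ^ n * (\<Sum>u\<in>S\<^sup>n. h (u \<otimes> y)))\<close>, which converges for bounded
  \<open>h\<close> since \<open>Z\<close> has subexponential growth. A factor from \<open>S\<close> moves the \<open>n\<close>-th term into the next one and thus
  costs at most a factor \<open>1 / q\<close>. Choose \<open>t\<close> such that \<open>smooth f t\<close> is at least half of the supremum of \<open>smooth f\<close>,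
  and let \<open>x h = smooth h t / smooth f t\<close>. The choice of \<open>t\<close> keeps \<open>x\<close> bounded on all translates of \<open>f\<close> by
  elements commuting with \<open>Z\<close>, as these translations commute with smoothing.
\<close>

lemma near_invariant_functional:
  fixes G (structure)
  assumes "group G" and Z: "subgroup Z G" and growth: "subexponential_in G Z"
    and decomp: "\<And>g. g \<in> carrier G \<Longrightarrow> \<exists>z\<in>Z. \<exists>c\<in>carrier G. g = z \<otimes> c \<and> (\<forall>u\<in>Z. u \<otimes> c = c \<otimes> u)"
    and f: "bounded_weight G f" and X: "finite X" "X \<subseteq> carrier G" and Y: "finite Y" "Y \<subseteq> Z"
    and q: "0 < q" "q < 1"
  shows "\<exists>x. positive_functional G (dominated G (carrier G) f) x \<and> x f = 1 \<and>
    (\<forall>k\<in>X. x (translate G k f) \<le> 2 / q) \<and>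
    (\<forall>z\<in>Y. \<forall>h\<in>dominated G (carrier G) f. (\<forall>y\<in>carrier G. 0 \<le> h y) \<longrightarrow> x (translate G z h) \<le> x h / q)"
proof -
  interpret weighted_group G f using \<open>group G\<close> f by (rule weighted_groupI)
  interpret Z: subgroup Z G by fact
  obtain z c where zc: "\<And>g. g \<in> carrier G \<Longrightarrow> z g \<in> Z \<and> c g \<in> carrier G \<and> g = z g \<otimes> c g \<and> (\<forall>u\<in>Z. u \<otimes> c g = c g \<otimes> u)"
    using decomp by metis
  \<comment> \<open>The set \<open>S\<close> contains the inverses of all elements of \<open>Z\<close> by which functions will be translated.\<close>
  define S where "S = insert \<one> ((\<lambda>y. inv y) ` Y \<union> (\<lambda>k. inv (z k)) ` X)"
  have SZ: "S \<subseteq> Z" using X Y zc by (auto simp: S_def)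
  have finS: "finite S" using X Y by (simp add: S_def)
  have SG: "S \<subseteq> carrier G" using SZ Z.subset by blast
  let ?P = "set_power G S"
  have PZ: "?P n \<subseteq> Z" for n using Z SZ by (rule set_power_subset)
  have PG: "?P n \<subseteq> carrier G" for n using PZ Z.subset by blast
  have finP: "finite (?P n)" for n using finS by (rule finite_set_power)
  have "S \<noteq> {}" by (simp add: S_def)
  then have "(\<lambda>n. root n (real (card (?P n)))) \<longlonglongrightarrow> 1"
    using growth SZ finS unfolding subexponential_in_def by blast
  then have growth_sum: "summable (\<lambda>n. q ^ n * real (card (?P n)))" using q by (rule summable_growth)
  define a where "a h y n = q ^ n * (\<Sum>u\<in>?P n. h (u \<otimes> y))" for h :: "'a \<Rightarrow> real" and y n
  define smooth where "smooth h y = (\<Sum>n. a h y n)" for h y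
  have a_bound: "\<bar>a h y n\<bar> \<le> q ^ n * real (card (?P n)) * B"
    if "\<And>x. x \<in> carrier G \<Longrightarrow> \<bar>h x\<bar> \<le> B" "y \<in> carrier G" for h y n B
  proof -
    have "\<bar>\<Sum>u\<in>?P n. h (u \<otimes> y)\<bar> \<le> (\<Sum>u\<in>?P n. \<bar>h (u \<otimes> y)\<bar>)" by (rule sum_abs)
    also have "\<dots> \<le> (\<Sum>u\<in>?P n. B)" using that PG by (intro sum_mono that(1)) auto
    finally have "\<bar>\<Sum>u\<in>?P n. h (u \<otimes> y)\<bar> \<le> real (card (?P n)) * B" by simp
    then have "q ^ n * \<bar>\<Sum>u\<in>?P n. h (u \<otimes> y)\<bar> \<le> q ^ n * (real (card (?P n)) * B)"
      using q by (intro mult_left_mono) auto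
    then show ?thesis using q by (simp add: a_def abs_mult mult.assoc)
  qed
  have summ: "summable (a h y)" if h: "h \<in> D" and y: "y \<in> carrier G" for h y
  proof -
    obtain B where B: "\<And>x. x \<in> carrier G \<Longrightarrow> \<bar>h x\<bar> \<le> B"
      using D_bounded[OF h] by blast
    show ?thesis
    proof (rule summable_comparison_test'[OF summable_mult2[OF growth_sum, of B], of 0])
      show "norm (a h y n) \<le> q ^ n * real (card (?P n)) * B" for n
        using a_bound[OF B y] by simp
    qed
  qed
  have nonneg: "0 \<le> smooth h y" if "h \<in> D" "y \<in> carrier G" "\<And>x. x \<in> carrier G \<Longrightarrow> 0 \<le> h x" for h y
    unfolding smooth_def
  proof (rule suminf_nonneg[OF summ[OF that(1,2)]])
    show "0 \<le> a h y n" for n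
      unfolding a_def using q that(2) PG[of n] by (intro mult_nonneg_nonneg sum_nonneg that(3)) auto
  qed
  have shift: "(\<Sum>n. q ^ n * (\<Sum>u\<in>?P n. h (s \<otimes> u \<otimes> y))) \<le> smooth h y / q"
    if h: "h \<in> D" "\<And>x. x \<in> carrier G \<Longrightarrow> 0 \<le> h x" and y: "y \<in> carrier G" and s: "s \<in> S" for h y s
  proof -
    have sG: "s \<in> carrier G" using s SG by blast
    have le: "q ^ n * (\<Sum>u\<in>?P n. h (s \<otimes> u \<otimes> y)) \<le> a h y (Suc n) / q" for n
    proof -
      have inj: "inj_on ((\<otimes>) s) (?P n)" using sG PG[of n] by (auto simp: inj_on_def subset_iff)
      have "(\<Sum>u\<in>?P n. h (s \<otimes> u \<otimes> y)) = (\<Sum>v\<in>(\<otimes>) s ` ?P n. h (v \<otimes> y))"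
        by (simp add: sum.reindex[OF inj])
      also have "\<dots> \<le> (\<Sum>v\<in>?P (Suc n). h (v \<otimes> y))"
      proof (rule sum_mono2[OF finP])
        show "(\<otimes>) s ` ?P n \<subseteq> ?P (Suc n)" using s by (auto simp: set_mult_def)
        show "0 \<le> h (v \<otimes> y)" if "v \<in> ?P (Suc n) - (\<otimes>) s ` ?P n" for v
          using that PG[of "Suc n"] y by (intro h(2)) blast
      qed
      finally have "q ^ n * (\<Sum>u\<in>?P n. h (s \<otimes> u \<otimes> y)) \<le> q ^ n * (\<Sum>v\<in>?P (Suc n). h (v \<otimes> y))"
        using q by (intro mult_left_mono) auto
      also have "\<dots> = a h y (Suc n) / q" using q by (simp add: a_def)
      finally show ?thesis .
    qed
    have nn: "0 \<le> q ^ n * (\<Sum>u\<in>?P n. h (s \<otimes> u \<otimes> y))" for n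
      using q sG y PG[of n] by (intro mult_nonneg_nonneg sum_nonneg h(2)) auto
    have sumS: "summable (\<lambda>n. a h y (Suc n) / q)"
      using summ[OF h(1) y] by (intro summable_divide) (simp only: summable_Suc_iff)
    have "(\<Sum>n. q ^ n * (\<Sum>u\<in>?P n. h (s \<otimes> u \<otimes> y))) \<le> (\<Sum>n. a h y (Suc n) / q)"
    proof (rule suminf_le[OF le _ sumS])
      show "summable (\<lambda>n. q ^ n * (\<Sum>u\<in>?P n. h (s \<otimes> u \<otimes> y)))"
        using le nn by (intro summable_comparison_test'[OF sumS, of 0]) simp
    qed
    also have "\<dots> = (\<Sum>n. a h y (Suc n)) / q"
      using summ[OF h(1) y] by (intro suminf_divide) (simp only: summable_Suc_iff)
    also have "(\<Sum>n. a h y (Suc n)) = smooth h y - a h y 0"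
      unfolding smooth_def using suminf_split_head[OF summ[OF h(1) y]] by simp
    also have "(smooth h y - a h y 0) / q \<le> smooth h y / q"
      using q y h(2)[OF y] by (intro divide_right_mono) (auto simp: a_def)
    finally show ?thesis .
  qed
  obtain t0 where t0: "t0 \<in> carrier G" "0 < f t0" using f_nonzero by blast
  obtain B where B: "\<And>x. x \<in> carrier G \<Longrightarrow> \<bar>f x\<bar> \<le> B"
    using D_bounded[OF f_in_D] by blast
  have "smooth f y \<le> (\<Sum>n. q ^ n * real (card (?P n)) * B)" if y: "y \<in> carrier G" for y
    unfolding smooth_def
  proof (rule suminf_le[OF _ summ[OF f_in_D y] summable_mult2[OF growth_sum]])
    show "a f y n \<le> q ^ n * real (card (?P n)) * B" for n
      using a_bound[OF B y] by (rule order_trans[OF abs_ge_self])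
  qed
  then have bdd: "bdd_above (smooth f ` carrier G)" by (intro bdd_aboveI2)
  define s where "s = (SUP y\<in>carrier G. smooth f y)"
  have le_s: "smooth f y \<le> s" if "y \<in> carrier G" for y
    unfolding s_def using that bdd by (rule cSUP_upper)
  note t0(2)
  also have "f t0 = (\<Sum>n\<in>{0}. a f t0 n)" using t0 by (simp add: a_def)
  also have "\<dots> \<le> smooth f t0"
    unfolding smooth_def
  proof (rule sum_le_suminf[OF summ[OF f_in_D t0(1)]])
    show "0 \<le> a f t0 n" for n
      unfolding a_def using q t0(1) PG[of n] by (intro mult_nonneg_nonneg sum_nonneg f_nonneg) auto
  qed simp
  finally have spos: "0 < s" using le_s[OF t0(1)] by linarith
  then have "s / 2 < s" by simp
  then obtain t where t: "t \<in> carrier G" "s / 2 < smooth f t"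
    unfolding s_def using less_cSUP_iff[OF _ bdd] t0(1) by blast
  define w where "w = smooth f t"
  have w: "0 < w" "smooth f y \<le> 2 * w" if "y \<in> carrier G" for y
    using spos t(2) le_s[OF that] unfolding w_def by linarith+
  define x where "x h = smooth h t / w" for h
  have lin: "linear_into D x"
    unfolding linear_into_def
  proof (intro conjI ballI allI)
    fix h h' assume h: "h \<in> D" "h' \<in> D"
    have "a (h + h') t = (\<lambda>n. a h t n + a h' t n)" by (auto simp: a_def sum.distrib algebra_simps)
    then have "smooth (h + h') t = smooth h t + smooth h' t"
      unfolding smooth_def using suminf_add[OF summ[OF h(1) t(1)] summ[OF h(2) t(1)]] by simp
    then show "x (h + h') = x h + x h'" by (simp add: x_def add_divide_distrib)
  next
    fix r h assume h: "h \<in> D"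
    have "a (r *\<^sub>R h) t = (\<lambda>n. r * a h t n)" by (auto simp: a_def algebra_simps simp flip: sum_distrib_left)
    then have "smooth (r *\<^sub>R h) t = r * smooth h t"
      unfolding smooth_def using suminf_mult[OF summ[OF h t(1)], of r] by simp
    then show "x (r *\<^sub>R h) = r *\<^sub>R x h" by (simp add: x_def)
  qed
  have "positive_functional G D x"
    using lin nonneg t w(1)[OF t(1)] by (simp add: x_def positive_functional_def)
  moreover have "x f = 1" using w[OF t(1)] by (simp add: x_def w_def)
  moreover have "x (translate G k f) \<le> 2 / q" if k: "k \<in> X" for k
  proof -
    have kG: "k \<in> carrier G" using k X by blast
    have *: "z k \<in> Z" "z k \<in> carrier G" "c k \<in> carrier G" "k = z k \<otimes> c k" "\<And>u. u \<in> Z \<Longrightarrow> u \<otimes> c k = c k \<otimes> u"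
      using zc[OF kG] by auto
    have comm: "inv (c k) \<otimes> u = u \<otimes> inv (c k)" if u: "u \<in> Z" for u
    proof -
      have uG: "u \<in> carrier G" using u by simp
      have "inv (c k) \<otimes> u = inv (c k) \<otimes> (u \<otimes> c k) \<otimes> inv (c k)"
        using *(3) uG by (simp add: m_assoc)
      also have "\<dots> = inv (c k) \<otimes> (c k \<otimes> u) \<otimes> inv (c k)" using *(5)[OF u] by simp
      also have "\<dots> = u \<otimes> inv (c k)" using *(3) uG by (simp flip: m_assoc)
      finally show ?thesis .
    qed
    have "inv k \<otimes> (u \<otimes> t) = inv (z k) \<otimes> u \<otimes> (inv (c k) \<otimes> t)" if u: "u \<in> Z" for u
    proof -
      have uG: "u \<in> carrier G" using u by simp
      have zu: "inv (z k) \<otimes> u \<in> Z" using u *(1) by simp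
      have "inv k = inv (c k) \<otimes> inv (z k)" using *(2,3) by (subst *(4)) (simp add: inv_mult_group)
      then have "inv k \<otimes> (u \<otimes> t) = (inv (c k) \<otimes> (inv (z k) \<otimes> u)) \<otimes> t"
        using *(2,3) uG t(1) by (simp add: m_assoc)
      also have "\<dots> = inv (z k) \<otimes> u \<otimes> (inv (c k) \<otimes> t)"
        unfolding comm[OF zu] using *(2,3) uG t(1) by (simp add: m_assoc)
      finally show ?thesis .
    qed
    then have "a (translate G k f) t n = q ^ n * (\<Sum>u\<in>?P n. f (inv (z k) \<otimes> u \<otimes> (inv (c k) \<otimes> t)))" for n
      unfolding a_def using PZ[of n] PG[of n] t(1)
      by (intro arg_cong[of _ _ "(*) (q ^ n)"] sum.cong) (auto simp: translate_apply subset_iff)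
    then have "smooth (translate G k f) t = (\<Sum>n. q ^ n * (\<Sum>u\<in>?P n. f (inv (z k) \<otimes> u \<otimes> (inv (c k) \<otimes> t))))"
      by (simp add: smooth_def)
    also have "\<dots> \<le> smooth f (inv (c k) \<otimes> t) / q"
      using *(3) t(1) k by (intro shift f_in_D f_nonneg) (auto simp: S_def)
    also have "\<dots> \<le> (2 * w) / q"
      using q *(3) t(1) by (intro divide_right_mono w(2)) auto
    finally show ?thesis using w(1)[OF t(1)] by (simp add: x_def divide_le_eq)
  qed
  moreover have "x (translate G y h) \<le> x h / q" if y: "y \<in> Y" and h: "h \<in> D" "\<forall>y\<in>carrier G. 0 \<le> h y" for y h
  proof -
    have yG: "y \<in> carrier G" using y Y(2) by auto
    have "inv y \<otimes> (u \<otimes> t) = inv y \<otimes> u \<otimes> t" if "u \<in> carrier G" for u using that yG t(1) by (simp add: m_assoc)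
    then have "a (translate G y h) t n = q ^ n * (\<Sum>u\<in>?P n. h (inv y \<otimes> u \<otimes> t))" for n
      unfolding a_def using PG[of n] t(1)
      by (intro arg_cong[of _ _ "(*) (q ^ n)"] sum.cong) (auto simp: translate_apply subset_iff)
    then have "smooth (translate G y h) t = (\<Sum>n. q ^ n * (\<Sum>u\<in>?P n. h (inv y \<otimes> u \<otimes> t)))"
      by (simp add: smooth_def)
    also have "\<dots> \<le> smooth h t / q" using h t(1) y by (intro shift) (auto simp: S_def)
    finally have "x (translate G y h) \<le> smooth h t / q / w"
      unfolding x_def using w(1)[OF t(1)] by (intro divide_right_mono) auto
    then show ?thesis by (simp add: x_def mult.commute)
  qed
  ultimately show ?thesis by blast
qed

text \<open>
  As \<open>q\<close> tends to \<open>1\<close> and the finite sets grow, compactness turns near-invariant functionals into a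
  \<open>Z\<close>-invariant one that is bounded on the translates of \<open>f\<close>. In place of \<open>3\<close> any
  constant above \<open>2\<close>, the limit of \<open>2 / q\<close>, would do.
\<close>

lemma integral_property_subexponential_kernel:
  fixes G (structure)
  assumes N: "Z \<lhd> G" and growth: "subexponential_in G Z"
    and decomp: "\<And>g. g \<in> carrier G \<Longrightarrow> \<exists>z\<in>Z. \<exists>c\<in>carrier G. g = z \<otimes> c \<and> (\<forall>u\<in>Z. u \<otimes> c = c \<otimes> u)"
    and int: "integral_property (G Mod Z)"
  shows "integral_property G"
  unfolding integral_property_def
proof (intro allI impI)
  fix f assume f: "bounded_weight G f"
  interpret normal Z G by fact
  interpret weighted_group G f using is_group f by (rule weighted_groupI)
  define A where "A = {translate G z h - h | z h. z \<in> Z \<and> h \<in> D} \<union> {3 *\<^sub>R f - translate G k f | k. k \<in> carrier G}"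
  have AD: "A \<subseteq> D"
    by (auto simp: A_def intro!: subspace_diff subspace_scale subspace_D translate_in_D f_in_D)
  have "\<exists>m. positive_functional G D m \<and> (\<forall>a\<in>A. 0 \<le> m a) \<and> m f = 1"
  proof (rule constrained_positive_functional[OF AD])
    show "3 *\<^sub>R f - translate G g f \<in> A" if "g \<in> carrier G" for g using that unfolding A_def by blast
    fix A0 :: "('a \<Rightarrow> real) set" and \<epsilon> :: real assume A0: "finite A0" "A0 \<subseteq> A" and \<epsilon>: "0 < \<epsilon>"
    have "\<exists>z h gs k. z \<in> Z \<and> k \<in> carrier G \<and> set gs \<subseteq> carrier G \<and>
        (\<forall>x\<in>carrier G. \<bar>h x\<bar> \<le> (\<Sum>g\<leftarrow>gs. translate G g f x)) \<and>
        (a = translate G z h - h \<or> a = 3 *\<^sub>R f - translate G k f)" if a: "a \<in> A0" for a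
    proof -
      have "a \<in> A" using a A0(2) by blast
      then consider z h where "z \<in> Z" "h \<in> D" "a = translate G z h - h"
        | k where "k \<in> carrier G" "a = 3 *\<^sub>R f - translate G k f"
        unfolding A_def by blast
      then show ?thesis
      proof cases
        case 1
        then show ?thesis unfolding dominated_def using one_closed by blast
      next
        case 2
        then show ?thesis
          by (intro exI[of _ \<one>] exI[of _ "0 :: 'a \<Rightarrow> real"] exI[of _ "[]"] exI[of _ k]) auto
      qed
    qed
    then obtain z h gs k where *: "\<And>a. a \<in> A0 \<Longrightarrow> z a \<in> Z \<and> k a \<in> carrier G \<and> set (gs a) \<subseteq> carrier G \<and>
        (\<forall>x\<in>carrier G. \<bar>h a x\<bar> \<le> (\<Sum>g\<leftarrow>gs a. translate G g f x)) \<and>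
        (a = translate G (z a) (h a) - h a \<or> a = 3 *\<^sub>R f - translate G (k a) f)"
      by metis
    define n where "n = (\<Sum>a\<in>A0. length (gs a))"
    \<comment> \<open>With \<open>1 / q = 1 + \<delta>\<close> the bound \<open>2 / q\<close> is at most \<open>3\<close>, and the error in each invariance condition is at most
      \<open>9 * \<delta> * n\<close>.\<close>
    define \<delta> where "\<delta> = min (1 / 2) (\<epsilon> / (9 * (real n + 1)))"
    have \<delta>: "0 < \<delta>" "\<delta> \<le> 1 / 2"
      using \<epsilon> by (simp add: \<delta>_def) (simp only: \<delta>_def min.cobounded1)
    have "9 * \<delta> * real n \<le> 9 * (\<epsilon> / (9 * (real n + 1))) * real n"
      by (intro mult_right_mono) (auto simp: \<delta>_def)
    also have "\<dots> \<le> \<epsilon>" using \<epsilon> by (simp add: field_simps)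
    finally have \<delta>n: "9 * \<delta> * real n \<le> \<epsilon>" .
    define q where "q = 1 / (1 + \<delta>)"
    have q: "0 < q" "q < 1" "1 / q = 1 + \<delta>" using \<delta> by (auto simp: q_def)
    have q': "1 - q \<le> \<delta>" using \<delta> by (simp add: q_def field_simps)
    let ?X = "k ` A0 \<union> (\<Union>a\<in>A0. set (gs a))" and ?Y = "z ` A0 \<union> (\<lambda>a. inv (z a)) ` A0"
    have X: "finite ?X" "?X \<subseteq> carrier G" using A0(1) * by (auto simp: subset_iff)
    have Y: "finite ?Y" "?Y \<subseteq> Z" using A0(1) * by auto
    obtain x where x: "positive_functional G D x" "x f = 1" "\<forall>k\<in>?X. x (translate G k f) \<le> 2 / q"
      "\<forall>z\<in>?Y. \<forall>h\<in>D. (\<forall>y\<in>carrier G. 0 \<le> h y) \<longrightarrow> x (translate G z h) \<le> x h / q"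
      using near_invariant_functional[OF is_group subgroup_axioms growth decomp f X Y q(1,2)] by blast
    have lin: "linear_into D x" by (rule positive_functional_linear[OF x(1)])
    have x_translate: "x (translate G k f) \<le> 3" if "k \<in> ?X" for k
    proof -
      have "x (translate G k f) \<le> 2 / q" using x(3) that by blast
      also have "2 / q = 2 * (1 / q)" by simp
      also have "\<dots> \<le> 3" unfolding q(3) using \<delta> by simp
      finally show ?thesis .
    qed
    have near: "- \<epsilon> \<le> x (translate G (z a) (h a) - h a)" if a: "a \<in> A0" for a
    proof -
      let ?h = "h a" and ?z = "z a" and ?ah = "\<lambda>y. \<bar>h a y\<bar>"
      have zG: "?z \<in> carrier G" "inv ?z \<in> carrier G" and gsa: "set (gs a) \<subseteq> carrier G"
        and zY: "?z \<in> ?Y" "inv ?z \<in> ?Y" using *[OF a] a by auto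
      have hD: "?h \<in> D" using *[OF a] by (intro dominatedI[of "gs a"]) auto
      then have ahD: "?ah \<in> D" by (rule abs_in_D)
      let ?p = "?ah + ?h"
      have pD: "?p \<in> D" using hD ahD by (intro subspace_add subspace_D)
      have "0 \<le> \<bar>?h y\<bar> + ?h y" for y by linarith
      then have pnn: "\<forall>y\<in>carrier G. 0 \<le> ?p y" by simp
      \<comment> \<open>The near-invariance inequality holds for nonnegative functions, so \<open>h\<close> is written as \<open>p - \<bar>h\<bar>\<close>.\<close>
      have "q * x ?p \<le> x (translate G ?z ?p)"
      proof -
        have "x (translate G (inv ?z) (translate G ?z ?p)) \<le> x (translate G ?z ?p) / q"
          using x(4) zY(2) translate_in_D[OF zG(1) pD] zG(1) translate_nonneg[OF zG(1), of ?p] by auto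
        moreover have "translate G (inv ?z) (translate G ?z ?p) = ?p"
          using zG by (simp add: translate_translate translate_one)
        ultimately show ?thesis using q by (simp add: field_simps)
      qed
      moreover have "x (translate G ?z ?ah) \<le> x ?ah + \<delta> * x ?ah"
      proof -
        have "x (translate G ?z ?ah) \<le> x ?ah * (1 / q)" using x(4) zY(1) ahD by simp
        then show ?thesis unfolding q(3) by (simp add: algebra_simps)
      qed
      moreover have "(1 - q) * x ?p \<le> \<delta> * (2 * x ?ah)"
      proof (intro mult_mono q')
        have "x ?h \<le> x ?ah"
          using positive_functional_abs_le[OF x(1) subspace_D hD ahD] by simp
        then show "x ?p \<le> 2 * x ?ah" using linear_into_add[OF lin ahD hD] by simp
        show "0 \<le> x ?p" using pnn by (intro positive_functional_nonneg[OF x(1) pD]) blast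
      qed (use \<delta> in auto)
      moreover have "x ?ah \<le> 3 * real n"
      proof -
        have "length (gs a) \<le> n"
          unfolding n_def using a A0(1) member_le_sum[of a A0 "\<lambda>a. length (gs a)"] by simp
        have "\<bar>x ?ah\<bar> \<le> (\<Sum>g\<leftarrow>gs a. x (translate G g f))"
          using *[OF a] by (intro positive_functional_le_translates[OF x(1) ahD gsa]) simp
        also have "\<dots> \<le> (\<Sum>g\<leftarrow>gs a. 3)" using a by (intro sum_list_mono x_translate) blast
        also have "\<dots> = 3 * real (length (gs a))" by (simp add: sum_list_triv)
        also have "\<dots> \<le> 3 * real n" using \<open>length (gs a) \<le> n\<close> by simp
        finally show ?thesis by simp
      qed
      then have "\<delta> * x ?ah \<le> \<delta> * (3 * real n)" using \<delta> by (intro mult_left_mono) auto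
      moreover have "x (translate G ?z ?h - ?h) = (x (translate G ?z ?p) - x ?p) - (x (translate G ?z ?ah) - x ?ah)"
      proof -
        have "translate G ?z ?p = translate G ?z ?ah + translate G ?z ?h" by (rule translate_add)
        then show ?thesis
          using linear_into_add[OF lin ahD hD] linear_into_add[OF lin translate_in_D[OF zG(1) ahD] translate_in_D[OF zG(1) hD]]
            linear_into_diff[OF lin subspace_D translate_in_D[OF zG(1) hD] hD] by simp
      qed
      ultimately show ?thesis using \<delta>n by (simp add: algebra_simps)
    qed
    have "- \<epsilon> \<le> x a" if a: "a \<in> A0" for a
    proof -
      consider "a = translate G (z a) (h a) - h a" | "a = 3 *\<^sub>R f - translate G (k a) f" using *[OF a] by blast
      then show ?thesis
      proof cases
        case 1
        then show ?thesis using near[OF a] by simp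
      next
        case 2
        have kG: "k a \<in> carrier G" using *[OF a] by blast
        have "x (3 *\<^sub>R f - translate G (k a) f) = 3 - x (translate G (k a) f)"
          using linear_into_diff[OF lin subspace_D subspace_scale[OF subspace_D f_in_D] translate_in_D[OF kG f_in_D]] linear_into_scale[OF lin f_in_D] x(2)
          by simp
        moreover have "x (translate G (k a) f) \<le> 3" using a by (intro x_translate) blast
        ultimately have "0 \<le> x (3 *\<^sub>R f - translate G (k a) f)" by simp
        then have "0 \<le> x a" by (simp only: 2[symmetric])
        then show ?thesis using \<epsilon> by linarith
      qed
    qed
    then show "\<exists>K m. \<one> \<in> K \<and> K \<subseteq> carrier G \<and> A0 \<subseteq> dominated G K f \<and>
        positive_functional G (dominated G K f) m \<and> (\<forall>a\<in>A0. - \<epsilon> \<le> m a) \<and> m f = 1"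
      using x(1,2) A0(2) AD by (intro exI[of _ "carrier G"] exI[of _ x]) auto
  qed
  then obtain m where m: "positive_functional G D m" "\<forall>a\<in>A. 0 \<le> m a" "m f = 1" by blast
  have lin: "linear_into D m" by (rule positive_functional_linear[OF m(1)])
  show "\<exists>m. invariant_integral G f m"
  proof (rule integral_of_quotient_integral[OF N int f m(1)])
    fix z h assume z: "z \<in> Z" and h: "h \<in> D"
    show "m (translate G z h) = m h"
    proof (rule invariant_if_subinvariant[OF lin _ h])
      show "0 \<le> m (translate G z h' - h')" if "h' \<in> D" for h'
        using m(2) z that unfolding A_def by blast
    qed (use z in simp)
  next
    fix g assume g: "g \<in> carrier G"
    then have "3 *\<^sub>R f - translate G g f \<in> A" unfolding A_def by blast
    then have "0 \<le> m (3 *\<^sub>R f - translate G g f)" using m(2) by blast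
    then show "m (translate G g f) \<le> 3"
      using linear_into_diff[OF lin subspace_D subspace_scale[OF subspace_D f_in_D] translate_in_D[OF g f_in_D]] linear_into_scale[OF lin f_in_D] m(3)
      by simp
  next
    show "\<exists>g\<in>carrier G. m (translate G g f) \<noteq> 0"
      using m(3) by (intro bexI[of _ \<one>]) (auto simp: translate_one)
  qed
qed

text \<open>
  Separating the powers of one generator \<open>s\<close> from the products of the others shows that the number of \<open>n\<close>-fold
  products is polynomial in \<open>n\<close>.
\<close>

lemma card_set_power_commuting:
  fixes G (structure)
  assumes "group G" and comm: "\<And>u v. u \<in> Z \<Longrightarrow> v \<in> Z \<Longrightarrow> u \<otimes> v = v \<otimes> u" and Z: "subgroup Z G"
    and S: "finite S" "S \<subseteq> Z"
  shows "card (set_power G S n) \<le> (n + 1) ^ card S"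
  using S
proof (induction S arbitrary: n rule: finite_induct)
  case empty
  show ?case by (cases n) (auto simp: set_mult_def)
next
  case (insert s S)
  interpret group G by fact
  interpret Z: subgroup Z G by fact
  let ?P = "set_power G S" and ?Q = "set_power G (insert s S)"
  have s: "s \<in> Z" and SZ: "S \<subseteq> Z" using insert by auto
  have PZ: "?P i \<subseteq> Z" for i using Z SZ by (rule set_power_subset)
  have pow: "s [^] i \<in> Z" for i :: nat using s by (induction i) auto
  have "?Q n \<subseteq> (\<Union>i\<le>n. (\<lambda>v. s [^] i \<otimes> v) ` ?P (n - i))"
  proof (induction n)
    case 0
    show ?case by simp
  next
    case (Suc n)
    show ?case
    proof
      fix w assume "w \<in> ?Q (Suc n)"
      then obtain r v where rv: "r \<in> insert s S" "v \<in> ?Q n" "w = r \<otimes> v" by (auto simp: set_mult_def)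
      then obtain i u where iu: "i \<le> n" "u \<in> ?P (n - i)" "v = s [^] i \<otimes> u" using Suc.IH by blast
      have uZ: "u \<in> Z" using iu(2) PZ by blast
      show "w \<in> (\<Union>i\<le>Suc n. (\<lambda>v. s [^] i \<otimes> v) ` ?P (Suc n - i))"
      proof (cases "r = s")
        case True
        have "w = s \<otimes> s [^] i \<otimes> u" using rv iu True s pow[of i] uZ by (simp add: m_assoc)
        also have "s \<otimes> s [^] i = s [^] Suc i" using comm[OF s pow[of i]] by simp
        finally show ?thesis using iu by (intro UN_I[of "Suc i"]) auto
      next
        case False
        then have r: "r \<in> S" "r \<in> Z" using rv(1) SZ by auto
        have "w = (r \<otimes> s [^] i) \<otimes> u" using rv iu r pow[of i] uZ by (simp add: m_assoc)
        also have "\<dots> = s [^] i \<otimes> (r \<otimes> u)"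
          unfolding comm[OF r(2) pow[of i]] using r pow[of i] uZ by (simp add: m_assoc)
        finally have "w = s [^] i \<otimes> (r \<otimes> u)" .
        moreover have "r \<otimes> u \<in> ?P (Suc n - i)" using r(1) iu by (auto simp: set_mult_def Suc_diff_le)
        ultimately show ?thesis using iu(1) by (intro UN_I[of i]) auto
      qed
    qed
  qed
  moreover have finP: "finite (?P i)" for i using insert.hyps(1) by (rule finite_set_power)
  ultimately have "card (?Q n) \<le> card (\<Union>i\<le>n. (\<lambda>v. s [^] i \<otimes> v) ` ?P (n - i))"
    by (intro card_mono) auto
  also have "\<dots> \<le> (\<Sum>i\<le>n. card ((\<lambda>v. s [^] i \<otimes> v) ` ?P (n - i)))" by (intro card_UN_le) auto
  also have "\<dots> \<le> (\<Sum>i\<le>n. (n + 1) ^ card S)"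
  proof (rule sum_mono)
    fix i assume "i \<in> {..n}"
    have "card ((\<lambda>v. s [^] i \<otimes> v) ` ?P (n - i)) \<le> card (?P (n - i))" using finP by (rule card_image_le)
    also have "\<dots> \<le> (n - i + 1) ^ card S" by (rule insert.IH[OF SZ])
    also have "\<dots> \<le> (n + 1) ^ card S" by (intro power_mono) auto
    finally show "card ((\<lambda>v. s [^] i \<otimes> v) ` ?P (n - i)) \<le> (n + 1) ^ card S" .
  qed
  also have "\<dots> = (n + 1) ^ card (insert s S)" using insert.hyps by simp
  finally show ?case .
qed

lemma subexponential_in_commuting:
  fixes G (structure)
  assumes "group G" and comm: "\<And>u v. u \<in> Z \<Longrightarrow> v \<in> Z \<Longrightarrow> u \<otimes> v = v \<otimes> u" and Z: "subgroup Z G"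
  shows "subexponential_in G Z"
  unfolding subexponential_in_def
proof (intro allI impI, elim conjE)
  fix S assume S: "S \<subseteq> Z" "finite S" "S \<noteq> {}"
  let ?c = "\<lambda>n. real (card (set_power G S n))"
  have "(\<lambda>n. (root n 2 * root n (real n)) ^ card S) \<longlonglongrightarrow> (1 * 1) ^ card S"
    by (intro tendsto_intros LIMSEQ_root LIMSEQ_root_const) auto
  then have lim: "(\<lambda>n. (root n 2 * root n (real n)) ^ card S) \<longlonglongrightarrow> 1" by simp
  show "(\<lambda>n. root n (?c n)) \<longlonglongrightarrow> 1"
  proof (rule tendsto_sandwich[OF _ _ tendsto_const lim])
    show "\<forall>\<^sub>F n in sequentially. 1 \<le> root n (?c n)"
      using eventually_gt_at_top[of 0]
    proof eventually_elim
      case (elim n)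
      have "0 < card (set_power G S n)" using S by (simp add: card_gt_0_iff finite_set_power set_power_nonempty)
      then show ?case using elim by (simp add: real_root_ge_1_iff)
    qed
    show "\<forall>\<^sub>F n in sequentially. root n (?c n) \<le> (root n 2 * root n (real n)) ^ card S"
      using eventually_gt_at_top[of 0]
    proof eventually_elim
      case (elim n)
      have "card (set_power G S n) \<le> (n + 1) ^ card S"
        by (rule card_set_power_commuting[OF \<open>group G\<close> comm Z S(2,1)])
      also have "\<dots> \<le> (2 * n) ^ card S" using elim by (intro power_mono) auto
      finally have "?c n \<le> (2 * real n) ^ card S" by (metis of_nat_le_iff of_nat_mult of_nat_numeral of_nat_power)
      then have "root n (?c n) \<le> root n ((2 * real n) ^ card S)" using elim by simp
      also have "\<dots> = (root n 2 * root n (real n)) ^ card S"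
        using elim by (simp add: real_root_power real_root_mult power_mult_distrib)
      finally show ?case .
    qed
  qed
qed

lemma set_power_image:
  assumes "\<And>u v. u \<in> H \<Longrightarrow> v \<in> H \<Longrightarrow> \<theta> (u \<otimes>\<^bsub>K\<^esub> v) = \<theta> u \<otimes>\<^bsub>G\<^esub> \<theta> v" "\<theta> \<one>\<^bsub>K\<^esub> = \<one>\<^bsub>G\<^esub>"
    and "S \<subseteq> H" "\<And>n. set_power K S n \<subseteq> H"
  shows "set_power G (\<theta> ` S) n = \<theta> ` set_power K S n"
proof (induction n)
  case 0
  then show ?case using assms(2) by simp
next
  case (Suc n)
  have "set_power G (\<theta> ` S) (Suc n) = (\<Union>s\<in>S. \<Union>v\<in>set_power K S n. {\<theta> s \<otimes>\<^bsub>G\<^esub> \<theta> v})"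
    by (simp add: Suc set_mult_def)
  also have "\<dots> = (\<Union>s\<in>S. \<Union>v\<in>set_power K S n. {\<theta> (s \<otimes>\<^bsub>K\<^esub> v)})"
    using assms(3,4) by (intro SUP_cong refl) (auto simp: assms(1) subset_iff)
  also have "\<dots> = \<theta> ` set_power K S (Suc n)" by (auto simp: set_mult_def)
  finally show ?case .
qed

text \<open>
  The factor \<open>H\<close> is the kernel, and \<open>G\<close> maps onto the quotient by it.
\<close>

lemma integral_property_prod_subexponential:
  assumes "group G" "group H" and sub: "subexponential H" and int: "integral_property G"
  shows "integral_property (G \<times>\<times> H)"
proof -
  let ?P = "G \<times>\<times> H" and ?Z = "{\<one>\<^bsub>G\<^esub>} \<times> carrier H"
  interpret G: group G by fact
  interpret H: group H by fact
  interpret P: group ?P using assms by (intro DirProd_group)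
  have invP: "inv\<^bsub>?P\<^esub> (g, h) = (inv\<^bsub>G\<^esub> g, inv\<^bsub>H\<^esub> h)" if "g \<in> carrier G" "h \<in> carrier H" for g h
    using that assms by (simp add: inv_DirProd)
  have "subgroup ?Z ?P"
    by (rule P.subgroupI) (auto simp: invP)
  then have N: "?Z \<lhd> ?P"
    unfolding P.normal_inv_iff by (auto simp: invP)
  have growth: "subexponential_in ?P ?Z"
    unfolding subexponential_in_def
  proof (intro allI impI, elim conjE)
    fix S assume S: "S \<subseteq> ?Z" "finite S" "S \<noteq> {}"
    have S': "snd ` S \<subseteq> carrier H" using S(1) by auto
    have SS: "S = Pair \<one>\<^bsub>G\<^esub> ` (snd ` S)" using S(1) by force
    have "set_power ?P S n = Pair \<one>\<^bsub>G\<^esub> ` set_power H (snd ` S) n" for n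
      by (subst SS, rule set_power_image[where H = "carrier H"])
        (use S' set_power_subset[OF H.subgroup_self S'] in auto)
    then have "card (set_power ?P S n) = card (set_power H (snd ` S) n)" for n
      by (simp add: card_image inj_on_def)
    moreover have "(\<lambda>n. root n (real (card (set_power H (snd ` S) n)))) \<longlonglongrightarrow> 1"
      using sub S S' by (simp add: subexponential_def)
    ultimately show "(\<lambda>n. root n (real (card (set_power ?P S n)))) \<longlonglongrightarrow> 1" by simp
  qed
  have "integral_property (?P Mod ?Z)"
  proof (rule integral_property_hom_image[OF \<open>group G\<close> normal.factorgroup_is_group[OF N] _ _ int])
    let ?\<theta> = "\<lambda>g. ?Z #>\<^bsub>?P\<^esub> (g, \<one>\<^bsub>H\<^esub>)"
    have "(\<lambda>g. (g, \<one>\<^bsub>H\<^esub>)) \<in> hom G ?P" by (auto simp: hom_def)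
    from hom_compose[OF this normal.r_coset_hom_Mod[OF N]]
    show "?\<theta> \<in> hom G (?P Mod ?Z)" by (simp add: o_def)
    show "?\<theta> ` carrier G = carrier (?P Mod ?Z)"
    proof
      show "?\<theta> ` carrier G \<subseteq> carrier (?P Mod ?Z)" by (auto simp: carrier_FactGroup)
      show "carrier (?P Mod ?Z) \<subseteq> ?\<theta> ` carrier G"
      proof
        fix A assume "A \<in> carrier (?P Mod ?Z)"
        then obtain g h where gh: "g \<in> carrier G" "h \<in> carrier H" "A = ?Z #>\<^bsub>?P\<^esub> (g, h)"
          by (auto simp: carrier_FactGroup)
        have "?Z #>\<^bsub>?P\<^esub> (g, \<one>\<^bsub>H\<^esub>) = ?Z #>\<^bsub>?P\<^esub> (g, h)"
        proof (rule P.repr_independence[OF _ _ \<open>subgroup ?Z ?P\<close>])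
          show "(g, \<one>\<^bsub>H\<^esub>) \<in> carrier ?P" using gh by simp
          show "(g, h) \<in> ?Z #>\<^bsub>?P\<^esub> (g, \<one>\<^bsub>H\<^esub>)"
            using gh by (auto simp: r_coset_def intro!: bexI[of _ h])
        qed
        then show "A \<in> ?\<theta> ` carrier G" using gh by blast
      qed
    qed
  qed
  then show ?thesis
  proof (rule integral_property_subexponential_kernel[OF N growth, rotated])
    fix p assume "p \<in> carrier ?P"
    then obtain g h where gh: "p = (g, h)" "g \<in> carrier G" "h \<in> carrier H" by auto
    show "\<exists>z\<in>?Z. \<exists>c\<in>carrier ?P. p = z \<otimes>\<^bsub>?P\<^esub> c \<and> (\<forall>u\<in>?Z. u \<otimes>\<^bsub>?P\<^esub> c = c \<otimes>\<^bsub>?P\<^esub> u)"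
      using gh by (intro bexI[of _ "(\<one>\<^bsub>G\<^esub>, h)"] bexI[of _ "(g, \<one>\<^bsub>H\<^esub>)"]) auto
  qed
qed

lemma central_subgroup_normal:
  assumes "group G" "central_subgroup Z G" shows "Z \<lhd> G"
proof -
  interpret group G by fact
  interpret Z: subgroup Z G using assms(2) by (simp add: central_subgroup_def)
  have "x \<otimes>\<^bsub>G\<^esub> z \<otimes>\<^bsub>G\<^esub> inv\<^bsub>G\<^esub> x = z" if "x \<in> carrier G" "z \<in> Z" for x z
  proof -
    have "x \<otimes>\<^bsub>G\<^esub> z = z \<otimes>\<^bsub>G\<^esub> x" using assms(2) that by (simp add: central_subgroup_def)
    then show ?thesis using that by (simp add: m_assoc)
  qed
  then show ?thesis unfolding normal_inv_iff using Z.subgroup_axioms by simp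
qed

lemma integral_property_central_extension:
  fixes G (structure)
  assumes "group G" and Z: "central_subgroup Z G" and int: "integral_property (G Mod Z)"
  shows "integral_property G"
proof (rule integral_property_subexponential_kernel[OF central_subgroup_normal[OF assms(1,2)] _ _ int])
  interpret group G by fact
  interpret Z: subgroup Z G using Z by (simp add: central_subgroup_def)
  have comm: "z \<otimes> g = g \<otimes> z" if "z \<in> Z" "g \<in> carrier G" for z g
    using Z that by (simp add: central_subgroup_def)
  show "subexponential_in G Z"
    using comm by (intro subexponential_in_commuting[OF \<open>group G\<close> _ Z.subgroup_axioms]) auto
  show "\<exists>z\<in>Z. \<exists>c\<in>carrier G. g = z \<otimes> c \<and> (\<forall>u\<in>Z. u \<otimes> c = c \<otimes> u)" if "g \<in> carrier G" for g
    using that comm by (intro bexI[of _ \<one>] bexI[of _ g]) auto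
qed

section \<open>Quotients at the same universe, and the closure theorem\<close>

lemma fixed_point_property_hom_image:
  assumes Q: "group Q" and Q': "group Q'" and \<theta>: "\<theta> \<in> hom Q Q'" "\<theta> ` carrier Q = carrier Q'"
    and fpp: "fixed_point_property_cones TYPE('e::real_vector) Q"
  shows "fixed_point_property_cones TYPE('e) Q'"
  unfolding fixed_point_property_cones_def
proof (intro allI impI, elim conjE)
  fix E :: "'e set" and T C \<rho>
  assume tvs: "lc_hausdorff_tvs E T" "proper_convex_cone E C" "weakly_complete E T C"
    and rep: "cone_representation Q' E T C \<rho>" and lb: "locally_bounded_type Q' T C \<rho>"
    and cb: "cobounded_type Q' E T C \<rho>"
  interpret Q': group Q' by fact
  interpret \<theta>: group_hom Q Q' \<theta> using Q Q' \<theta>(1) by (simp add: group_hom_def group_hom_axioms_def)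
  let ?\<rho> = "\<lambda>g. \<rho> (\<theta> g)"
  have "\<rho> \<in> hom Q' (BijGroup E)"
    using rep by (simp add: cone_representation_def group_action_def group_hom_def group_hom_axioms_def)
  from hom_compose[OF \<theta>(1) this] have "group_action Q E ?\<rho>"
    using Q group_BijGroup by (simp add: group_action_def group_hom_def group_hom_axioms_def o_def)
  then have "cone_representation Q E T C ?\<rho>"
    using rep by (simp add: cone_representation_def)
  moreover have "orbit Q ?\<rho> x = orbit Q' \<rho> x" for x
    unfolding orbit_def \<theta>(2)[symmetric] by blast
  then have "locally_bounded_type Q T C ?\<rho>"
    using lb by (simp add: locally_bounded_type_def)
  moreover have "cobounded_type Q E T C ?\<rho>"
  proof -
    let ?l = "inv_into (carrier Q) \<theta>"
    have lift: "\<exists>gs. set gs \<subseteq> carrier Q \<and>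
        (\<forall>x. (\<Sum>g\<leftarrow>gs. dual_rep Q ?\<rho> g \<phi> x) = (\<Sum>g\<leftarrow>gs'. dual_rep Q' \<rho> g \<phi> x))"
      if gs': "set gs' \<subseteq> carrier Q'" for gs' \<phi>
    proof -
      have l: "?l g \<in> carrier Q" "\<theta> (?l g) = g" if "g \<in> set gs'" for g
      proof -
        have "g \<in> \<theta> ` carrier Q" using that gs' \<theta>(2) by blast
        then show "?l g \<in> carrier Q" "\<theta> (?l g) = g" by (rule inv_into_into, rule f_inv_into_f)
      qed
      have "dual_rep Q ?\<rho> (?l g) \<phi> x = dual_rep Q' \<rho> g \<phi> x" if "g \<in> set gs'" for g x
        using l[OF that] by (simp add: dual_rep_def)
      then have "(\<Sum>g\<leftarrow>map ?l gs'. dual_rep Q ?\<rho> g \<phi> x) = (\<Sum>g\<leftarrow>gs'. dual_rep Q' \<rho> g \<phi> x)" for x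
        by (simp add: o_def cong: map_cong)
      moreover have "set (map ?l gs') \<subseteq> carrier Q" using l(1) by auto
      ultimately show ?thesis by blast
    qed
    obtain \<phi> where \<phi>: "\<phi> \<in> top_dual E T" and cob: "\<And>\<psi>. \<psi> \<in> top_dual E T \<Longrightarrow> \<exists>gs. set gs \<subseteq> carrier Q' \<and>
        dual_le C \<psi> (\<lambda>x. \<Sum>g\<leftarrow>gs. dual_rep Q' \<rho> g \<phi> x) \<and>
        dual_le C (\<lambda>x. - \<psi> x) (\<lambda>x. \<Sum>g\<leftarrow>gs. dual_rep Q' \<rho> g \<phi> x)"
      using cb unfolding cobounded_type_def by blast
    show ?thesis
      unfolding cobounded_type_def
    proof (intro bexI[OF _ \<phi>] ballI)
      fix \<psi> assume \<psi>: "\<psi> \<in> top_dual E T"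
      obtain gs' where gs': "set gs' \<subseteq> carrier Q'"
        "dual_le C \<psi> (\<lambda>x. \<Sum>g\<leftarrow>gs'. dual_rep Q' \<rho> g \<phi> x)"
        "dual_le C (\<lambda>x. - \<psi> x) (\<lambda>x. \<Sum>g\<leftarrow>gs'. dual_rep Q' \<rho> g \<phi> x)"
        using cob[OF \<psi>] by blast
      obtain gs where gs: "set gs \<subseteq> carrier Q"
        "\<forall>x. (\<Sum>g\<leftarrow>gs. dual_rep Q ?\<rho> g \<phi> x) = (\<Sum>g\<leftarrow>gs'. dual_rep Q' \<rho> g \<phi> x)"
        using lift[OF gs'(1)] by blast
      show "\<exists>gs. set gs \<subseteq> carrier Q \<and> dual_le C \<psi> (\<lambda>x. \<Sum>g\<leftarrow>gs. dual_rep Q ?\<rho> g \<phi> x) \<and>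
        dual_le C (\<lambda>x. - \<psi> x) (\<lambda>x. \<Sum>g\<leftarrow>gs. dual_rep Q ?\<rho> g \<phi> x)"
        using gs gs'(2,3) by (intro exI[of _ gs]) simp
    qed
  qed
  ultimately have "\<exists>x\<in>C. x \<noteq> 0 \<and> (\<forall>g\<in>carrier Q. ?\<rho> g x = x)"
    using fpp tvs unfolding fixed_point_property_cones_def by blast
  then show "\<exists>x\<in>C. x \<noteq> 0 \<and> (\<forall>g\<in>carrier Q'. \<rho> g x = x)"
    unfolding \<theta>(2)[symmetric] by simp
qed

text \<open>
  Elements of the quotient are sets, so the universe is not known to be large for their type. Choosing a
  representative of each coset replaces the quotient by an isomorphic group with elements of type \<open>'g\<close>.
\<close>

lemma quotient_fixed_point_property_imp_integral_property:
  fixes G :: "('g, 'm) monoid_scheme" (structure)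
  assumes N: "N \<lhd> G" and large: "large_universe TYPE('g) TYPE('u::real_vector)"
    and fpp: "fixed_point_property_cones TYPE('u) (G Mod N)"
  shows "integral_property (G Mod N)"
proof -
  interpret normal N G by fact
  let ?Q = "G Mod N"
  have Q: "group ?Q" by (rule factorgroup_is_group)
  interpret Q: group ?Q by (rule Q)
  define r where "r A = (SOME x. x \<in> A)" for A :: "'g set"
  have coset: "A = N #> r A" if A: "A \<in> carrier ?Q" for A
  proof -
    obtain k where k: "k \<in> carrier G" "A = N #> k" using A unfolding carrier_FactGroup by blast
    have "r A \<in> N #> k" unfolding r_def k(2) using rcos_self[OF k(1) subgroup_axioms] by (rule someI)
    then show ?thesis using k repr_independence subgroup_axioms by blast
  qed
  then have inj: "inj_on r (carrier ?Q)" by (intro inj_onI) metis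
  let ?R = "image_group r ?Q"
  have R: "group ?R" using inj by (rule Q.inj_imp_image_group_is_group)
  have iso: "r \<in> iso ?Q ?R" using inj by (rule inj_imp_image_group_iso)
  then have iso': "inv_into (carrier ?Q) r \<in> iso ?R ?Q" by (rule Q.iso_set_sym)
  have "fixed_point_property_cones TYPE('u) ?R"
    using iso by (intro fixed_point_property_hom_image[OF Q R _ _ fpp]) (auto simp: iso_def bij_betw_def)
  then have "integral_property ?R"
    by (rule fixed_point_property_imp_integral_property[OF R large])
  then show ?thesis
    using iso' by (intro integral_property_hom_image[OF R Q]) (auto simp: iso_def bij_betw_def)
qed

theorem theorem8:
  fixes G :: "'g monoid" and H :: "'h monoid"
    and U :: "'u::real_vector itself" and V :: "'v::real_vector itself"
  assumes "group G"
    and "large_universe TYPE('g) U"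
  shows
    "(\<forall>N. N \<lhd> G \<and> fixed_point_property_cones U G
        \<longrightarrow> fixed_point_property_cones V (G Mod N)) \<and>
     (\<forall>K. subgroup K G \<and> fixed_point_property_cones U G
        \<longrightarrow> fixed_point_property_cones V (G\<lparr>carrier := K\<rparr>)) \<and>
     (\<forall>\<S>. (\<forall>K\<in>\<S>. subgroup K G) \<and> directed_by_inclusion \<S> \<and> \<Union>\<S> = carrier G \<and>
           (\<forall>K\<in>\<S>. fixed_point_property_cones U (G\<lparr>carrier := K\<rparr>))
        \<longrightarrow> fixed_point_property_cones V G) \<and>
     (group H \<and> subexponential H \<and> fixed_point_property_cones U G
        \<longrightarrow> fixed_point_property_cones V (G \<times>\<times> H)) \<and>
     (\<forall>Z. central_subgroup Z G \<and> fixed_point_property_cones U (G Mod Z)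
        \<longrightarrow> fixed_point_property_cones V G) \<and>
     (\<forall>N. N \<lhd> G \<and>
           (finite N \<and> fixed_point_property_cones U (G Mod N) \<or>
            finite (carrier (G Mod N)) \<and> fixed_point_property_cones U (G\<lparr>carrier := N\<rparr>))
        \<longrightarrow> fixed_point_property_cones V G)"
proof -
  interpret group G by fact
  have large: "large_universe TYPE('g) TYPE('u)" using assms(2) by (simp add: large_universe_def)
  have int: "integral_property Q" if "group Q" "fixed_point_property_cones U Q" for Q :: "'g monoid"
    using fixed_point_property_imp_integral_property[OF that(1) large] that(2)
    by (simp add: fixed_point_property_cones_def)
  have int_quot: "integral_property (G Mod N)" if "N \<lhd> G" "fixed_point_property_cones U (G Mod N)" for N
    using quotient_fixed_point_property_imp_integral_property[OF that(1) large] that(2)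
    by (simp add: fixed_point_property_cones_def)
  have int_sub: "integral_property (G\<lparr>carrier := K\<rparr>)"
    if "subgroup K G" "fixed_point_property_cones U (G\<lparr>carrier := K\<rparr>)" for K
    using that subgroup_imp_group by (intro int)
  have fpp: "fixed_point_property_cones V G" if "integral_property G"
    using integral_property_imp_fixed_point_property[OF assms(1) that, where 'e = 'v]
    by (simp add: fixed_point_property_cones_def)
  show ?thesis
  proof (intro conjI allI impI; elim conjE)
    fix N assume N: "N \<lhd> G" and G: "fixed_point_property_cones U G"
    have "integral_property (G Mod N)"
      using normal.r_coset_hom_Mod[OF N] int[OF assms(1) G]
      by (intro integral_property_hom_image[OF assms(1) normal.factorgroup_is_group[OF N]])
        (auto simp: carrier_FactGroup)
    then show "fixed_point_property_cones V (G Mod N)"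
      using integral_property_imp_fixed_point_property[OF normal.factorgroup_is_group[OF N], where 'e = 'v]
      by (simp add: fixed_point_property_cones_def)
  next
    fix K assume K: "subgroup K G" and G: "fixed_point_property_cones U G"
    then show "fixed_point_property_cones V (G\<lparr>carrier := K\<rparr>)"
      using integral_property_imp_fixed_point_property[OF subgroup_imp_group[OF K]
          integral_property_subgroup[OF assms(1) K int[OF assms(1) G]], where 'e = 'v]
      by (simp add: fixed_point_property_cones_def)
  next
    fix \<S> assume "\<forall>K\<in>\<S>. subgroup K G" "directed_by_inclusion \<S>" "\<Union>\<S> = carrier G"
      "\<forall>K\<in>\<S>. fixed_point_property_cones U (G\<lparr>carrier := K\<rparr>)"
    then show "fixed_point_property_cones V G"
      by (intro fpp integral_property_directed_union[OF assms(1), of \<S>] int_sub) auto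
  next
    assume "group H" "subexponential H" "fixed_point_property_cones U G"
    then show "fixed_point_property_cones V (G \<times>\<times> H)"
      using integral_property_imp_fixed_point_property[OF DirProd_group[OF assms(1)]
          integral_property_prod_subexponential[OF assms(1) _ _ int[OF assms(1)]], where 'e = 'v]
      by (simp add: fixed_point_property_cones_def)
  next
    fix Z assume "central_subgroup Z G" "fixed_point_property_cones U (G Mod Z)"
    then show "fixed_point_property_cones V G"
      by (intro fpp integral_property_central_extension[OF assms(1)] int_quot central_subgroup_normal[OF assms(1)])
  next
    fix N assume N: "N \<lhd> G" and disj: "finite N \<and> fixed_point_property_cones U (G Mod N) \<or>
      finite (carrier (G Mod N)) \<and> fixed_point_property_cones U (G\<lparr>carrier := N\<rparr>)"
    from disj show "fixed_point_property_cones V G"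
    proof (elim disjE conjE)
      assume "finite N" "fixed_point_property_cones U (G Mod N)"
      then show ?thesis by (intro fpp integral_property_finite_kernel[OF N] int_quot N)
    next
      assume "finite (carrier (G Mod N))" "fixed_point_property_cones U (G\<lparr>carrier := N\<rparr>)"
      then show ?thesis
        using N by (intro fpp integral_property_finite_quotient[OF N] int_sub normal_imp_subgroup)
    qed
  qed
qed

end
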